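(* Let $\{H_\omega\}_{\omega\in\Omega}$ be the family of selfadjoint operators in $L_2(a,b)$ generated (as described in the context) by $$-\frac{d^2}{dx^2}+v(x)+\sum_{n\in I}\omega(n)f_n(x).$$ Assume there are infinitely many distinct indices $n_i\in I$, $i\in\mathbb{N}$, and pairwise disjoint intervals $(c_i,d_i)$ with $[c_i,d_i]\subset(a,b)$, $i\in\mathbb{N}$, such that $f_{n_i}(x)>0$ for almost all $x\in(c_i,d_i)$ and $f_{n_i}(x)=0$ for $x\notin(c_i,d_i)$. Assume that the probability distributions $p_{n_i}$, $i\in\mathbb{N}$, are continuous (i.e. $p_{n_i}(\{r\})=0$ for every $r\in\mathbb{R}$). Let $(\tilde a,\tilde b)\subset(a,b)$ be a subinterval, bounded or unbounded, such that $(c_i,d_i)\cap(\tilde a,\tilde b)=\emptyset$ for some $i\in\mathbb{N}$, and let $\tilde H_\omega$ be the selfadjoint operator in $L_2(\tilde a,\tilde b)$ generated in the same way by the same differential expression (restricted to $(\tilde a,\tilde b)$). Then for $\mathbb{P}$-almost every $\omega\in\Omega$ the operators $H_\omega$ and $\tilde H_\omega$ have no common eigenvalue: $$\mathbb{P}\bigl(\{\omega\in\Omega:\sigma_p(\tilde H_\omega)\cap\sigma_p(H_\omega)\neq\emptyset\}\bigr)=0.$$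
   Context: Let $-\infty\le a<b\le\infty$. Probability space: fix $n_1<n_2$ in $\mathbb{Z}\cup\{\pm\infty\}$ and let $I=\{n\in\mathbb{Z}:n_1<n<n_2\}$. Let $\{p_n\}_{n\in I}$ be arbitrary Borel probability measures on $\mathbb{R}$, and let $\Omega=(\mathbb{R}^I,\mathcal{F},\mathbb{P})$, where $\mathbb{R}^I$ is the space of real sequences $\omega=\{\omega(n)\}_{n\in I}$, $\mathcal{F}$ is the product $\sigma$-algebra generated by the cylinder sets $\{\omega:\omega(i_1)\in A_1,\dots,\omega(i_k)\in A_k\}$ with $i_1,\dots,i_k\in I$ and $A_1,\dots,A_k\subset\mathbb{R}$ Borel, and $\mathbb{P}=\times_{n\in I}p_n$ is the product measure. The operators $H_\omega$: let $v$ and $f_n$ ($n\in I$) be real valued, measurable, locally $L_1$ functions on $(a,b)$, and put $q_\omega(x)=v(x)+\sum_{n\in I}\omega(n)f_n(x)$; it is assumed that for every $\omega$ this is a well defined real valued locally integrable function on $(a,b)$. Let $\tau_\omega u=-u''+q_\omega u$. It is assumed that, at each of the endpoints $a$ and $b$, $\tau_\omega$ is either regular or in the limit point case. Let $D_{\tau_\omega}$ be the set of $u\in L_2(a,b)$ with $u,u'$ absolutely continuous in $(a,b)$ (locally) and $\tau_\omega u\in L_2(a,b)$. For fixed real angles $\alpha,\beta$ not depending on $\omega$, $H_\omega u=\tau_\omega u$ with domain the set of $u\in D_{\tau_\omega}$ satisfying $u(a)\cos\alpha+u'(a)\sin\alpha=0$ if $\tau_\omega$ is regular at $a$, and $u(b)\cos\beta+u'(b)\sin\beta=0$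 if $\tau_\omega$ is regular at $b$ (no condition at a limit point endpoint). It is assumed that $H_\omega$ is selfadjoint for all $\omega\in\Omega$. The operator $\tilde H_\omega$ in $L_2(\tilde a,\tilde b)$: for fixed real angles $\tilde\alpha,\tilde\beta$ not depending on $\omega$, $\tilde H_\omega u=\tau_\omega u$ with domain the set of $u\in L_2(\tilde a,\tilde b)$ with $u,u'$ absolutely continuous in $(\tilde a,\tilde b)$ (locally) and $\tau_\omega u\in L_2(\tilde a,\tilde b)$, satisfying $u(\tilde a)\cos\tilde\alpha+u'(\tilde a)\sin\tilde\alpha=0$ if $\tau_\omega$ on $(\tilde a,\tilde b)$ is regular at $\tilde a$, and $u(\tilde b)\cos\tilde\beta+u'(\tilde b)\sin\tilde\beta=0$ if $\tau_\omega$ on $(\tilde a,\tilde b)$ is regular at $\tilde b$ (no condition at a limit point endpoint). For an operator $H$, $\sigma_p(H)=\{r\in\mathbb{R}:H\varphi=r\varphi\text{ for some }\varphi\not\equiv0\}$ denotes its set of eigenvalues. *)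

theory Defs
  imports "HOL-Probability.Probability" "HOL-Library.Extended"
begin

no_notation Minf (\<open>-\<infinity>\<close>) and Pinf (\<open>\<infinity>\<close>)

section \<open>The index set and the random potential\<close>

definition index_set :: "int extended \<Rightarrow> int extended \<Rightarrow> int set" where
  "index_set n1 n2 = {n. n1 < Fin n \<and> Fin n < n2}"

definition random_potential ::
    "int set \<Rightarrow> (real \<Rightarrow> real) \<Rightarrow> (int \<Rightarrow> real \<Rightarrow> real) \<Rightarrow> (int \<Rightarrow> real) \<Rightarrow> real \<Rightarrow> real" where
  "random_potential I v f \<omega> x = v x + (\<Sum>\<^sub>\<infinity>n\<in>I. \<omega> n * f n x)"

section \<open>Function spaces on an open interval\<close>

text \<open>
  Functions are total; only their restriction to the open interval \<open>einterval a b\<close> matters.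
  Elements of \<open>L\<^sub>2\<close> are represented by functions, to be identified when they agree almost everywhere.
\<close>

definition locally_L1 :: "ereal \<Rightarrow> ereal \<Rightarrow> (real \<Rightarrow> real) \<Rightarrow> bool" where
  "locally_L1 a b g \<longleftrightarrow>
     set_borel_measurable lebesgue (einterval a b) g \<and>
     (\<forall>c d. a < ereal c \<and> c \<le> d \<and> ereal d < b \<longrightarrow> set_integrable lebesgue {c..d} g)"

definition L2 :: "real set \<Rightarrow> (real \<Rightarrow> complex) set" where
  "L2 S = {u. set_borel_measurable lebesgue S u \<and>
              set_integrable lebesgue S (\<lambda>x. (cmod (u x))\<^sup>2)}"

definition L2_inner :: "real set \<Rightarrow> (real \<Rightarrow> complex) \<Rightarrow> (real \<Rightarrow> complex) \<Rightarrow> complex" where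
  "L2_inner S u w = (LINT x:S|lebesgue. u x * cnj (w x))"

definition ae_eq_on :: "real set \<Rightarrow> (real \<Rightarrow> complex) \<Rightarrow> (real \<Rightarrow> complex) \<Rightarrow> bool" where
  "ae_eq_on S u w \<longleftrightarrow> (AE x in lebesgue. x \<in> S \<longrightarrow> u x = w x)"

text \<open>A pair \<open>(x, y)\<close> in \<open>P\<close> encodes the interval with endpoints \<open>x \<le> y\<close>.\<close>

definition abs_continuous_on :: "real \<Rightarrow> real \<Rightarrow> (real \<Rightarrow> complex) \<Rightarrow> bool" where
  "abs_continuous_on c d u \<longleftrightarrow>
     (\<forall>\<epsilon>>0. \<exists>\<delta>>0. \<forall>P. finite P \<and>
        (\<forall>(x, y)\<in>P. c \<le> x \<and> x \<le> y \<and> y \<le> d) \<and>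
        disjoint_family_on (\<lambda>(x, y). {x<..<y}) P \<and>
        (\<Sum>(x, y)\<in>P. y - x) < \<delta> \<longrightarrow>
        (\<Sum>(x, y)\<in>P. cmod (u y - u x)) < \<epsilon>)"

definition locally_AC :: "ereal \<Rightarrow> ereal \<Rightarrow> (real \<Rightarrow> complex) \<Rightarrow> bool" where
  "locally_AC a b u \<longleftrightarrow>
     (\<forall>c d. a < ereal c \<and> c \<le> d \<and> ereal d < b \<longrightarrow> abs_continuous_on c d u)"

section \<open>The differential expression\<close>

definition D1 :: "(real \<Rightarrow> complex) \<Rightarrow> real \<Rightarrow> complex" where
  "D1 u x = vector_derivative u (at x)"

text \<open>
  When \<open>u'\<close> is locally absolutely continuous, \<open>u''\<close> exists almost everywhere;
  on the exceptional null set \<open>D1 (D1 u)\<close> has an irrelevant value.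
\<close>

definition tau :: "(real \<Rightarrow> real) \<Rightarrow> (real \<Rightarrow> complex) \<Rightarrow> real \<Rightarrow> complex" where
  "tau q u x = - D1 (D1 u) x + complex_of_real (q x) * u x"

definition AC2 :: "ereal \<Rightarrow> ereal \<Rightarrow> (real \<Rightarrow> complex) set" where
  "AC2 a b = {u. (\<forall>x\<in>einterval a b. u differentiable (at x)) \<and>
                 locally_AC a b u \<and> locally_AC a b (D1 u)}"

definition regular_left :: "ereal \<Rightarrow> ereal \<Rightarrow> (real \<Rightarrow> real) \<Rightarrow> bool" where
  "regular_left a b q \<longleftrightarrow>
     a \<noteq> -\<infinity> \<and> (\<exists>c\<in>einterval a b. set_integrable lebesgue (einterval a (ereal c)) q)"

definition regular_right :: "ereal \<Rightarrow> ereal \<Rightarrow> (real \<Rightarrow> real) \<Rightarrow> bool" where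
  "regular_right a b q \<longleftrightarrow>
     b \<noteq> \<infinity> \<and> (\<exists>c\<in>einterval a b. set_integrable lebesgue (einterval (ereal c) b) q)"

text \<open>
  Limit point case (Weyl): for every complex \<open>z\<close> the equation \<open>\<tau> u = z u\<close> has a solution
  that is not square integrable near the endpoint.
\<close>

definition limit_point_left :: "ereal \<Rightarrow> ereal \<Rightarrow> (real \<Rightarrow> real) \<Rightarrow> bool" where
  "limit_point_left a b q \<longleftrightarrow>
     (\<forall>z. \<exists>u\<in>AC2 a b. ae_eq_on (einterval a b) (tau q u) (\<lambda>x. z * u x) \<and>
        (\<forall>c\<in>einterval a b. u \<notin> L2 (einterval a (ereal c))))"

definition limit_point_right :: "ereal \<Rightarrow> ereal \<Rightarrow> (real \<Rightarrow> real) \<Rightarrow> bool" where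
  "limit_point_right a b q \<longleftrightarrow>
     (\<forall>z. \<exists>u\<in>AC2 a b. ae_eq_on (einterval a b) (tau q u) (\<lambda>x. z * u x) \<and>
        (\<forall>c\<in>einterval a b. u \<notin> L2 (einterval (ereal c) b)))"

section \<open>The Sturm-Liouville operators\<close>

definition max_domain :: "ereal \<Rightarrow> ereal \<Rightarrow> (real \<Rightarrow> real) \<Rightarrow> (real \<Rightarrow> complex) set" where
  "max_domain a b q =
     {u \<in> AC2 a b. u \<in> L2 (einterval a b) \<and> tau q u \<in> L2 (einterval a b)}"

text \<open>
  At a regular endpoint \<open>e\<close>, \<open>u(e)\<close> and \<open>u'(e)\<close> are the one-sided limits of \<open>u\<close> and \<open>u'\<close>;
  \<open>F\<close> is the filter of one-sided approach to \<open>e\<close>.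
\<close>

definition boundary_condition :: "real filter \<Rightarrow> real \<Rightarrow> (real \<Rightarrow> complex) \<Rightarrow> bool" where
  "boundary_condition F \<theta> u \<longleftrightarrow>
     (\<exists>y y'. (u \<longlongrightarrow> y) F \<and> (D1 u \<longlongrightarrow> y') F \<and>
        y * complex_of_real (cos \<theta>) + y' * complex_of_real (sin \<theta>) = 0)"

text \<open>
  The operator acts as \<open>tau q\<close> on this domain; the angle at an endpoint that is not regular
  is not used.
\<close>

definition SL_domain ::
    "ereal \<Rightarrow> ereal \<Rightarrow> real \<Rightarrow> real \<Rightarrow> (real \<Rightarrow> real) \<Rightarrow> (real \<Rightarrow> complex) set" where
  "SL_domain a b \<alpha> \<beta> q =
     {u \<in> max_domain a b q.
        (regular_left a b q \<longrightarrow> boundary_condition (at_right (real_of_ereal a)) \<alpha> u) \<and>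
        (regular_right a b q \<longrightarrow> boundary_condition (at_left (real_of_ereal b)) \<beta> u)}"

text \<open>
  For an operator \<open>T\<close> with domain \<open>\<D>\<close> in \<open>L\<^sub>2\<close> over \<open>S\<close>: \<open>(g, h)\<close> lies in the graph of the adjoint iff
  \<open>\<langle>T u, g\<rangle> = \<langle>u, h\<rangle>\<close> for all \<open>u\<close> in \<open>\<D>\<close>, and selfadjointness says that \<open>\<D>\<close> is dense and the graphs of
  \<open>T\<close> and of its adjoint coincide up to equality almost everywhere.
\<close>

definition selfadjoint ::
    "real set \<Rightarrow> (real \<Rightarrow> complex) set \<Rightarrow> ((real \<Rightarrow> complex) \<Rightarrow> real \<Rightarrow> complex) \<Rightarrow> bool" where
  "selfadjoint S \<D> T \<longleftrightarrow>
     (\<forall>g\<in>L2 S. \<forall>\<epsilon>>0. \<exists>u\<in>\<D>. (LINT x:S|lebesgue. (cmod (g x - u x))\<^sup>2) < \<epsilon>) \<and>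
     (\<forall>g\<in>L2 S. \<forall>h\<in>L2 S.
        (\<forall>u\<in>\<D>. L2_inner S (T u) g = L2_inner S u h) \<longleftrightarrow>
        (\<exists>u\<in>\<D>. ae_eq_on S u g \<and> ae_eq_on S (T u) h))"

definition eigenvalues ::
    "real set \<Rightarrow> (real \<Rightarrow> complex) set \<Rightarrow> ((real \<Rightarrow> complex) \<Rightarrow> real \<Rightarrow> complex) \<Rightarrow> real set" where
  "eigenvalues S \<D> T =
     {r. \<exists>\<phi>\<in>\<D>. \<not> ae_eq_on S \<phi> (\<lambda>x. 0) \<and>
           ae_eq_on S (T \<phi>) (\<lambda>x. complex_of_real r * \<phi> x)}"

definition SL_selfadjoint ::
    "ereal \<Rightarrow> ereal \<Rightarrow> real \<Rightarrow> real \<Rightarrow> (real \<Rightarrow> real) \<Rightarrow> bool" where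
  "SL_selfadjoint a b \<alpha> \<beta> q \<longleftrightarrow> selfadjoint (einterval a b) (SL_domain a b \<alpha> \<beta> q) (tau q)"

definition SL_eigenvalues ::
    "ereal \<Rightarrow> ereal \<Rightarrow> real \<Rightarrow> real \<Rightarrow> (real \<Rightarrow> real) \<Rightarrow> real set" where
  "SL_eigenvalues a b \<alpha> \<beta> q = eigenvalues (einterval a b) (SL_domain a b \<alpha> \<beta> q) (tau q)"

end

theory Submission
  imports Defs
begin

text \<open>
  Fix an index \<open>j\<close> whose interval \<open>(c\<^sub>j, d\<^sub>j)\<close> misses \<open>(a', b')\<close>, fix all coordinates of \<open>\<omega>\<close> except
  \<open>t = \<omega>(j)\<close>, and let \<open>t\<close> vary. The eigenvalues on \<open>(a', b')\<close> do not depend on \<open>t\<close>, and they form a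
  countable set because eigenfunctions of different eigenvalues are orthogonal. For a fixed real \<open>r\<close>, let
  \<open>u\<^sub>t\<close> be an eigenfunction on \<open>(a, b)\<close> with eigenvalue \<open>r\<close> for the coupling \<open>t\<close>. Outside \<open>(c\<^sub>j, d\<^sub>j)\<close> the
  equation is the same for all \<open>t\<close>, so the Wronskian of \<open>u\<^sub>t\<close> and \<open>u\<^sub>s\<close> is constant on both sides of it;
  it tends to \<open>0\<close> at \<open>a\<close> and at \<open>b\<close>, hence vanishes at \<open>c\<^sub>j\<close> and \<open>d\<^sub>j\<close>, and
  \<open>(t - s) \<integral> f\<^sub>j u\<^sub>t u\<^sub>s = 0\<close>. Thus the \<open>u\<^sub>t\<close> are orthogonal with respect to the weight \<open>f\<^sub>j\<close>, and only
  countably many \<open>t\<close> occur. So every section of the event in direction \<open>j\<close> is countable, hence null for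
  the atomless \<open>p\<^sub>j\<close>, and Fubini applies.

  The event is measurable for the product \<open>\<sigma>\<close>-algebra itself: \<open>r\<close> is an eigenvalue iff for some \<open>\<theta>\<close>
  the solution with initial data \<open>(cos \<theta>, sin \<theta>)\<close> at an interior point satisfies the boundary conditions and
  has \<open>\<integral> u\<^sup>2 \<le> N\<close> over all compact subintervals, for some \<open>N\<close>. For fixed \<open>N\<close> these are countably many
  conditions that are closed in \<open>(r, \<theta>)\<close> and measurable in \<open>\<omega>\<close>, and the solvability of such a family over
  a compact set of parameters is a countable condition.
\<close>

section \<open>Absolutely continuous functions\<close>

text \<open>The coefficients are only locally integrable, and the operator domains use the
  epsilon-delta form of absolute continuity. The arguments therefore run on the integrated form of
  u' = w, w' = (q - r) u, once absolutely continuous functions are known to be exactly the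
  indefinite integrals. Since q, r and the angles are real, complex eigenfunctions yield real ones.
  At a regular endpoint the boundary condition makes Wronskians vanish. At a limit point endpoint
  the definition only provides, for each parameter, some solution that is not square integrable;
  variation of constants shows that a Wronskian not tending to 0 would make this solution square
  integrable. The two eigenvalue parameters in that argument may differ, which gives orthogonality
  of eigenfunctions, or coincide, as in the coupling argument. Countable sections alone do not make
  a set null: Fubini's theorem needs a measurable event, and this one quantifies over uncountably
  many r. Hence the detailed study of how solutions depend continuously on r and the initial data,
  and measurably on \<omega>.\<close>

definition short_sums :: "real \<Rightarrow> real \<Rightarrow> (real \<times> real) set \<Rightarrow> bool" where
  "short_sums c d P \<longleftrightarrow> finite P \<and> (\<forall>(x, y)\<in>P. c \<le> x \<and> x < y \<and> y \<le> d) \<and>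
     disjoint_family_on (\<lambda>(x, y). {x<..<y}) P"

definition inc_sum :: "(real \<Rightarrow> real) \<Rightarrow> (real \<times> real) set \<Rightarrow> real" where
  "inc_sum g P = (\<Sum>(x, y)\<in>P. g y - g x)"

abbreviation var_sum :: "(real \<Rightarrow> real) \<Rightarrow> (real \<times> real) set \<Rightarrow> real" where
  "var_sum g P \<equiv> (\<Sum>(x, y)\<in>P. \<bar>g y - g x\<bar>)"

abbreviation total_length :: "(real \<times> real) set \<Rightarrow> real" where
  "total_length P \<equiv> (\<Sum>(x, y)\<in>P. y - x)"

definition real_AC :: "real \<Rightarrow> real \<Rightarrow> (real \<Rightarrow> real) \<Rightarrow> bool" where
  "real_AC c d g \<longleftrightarrow> abs_continuous_on c d (\<lambda>x. complex_of_real (g x))"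

lemma real_AC_iff:
  "real_AC c d g \<longleftrightarrow> (\<forall>\<epsilon>>0. \<exists>\<delta>>0. \<forall>P. short_sums c d P \<and> total_length P < \<delta> \<longrightarrow>
     var_sum g P < \<epsilon>)" (is "?L \<longleftrightarrow> ?R")
proof
  assume L: ?L
  show ?R
  proof (intro allI impI)
    fix e :: real assume "e > 0"
    then obtain \<delta> where d: "\<delta> > 0" "\<And>P. finite P \<and>
        (\<forall>(x, y)\<in>P. c \<le> x \<and> x \<le> y \<and> y \<le> d) \<and>
        disjoint_family_on (\<lambda>(x, y). {x<..<y}) P \<and>
        total_length P < \<delta> \<Longrightarrow>
        (\<Sum>(x, y)\<in>P. cmod (complex_of_real (g y) - complex_of_real (g x))) < e"
      using L unfolding real_AC_def abs_continuous_on_def by meson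
    have "var_sum g P < e" if P: "short_sums c d P" "total_length P < \<delta>" for P
    proof -
      have "(\<Sum>(x, y)\<in>P. cmod (complex_of_real (g y) - complex_of_real (g x))) < e"
        using P by (intro d(2)) (auto simp: short_sums_def)
      then show ?thesis
        by (simp flip: of_real_diff)
    qed
    then show "\<exists>\<delta>>0. \<forall>P. short_sums c d P \<and> total_length P < \<delta> \<longrightarrow> var_sum g P < e"
      using d(1) by blast
  qed
next
  assume R: ?R
  show ?L unfolding real_AC_def abs_continuous_on_def
  proof (intro allI impI)
    fix e :: real assume "e > 0"
    then obtain \<delta> where d: "\<delta> > 0" "\<And>P. short_sums c d P \<Longrightarrow> total_length P < \<delta> \<Longrightarrow> var_sum g P < e"
      using R by meson
    have "(\<Sum>(x, y)\<in>P. cmod (complex_of_real (g y) - complex_of_real (g x))) < e" if P: "finite P"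
        "\<forall>(x, y)\<in>P. c \<le> x \<and> x \<le> y \<and> y \<le> d"
        "disjoint_family_on (\<lambda>(x, y). {x<..<y}) P"
        "total_length P < \<delta>" for P
    proof -
      define P' where "P' = {(x,y)\<in>P. x < y}"
      have sub: "P' \<subseteq> P" by (auto simp: P'_def)
      have eq: "(\<Sum>(x, y)\<in>P'. f x y) = (\<Sum>(x, y)\<in>P. f x y)" if "\<And>x. f x x = 0" for f :: "real \<Rightarrow> real \<Rightarrow> real"
        using P(1,2) that by (intro sum.mono_neutral_left) (fastforce simp: P'_def)+
      have "short_sums c d P'"
        unfolding short_sums_def using P sub finite_subset[OF sub]
        by (auto simp: P'_def intro: disjoint_family_on_mono)
      then have "var_sum g P' < e"
        using eq[of "\<lambda>x y. y - x"] P(4) by (intro d(2)) auto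
      then show ?thesis
        by (simp flip: of_real_diff add: eq)
    qed
    then show "\<exists>\<delta>>0. \<forall>P. finite P \<and> (\<forall>(x, y)\<in>P. c \<le> x \<and> x \<le> y \<and> y \<le> d) \<and>
        disjoint_family_on (\<lambda>(x, y). {x<..<y}) P \<and> total_length P < \<delta> \<longrightarrow>
        (\<Sum>(x, y)\<in>P. cmod (complex_of_real (g y) - complex_of_real (g x))) < e"
      using d(1) by blast
  qed
qed

lemma short_sums_mono: "short_sums c d P \<Longrightarrow> c' \<le> c \<Longrightarrow> d \<le> d' \<Longrightarrow> short_sums c' d' P"
  unfolding short_sums_def by fastforce

lemma short_sums_singleton: "c \<le> x \<Longrightarrow> x < y \<Longrightarrow> y \<le> d \<Longrightarrow> short_sums c d {(x,y)}"
  by (auto simp: short_sums_def disjoint_family_on_def)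

lemma real_AC_mono: "real_AC c d g \<Longrightarrow> c \<le> c' \<Longrightarrow> d' \<le> d \<Longrightarrow> real_AC c' d' g"
  unfolding real_AC_iff using short_sums_mono by meson

lemma short_sums_disjoint:
  assumes "short_sums c d P" "(s,t) \<in> P" "(s',t') \<in> P" "max s s' < min t t'"
  shows "(s,t) = (s',t')"
proof (rule ccontr)
  assume "(s,t) \<noteq> (s',t')"
  then have "{s<..<t} \<inter> {s'<..<t'} = {}"
    using assms unfolding short_sums_def disjoint_family_on_def by fastforce
  moreover have "(max s s' + min t t')/2 \<in> {s<..<t} \<inter> {s'<..<t'}"
    using assms(4) by auto
  ultimately show False by blast
qed

lemma short_sumsI:
  assumes "finite P" "\<And>x y. (x,y) \<in> P \<Longrightarrow> c \<le> x \<and> x < y \<and> y \<le> d"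
    and "\<And>s t s' t'. (s,t) \<in> P \<Longrightarrow> (s',t') \<in> P \<Longrightarrow> max s s' < min t t' \<Longrightarrow> (s,t) = (s',t')"
  shows "short_sums c d P"
  unfolding short_sums_def
proof (intro conjI)
  show "disjoint_family_on (\<lambda>(x, y). {x<..<y}) P"
    unfolding disjoint_family_on_def
  proof (intro ballI impI, rule ccontr)
    fix m n assume mn: "m \<in> P" "n \<in> P" "m \<noteq> n"
      and ne: "(case m of (x, y) \<Rightarrow> {x<..<y}) \<inter> (case n of (x, y) \<Rightarrow> {x<..<y}) \<noteq> {}"
    obtain s t s' t' where eq: "m = (s,t)" "n = (s',t')" by fastforce
    then have "(s,t) = (s',t')" using mn ne by (intro assms(3)) auto
    with mn eq show False by simp
  qed
qed (use assms in auto)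

lemma short_sums_length:
  assumes "short_sums c d P" and U: "U \<in> fmeasurable lborel" "\<And>x y. (x,y) \<in> P \<Longrightarrow> {x<..<y} \<subseteq> U"
  shows "total_length P \<le> measure lborel U"
proof -
  have fin: "finite P" and P: "\<And>x y. (x,y) \<in> P \<Longrightarrow> c \<le> x \<and> x < y \<and> y \<le> d"
    and disj: "disjoint_family_on (\<lambda>(x, y). {x<..<y}) P"
    using assms by (auto simp: short_sums_def)
  have "total_length P = (\<Sum>z\<in>P. measure lborel ((\<lambda>(x, y). {x<..<y}) z))"
    by (intro sum.cong) (use P in \<open>force\<close>)+
  also have "\<dots> = measure lborel (\<Union>z\<in>P. (\<lambda>(x, y). {x<..<y}) z)"
  proof (rule measure_finite_Union[symmetric])
    have "emeasure lborel {x<..<y} \<noteq> \<infinity>" for x y :: real by (cases "x \<le> y") auto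
    then show "\<And>z. z \<in> P \<Longrightarrow> emeasure lborel ((\<lambda>(x, y). {x<..<y}) z) \<noteq> \<infinity>" by auto
  qed (use fin disj in auto)
  also have "\<dots> \<le> measure lborel U"
  proof (rule measure_mono_fmeasurable)
    show "(\<Union>z\<in>P. (\<lambda>(x, y). {x<..<y}) z) \<in> sets lborel"
      using fin by (intro sets.finite_UN) auto
  qed (use U in blast)+
  finally show ?thesis .
qed

lemma short_sums_length_Icc:
  assumes "short_sums c d P" "c \<le> d"
  shows "total_length P \<le> d - c"
proof -
  have "{c..d} \<in> fmeasurable lborel" using assms(2) by (simp add: fmeasurable_def)
  then have "total_length P \<le> measure lborel {c..d}"
    by (rule short_sums_length[OF assms(1)]) (use assms in \<open>fastforce simp: short_sums_def\<close>)
  then show ?thesis using assms(2) by simp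
qed

text \<open>The intervals are cut at x: \<open>F\<close> truncates those that begin left of x,
  \<open>G\<close> those that end right of x. An interval containing x gives a piece to each side,
  and its increment is the sum of the increments of its pieces.\<close>

lemma short_sums_split:
  assumes P: "short_sums c y P" and x: "c \<le> x" "x \<le> y"
  obtains P1 P2 where "short_sums c x P1" "short_sums x y P2"
    "inc_sum g P = inc_sum g P1 + inc_sum g P2"
proof -
  have fin: "finite P" and P': "\<And>x z. (x,z) \<in> P \<Longrightarrow> c \<le> x \<and> x < z \<and> z \<le> y"
    using P by (auto simp: short_sums_def)
  define A where "A = {z\<in>P. fst z < x}"
  define B where "B = {z\<in>P. x < snd z}"
  define F where "F = (\<lambda>(s,t). (s::real, min t x))"
  define G where "G = (\<lambda>(s,t). (max s x, t::real))"
  have finAB: "finite A" "finite B" using fin by (auto simp: A_def B_def intro: finite_subset[rotated])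
  \<comment> \<open>Nondegenerate pieces that coincide have a common interior, so the intervals they
    come from meet and are equal.\<close>
  have injF: "inj_on F A"
  proof (rule inj_onI; clarify)
    fix s t s' t' assume "(s,t) \<in> A" "(s',t') \<in> A" "F (s,t) = F (s',t')"
    then have "(s,t) = (s',t')"
      using P' by (intro short_sums_disjoint[OF P]) (auto simp: A_def F_def)
    then show "s = s' \<and> t = t'" by simp
  qed
  have injG: "inj_on G B"
  proof (rule inj_onI; clarify)
    fix s t s' t' assume "(s,t) \<in> B" "(s',t') \<in> B" "G (s,t) = G (s',t')"
    then have "(s,t) = (s',t')"
      using P' by (intro short_sums_disjoint[OF P]) (auto simp: B_def G_def)
    then show "s = s' \<and> t = t'" by simp
  qed
  have 1: "short_sums c x (F ` A)"
  proof (rule short_sumsI)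
    fix s t s' t' assume "(s,t) \<in> F ` A" "(s',t') \<in> F ` A" and m: "max s s' < min t t'"
    then obtain u u' where u: "(s,u) \<in> A" "t = min u x" "(s',u') \<in> A" "t' = min u' x"
      by (auto simp: F_def)
    have "(s,u) = (s',u')" using u m by (intro short_sums_disjoint[OF P]) (auto simp: A_def)
    then show "(s,t) = (s',t')" using u by simp
  qed (use finAB P' x in \<open>auto simp: A_def F_def\<close>)
  have 2: "short_sums x y (G ` B)"
  proof (rule short_sumsI)
    fix s t s' t' assume "(s,t) \<in> G ` B" "(s',t') \<in> G ` B" and m: "max s s' < min t t'"
    then obtain u u' where u: "(u,t) \<in> B" "s = max u x" "(u',t') \<in> B" "s' = max u' x"
      by (auto simp: G_def)
    have "(u,t) = (u',t')" using u m by (intro short_sums_disjoint[OF P]) (auto simp: B_def)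
    then show "(s,t) = (s',t')" using u by simp
  qed (use finAB P' x in \<open>auto simp: B_def G_def\<close>)
  have "inc_sum g P = (\<Sum>(s,t)\<in>P. (if s < x then g (min t x) - g s else 0) + (if x < t then g t - g (max s x) else 0))"
    unfolding inc_sum_def using P' by (intro sum.cong) (fastforce simp: min_def max_def not_less)+
  also have "\<dots> = (\<Sum>(s,t)\<in>P. if s < x then g (min t x) - g s else 0) + (\<Sum>(s,t)\<in>P. if x < t then g t - g (max s x) else 0)"
    by (simp add: case_prod_unfold sum.distrib)
  also have "(\<Sum>(s,t)\<in>P. if s < x then g (min t x) - g s else 0) = (\<Sum>(s,t)\<in>A. g (min t x) - g s)"
    unfolding A_def using fin by (subst sum.inter_filter) (auto simp: case_prod_unfold intro!: sum.cong)
  also have "\<dots> = inc_sum g (F ` A)"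
    unfolding inc_sum_def by (subst sum.reindex[OF injF]) (auto simp: F_def case_prod_unfold)
  also have "(\<Sum>(s,t)\<in>P. if x < t then g t - g (max s x) else 0) = (\<Sum>(s,t)\<in>B. g t - g (max s x))"
    unfolding B_def using fin by (subst sum.inter_filter) (auto simp: case_prod_unfold intro!: sum.cong)
  also have "\<dots> = inc_sum g (G ` B)"
    unfolding inc_sum_def by (subst sum.reindex[OF injG]) (auto simp: G_def case_prod_unfold)
  finally show ?thesis using 1 2 that by blast
qed

text \<open>An absolutely continuous \<open>g\<close> is the difference of the two monotone absolutely continuous functions
  \<open>pos_variation c g\<close> and \<open>pos_variation c g - g\<close>; the Stieltjes measure of a monotone absolutely
  continuous function has a Radon--Nikodym density.\<close>

definition pos_variation :: "real \<Rightarrow> (real \<Rightarrow> real) \<Rightarrow> real \<Rightarrow> real" where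
  "pos_variation c g x = Sup (inc_sum g ` {P. short_sums c x P})"

lemma short_sums_empty [simp]: "short_sums c d {}"
  by (simp add: short_sums_def disjoint_family_on_def)

lemma inc_sum_le_abs: "inc_sum g P \<le> var_sum g P"
  unfolding inc_sum_def by (intro sum_mono) auto

context
  fixes c d :: real and g :: "real \<Rightarrow> real" and B :: real
  assumes bounded: "\<And>P. short_sums c d P \<Longrightarrow> inc_sum g P \<le> B"
begin

text \<open>\<open>Sup\<close> of an unbounded set has no meaning, hence the bound fixed in the
  context. It is supplied later by absolute continuity, on intervals shorter than the \<delta> that
  belongs to \<epsilon> = 1.\<close>

lemma inc_sum_le_pos_variation:
  assumes "short_sums c x P" "x \<le> d"
  shows "inc_sum g P \<le> pos_variation c g x"
  unfolding pos_variation_def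
proof (rule cSup_upper)
  show "bdd_above (inc_sum g ` {P. short_sums c x P})"
    using bounded short_sums_mono[OF _ order.refl assms(2)] by (auto simp: bdd_above_def)
qed (use assms in auto)

text \<open>Appending (x, y) to a system of intervals in [c, x] raises its sum by g y - g x. The
  second inequality says that the positive variation minus g is increasing too.\<close>

lemma pos_variation_add:
  assumes "c \<le> x" "x \<le> y" "y \<le> d"
  shows "pos_variation c g x \<le> pos_variation c g y"
    "pos_variation c g x + (g y - g x) \<le> pos_variation c g y"
proof -
  have ne: "inc_sum g ` {P. short_sums c x P} \<noteq> {}"
    using short_sums_empty by blast
  show mono: "pos_variation c g x \<le> pos_variation c g y"
    unfolding pos_variation_def[of c g x]
    using ne inc_sum_le_pos_variation[OF _ assms(3)] short_sums_mono[OF _ order.refl assms(2)]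
    by (intro cSup_least) auto
  show "pos_variation c g x + (g y - g x) \<le> pos_variation c g y"
  proof (cases "x = y")
    case False
    then have xy: "x < y" using assms by simp
    have "inc_sum g P \<le> pos_variation c g y - (g y - g x)" if P: "short_sums c x P" for P
    proof -
      have notin: "(x,y) \<notin> P" and fin: "finite P" using P xy by (auto simp: short_sums_def)
      have "short_sums c y (insert (x,y) P)"
      proof (rule short_sumsI)
        fix s t s' t' assume *: "(s, t) \<in> insert (x, y) P" "(s', t') \<in> insert (x, y) P" "max s s' < min t t'"
        show "(s, t) = (s', t')"
        proof (cases "(s,t) \<in> P \<and> (s',t') \<in> P")
          case True then show ?thesis using short_sums_disjoint[OF P] * by blast
        next
          case False
          have "t \<le> x" if "(s,t) \<in> P" for s t using P that by (auto simp: short_sums_def)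
          then have "\<And>u v. (u,v) \<in> P \<Longrightarrow> v \<le> x" by blast
          from this[of s t] this[of s' t'] False * show ?thesis by auto
        qed
      next
        fix s t assume "(s,t) \<in> insert (x,y) P"
        then consider "s = x" "t = y" | "(s,t) \<in> P" by blast
        then show "c \<le> s \<and> s < t \<and> t \<le> y"
        proof cases
          case 2 then have "c \<le> s \<and> s < t \<and> t \<le> x" using P by (auto simp: short_sums_def)
          then show ?thesis using assms by linarith
        qed (use xy assms in simp)
      qed (use fin in simp)
      from inc_sum_le_pos_variation[OF this assms(3)] show ?thesis
        using notin fin by (simp add: inc_sum_def)
    qed
    then have "pos_variation c g x \<le> pos_variation c g y - (g y - g x)"
      unfolding pos_variation_def[of c g x] using ne by (intro cSup_least) auto
    then show ?thesis by simp
  qed (use mono in simp)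
qed

text \<open>A nearly optimal system for [c, y] is split at x. Its part in [c, x] is worth at most
  the variation at x, so the part in [x, y] must account for the rest.\<close>

lemma pos_variation_approx:
  assumes "c \<le> x" "x \<le> y" "y \<le> d" "0 < \<eta>"
  obtains P where "short_sums x y P" "pos_variation c g y - pos_variation c g x \<le> inc_sum g P + \<eta>"
proof -
  have ne: "inc_sum g ` {P. short_sums c y P} \<noteq> {}"
    using short_sums_empty by blast
  have "pos_variation c g y - \<eta> < Sup (inc_sum g ` {P. short_sums c y P})"
    using assms by (simp add: pos_variation_def)
  from less_cSupE[OF this ne] obtain z where "z \<in> inc_sum g ` {P. short_sums c y P}" "pos_variation c g y - \<eta> < z"
    by blast
  then obtain P where P: "short_sums c y P" "pos_variation c g y - \<eta> < inc_sum g P"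
    by blast
  obtain P1 P2 where *: "short_sums c x P1" "short_sums x y P2" "inc_sum g P = inc_sum g P1 + inc_sum g P2"
    using short_sums_split[OF P(1) assms(1,2)] by blast
  have "inc_sum g P1 \<le> pos_variation c g x"
    using inc_sum_le_pos_variation[OF *(1)] assms by simp
  then show ?thesis using that[OF *(2)] P(2) *(3) by linarith
qed

text \<open>Each interval is replaced by a nearly optimal system inside it. The refined system
  \<open>Q\<close> is not longer than the given one, so the \<delta> that serves g for e/2 serves
  the variation for e.\<close>

lemma pos_variation_AC:
  assumes AC: "real_AC c d g"
  shows "real_AC c d (pos_variation c g)"
  unfolding real_AC_iff
proof (intro allI impI)
  fix e :: real assume "e > 0"
  then obtain \<delta> where d: "\<delta> > 0" "\<And>P. short_sums c d P \<Longrightarrow> total_length P < \<delta> \<Longrightarrow> var_sum g P < e/2"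
    using AC unfolding real_AC_iff by (meson half_gt_zero)
  have "var_sum (pos_variation c g) R < e"
    if R: "short_sums c d R" "total_length R < \<delta>" for R
  proof -
    have fin: "finite R" and Rb: "\<And>x y. (x,y) \<in> R \<Longrightarrow> c \<le> x \<and> x < y \<and> y \<le> d"
      using R(1) by (auto simp: short_sums_def)
    \<comment> \<open>One error \<eta> occurs per interval, so all errors together are at most e/2;
      the summand 1 covers an empty \<open>R\<close>.\<close>
    define \<eta> where "\<eta> = e / (2 * (card R + 1))"
    have \<eta>: "\<eta> > 0" using \<open>e > 0\<close> by (simp add: \<eta>_def)
    have "\<exists>P. short_sums (fst z) (snd z) P \<and>
        pos_variation c g (snd z) - pos_variation c g (fst z) \<le> inc_sum g P + \<eta>" if "z \<in> R" for z
    proof -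
      have "c \<le> fst z" "fst z \<le> snd z" "snd z \<le> d" using Rb[of "fst z" "snd z"] that by auto
      from pos_variation_approx[OF this \<eta>] show ?thesis by blast
    qed
    then obtain P where P: "\<And>z. z \<in> R \<Longrightarrow> short_sums (fst z) (snd z) (P z)"
      "\<And>z. z \<in> R \<Longrightarrow> pos_variation c g (snd z) - pos_variation c g (fst z) \<le> inc_sum g (P z) + \<eta>"
      using bchoice[of R "\<lambda>z P. short_sums (fst z) (snd z) P \<and>
        pos_variation c g (snd z) - pos_variation c g (fst z) \<le> inc_sum g P + \<eta>"] by blast
    have finP: "finite (P z)" and Pb: "\<And>s t. (s,t) \<in> P z \<Longrightarrow> fst z \<le> s \<and> s < t \<and> t \<le> snd z" if "z \<in> R" for z
      using P(1)[OF that] by (auto simp: short_sums_def)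
    have same: "z = z'" if "z \<in> R" "z' \<in> R" "(s,t) \<in> P z" "(s',t') \<in> P z'" "max s s' < min t t'" for z z' s t s' t'
    proof -
      have "max (fst z) (fst z') < min (snd z) (snd z')"
        using Pb[OF that(1,3)] Pb[OF that(2,4)] that(5) by linarith
      then have "(fst z, snd z) = (fst z', snd z')"
        using that by (intro short_sums_disjoint[OF R(1)]) auto
      then show ?thesis by (simp add: prod_eq_iff)
    qed
    define Q where "Q = (\<Union>z\<in>R. P z)"
    have Q: "short_sums c d Q"
    proof (rule short_sumsI)
      fix s t s' t' assume "(s,t) \<in> Q" "(s',t') \<in> Q" and m: "max s s' < min t t'"
      then obtain z z' where z: "z \<in> R" "z' \<in> R" "(s,t) \<in> P z" "(s',t') \<in> P z'"
        by (auto simp: Q_def)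
      then have "z = z'" using same m by blast
      then show "(s,t) = (s',t')" using z short_sums_disjoint[OF P(1)[OF z(1)]] m by blast
    next
      fix s t assume "(s,t) \<in> Q"
      then obtain z where z: "z \<in> R" "(s,t) \<in> P z" by (auto simp: Q_def)
      show "c \<le> s \<and> s < t \<and> t \<le> d"
        using Pb[OF z] Rb[of "fst z" "snd z"] z(1) by auto
    qed (use fin finP in \<open>auto simp: Q_def\<close>)
    have sum_Q: "(\<Sum>(x,y)\<in>Q. f x y) = (\<Sum>z\<in>R. \<Sum>(x,y)\<in>P z. f x y)" for f :: "real \<Rightarrow> real \<Rightarrow> real"
      unfolding Q_def
    proof (rule sum.UNION_disjoint)
      show "\<forall>i\<in>R. \<forall>j\<in>R. i \<noteq> j \<longrightarrow> P i \<inter> P j = {}"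
      proof (intro ballI impI, rule ccontr)
        fix z z' assume z: "z \<in> R" "z' \<in> R" "z \<noteq> z'" "P z \<inter> P z' \<noteq> {}"
        then obtain s t where st: "(s,t) \<in> P z" "(s,t) \<in> P z'" by auto
        show False using same[OF z(1,2) st] Pb[OF z(1) st(1)] z(3) by simp
      qed
    qed (use fin finP in auto)
    have "total_length Q \<le> (\<Sum>z\<in>R. snd z - fst z)"
      unfolding sum_Q
    proof (rule sum_mono)
      fix z assume z: "z \<in> R"
      then have "fst z \<le> snd z" using Rb[of "fst z" "snd z"] by auto
      then show "(\<Sum>(x,y)\<in>P z. y - x) \<le> snd z - fst z"
        using short_sums_length_Icc P(1) z by blast
    qed
    then have "total_length Q < \<delta>" using R(2) by (simp add: case_prod_unfold)
    from d(2)[OF Q this] have Qe: "var_sum g Q < e/2" .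
    have "var_sum (pos_variation c g) R = (\<Sum>z\<in>R. pos_variation c g (snd z) - pos_variation c g (fst z))"
      unfolding case_prod_unfold
    proof (rule sum.cong)
      fix z assume "z \<in> R"
      then show "\<bar>pos_variation c g (snd z) - pos_variation c g (fst z)\<bar> = pos_variation c g (snd z) - pos_variation c g (fst z)"
        using Rb[of "fst z" "snd z"] pos_variation_add(1)[of "fst z" "snd z"] by auto
    qed simp
    also have "\<dots> \<le> (\<Sum>z\<in>R. inc_sum g (P z) + \<eta>)"
      by (intro sum_mono P)
    also have "\<dots> = (\<Sum>z\<in>R. inc_sum g (P z)) + card R * \<eta>"
      by (simp add: sum.distrib)
    also have "(\<Sum>z\<in>R. inc_sum g (P z)) \<le> var_sum g Q"
      unfolding sum_Q by (intro sum_mono inc_sum_le_abs)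
    also have "card R * \<eta> \<le> e/2"
      using \<open>e > 0\<close> by (simp add: \<eta>_def field_simps)
    finally show ?thesis using Qe by simp
  qed
  then show "\<exists>\<delta>>0. \<forall>P. short_sums c d P \<and> total_length P < \<delta> \<longrightarrow>
     var_sum (pos_variation c g) P < e"
    using d(1) by blast
qed

end

text \<open>The integrated form of g' = h. Here h is only a density and may be changed on null sets;
  by \<open>real_AC_imp_primitive\<close> and \<open>primitive_on_imp_real_AC\<close> such an h
  exists exactly for absolutely continuous g.\<close>

definition primitive_on :: "real \<Rightarrow> real \<Rightarrow> (real \<Rightarrow> real) \<Rightarrow> (real \<Rightarrow> real) \<Rightarrow> bool" where
  "primitive_on c d g h \<longleftrightarrow> h absolutely_integrable_on {c..d} \<and>
     (\<forall>x y. c \<le> x \<and> x \<le> y \<and> y \<le> d \<longrightarrow> (h has_integral (g y - g x)) {x..y})"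

lemma real_AC_imp_continuous_on:
  assumes "real_AC c d g"
  shows "continuous_on {c..d} g"
  unfolding continuous_on_iff
proof (intro ballI allI impI)
  fix x e :: real assume x: "x \<in> {c..d}" and "e > 0"
  then obtain \<delta> where d: "\<delta> > 0" "\<And>P. short_sums c d P \<Longrightarrow> total_length P < \<delta> \<Longrightarrow> var_sum g P < e"
    using assms unfolding real_AC_iff by meson
  have *: "\<bar>g t - g s\<bar> < e" if "c \<le> s" "s < t" "t \<le> d" "t - s < \<delta>" for s t
    using d(2)[OF short_sums_singleton[OF that(1,2,3)]] that by simp
  have "dist (g y) (g x) < e" if "y \<in> {c..d}" "dist y x < \<delta>" for y
    using *[of x y] *[of y x] that x \<open>e > 0\<close> by (cases x y rule: linorder_cases) (auto simp: dist_real_def)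
  then show "\<exists>\<delta>>0. \<forall>y\<in>{c..d}. dist y x < \<delta> \<longrightarrow> dist (g y) (g x) < e"
    using d(1) by blast
qed

text \<open>K is covered by finitely many closed intervals inside U, which are rearranged into
  nonoverlapping ones. Clamped to [c, d] they form an admissible system of total length below
  \<delta>, and its sum of increments bounds the measure of K.\<close>

lemma interval_measure_compact_le:
  fixes G :: "real \<Rightarrow> real"
  assumes mono: "\<And>x y. x \<le> y \<Longrightarrow> G x \<le> G y" and cont: "continuous_on UNIV G"
    and const: "\<And>x. G x = G (max c (min d x))" and cd: "c \<le> d"
    and \<delta>: "\<And>P. short_sums c d P \<Longrightarrow> total_length P < \<delta> \<Longrightarrow> var_sum G P \<le> e"
    and U: "open U" "emeasure lborel U < ennreal \<delta>" and K: "compact K" "K \<subseteq> U"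
  shows "emeasure (interval_measure G) K \<le> ennreal e"
proof -
  let ?M = "interval_measure G"
  have "\<forall>x\<in>K. \<exists>r>0. cball x r \<subseteq> U"
    using U(1) K(2) open_contains_cball by blast
  then obtain r where r: "\<And>x. x \<in> K \<Longrightarrow> r x > 0" "\<And>x. x \<in> K \<Longrightarrow> cball x (r x) \<subseteq> U"
    by metis
  have "K \<subseteq> (\<Union>x\<in>K. ball x (r x))" using r(1) by fastforce
  then obtain K0 where K0: "K0 \<subseteq> K" "finite K0" "K \<subseteq> (\<Union>x\<in>K0. ball x (r x))"
    using compactE_image[OF K(1), of K "\<lambda>x. ball x (r x)"] by blast
  define F where "F = (\<lambda>x. cball x (r x)) ` K0"
  obtain D where D: "D division_of \<Union>F"
  proof (rule elementary_unions_intervals)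
    show "finite F" using K0 by (simp add: F_def)
    show "\<exists>a b. s = cbox a b" if "s \<in> F" for s
      using that by (auto simp: F_def cball_eq_atLeastAtMost cbox_interval)
  qed
  have fin: "finite D" using D by blast
  have DF: "\<Union>D = (\<Union>x\<in>K0. cball x (r x))" by (simp add: division_ofD(6)[OF D] F_def)
  have "(\<Union>x\<in>K0. ball x (r x)) \<subseteq> (\<Union>x\<in>K0. cball x (r x))" by (intro UN_mono ball_subset_cball order.refl)
  then have KD: "K \<subseteq> \<Union>D" using K0(3) DF by simp
  have DU: "\<Union>D \<subseteq> U" unfolding DF using r(2) K0(1) by (intro UN_least) auto
  have Dbox: "\<exists>a b. a \<le> b \<and> k = {a..b}" if kD: "k \<in> D" for k
  proof -
    obtain a b where "k = {a..b}" "k \<noteq> {}"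
      using division_ofD(3,4)[OF D kD] by (auto simp: cbox_interval)
    then show ?thesis by (intro exI[of _ a] exI[of _ b]) auto
  qed
  \<comment> \<open>By \<open>const\<close>, clamping to [c, d] changes no value of G. Intervals
    that shrink to a point under clamping have measure 0 and are left out of
    \<open>D'\<close>.\<close>
  define C where "C = (\<lambda>x. max c (min d x))"
  have C_mono: "x \<le> y \<Longrightarrow> C x \<le> C y" for x y by (auto simp: C_def)
  have C_less: "C x < C y \<Longrightarrow> x < y" for x y using C_mono[of y x] by linarith
  have GC: "G (C x) = G x" for x unfolding C_def by (rule const[symmetric])
  define D' where "D' = {k\<in>D. C (Inf k) < C (Sup k)}"
  define E where "E = (\<lambda>k. (C (Inf k), C (Sup k)))"
  have same: "k = l" if kl: "k \<in> D" "l \<in> D" "max (C (Inf k)) (C (Inf l)) < min (C (Sup k)) (C (Sup l))" for k l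
  proof -
    obtain a b a' b' where ab: "a \<le> b" "k = {a..b}" "a' \<le> b'" "l = {a'..b'}"
      using Dbox[OF kl(1)] Dbox[OF kl(2)] by blast
    have "max (C a) (C a') < min (C b) (C b')" using that ab by simp
    then have lt: "a < b" "a < b'" "a' < b" "a' < b'"
      using C_less[of a b] C_less[of a b'] C_less[of a' b] C_less[of a' b'] by simp_all
    then have "(max a a' + min b b') / 2 \<in> interior k \<inter> interior l"
      by (auto simp: ab)
    then show ?thesis using division_ofD(5)[OF D that(1,2)] by blast
  qed
  have inj: "inj_on E D'"
  proof (rule inj_onI)
    fix k l assume *: "k \<in> D'" "l \<in> D'" "E k = E l"
    show "k = l"
      by (rule same) (use * in \<open>auto simp: D'_def E_def\<close>)
  qed
  have C_range: "c \<le> C x" "C x \<le> d" for x using cd by (auto simp: C_def)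
  have short: "short_sums c d (E ` D')"
  proof (rule short_sumsI)
    fix s t s' t' assume "(s,t) \<in> E ` D'" "(s',t') \<in> E ` D'" and m: "max s s' < min t t'"
    then obtain k l where kl: "k \<in> D'" "l \<in> D'" "(s,t) = E k" "(s',t') = E l" by auto
    have "k = l" by (rule same) (use kl m in \<open>auto simp: D'_def E_def\<close>)
    then show "(s,t) = (s',t')" using kl by simp
  qed (use fin C_range in \<open>auto simp: D'_def E_def\<close>)
  have C_in: "C x < z \<Longrightarrow> z < C y \<Longrightarrow> x < z \<and> z < y" for x y z by (auto simp: C_def)
  have UF: "U \<in> fmeasurable lborel"
    using U by (auto simp: fmeasurable_def intro: order_less_trans)
  have "total_length (E ` D') \<le> measure lborel U"
  proof (rule short_sums_length[OF short UF])
    fix s t assume "(s,t) \<in> E ` D'"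
    then obtain k where k: "k \<in> D" "s = C (Inf k)" "t = C (Sup k)" by (auto simp: E_def D'_def)
    then obtain a b where ab: "a \<le> b" "k = {a..b}" using Dbox by metis
    have "{s<..<t} \<subseteq> k"
    proof
      fix z assume "z \<in> {s<..<t}"
      then show "z \<in> k" using k ab C_in[of a z b] by simp
    qed
    then show "{s<..<t} \<subseteq> U" using DU k(1) by blast
  qed
  also have "\<dots> < \<delta>"
  proof -
    have "ennreal (measure lborel U) < ennreal \<delta>"
      using U(2) UF by (simp add: emeasure_eq_measure2)
    then show ?thesis by (simp add: ennreal_less_iff)
  qed
  finally have len: "total_length (E ` D') < \<delta>" .
  have "emeasure ?M K \<le> emeasure ?M (\<Union>k\<in>D. k)"
    using KD fin Dbox by (intro emeasure_mono sets.finite_UN) (auto, metis atLeastAtMost_borel)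
  also have "\<dots> \<le> (\<Sum>k\<in>D. emeasure ?M k)"
    using fin Dbox by (intro emeasure_subadditive_finite) (auto, metis atLeastAtMost_borel)
  also have "\<dots> = (\<Sum>k\<in>D. ennreal (G (C (Sup k)) - G (C (Inf k))))"
  proof (rule sum.cong)
    fix k assume "k \<in> D"
    then obtain a b where ab: "a \<le> b" "k = {a..b}" using Dbox by metis
    then show "emeasure ?M k = ennreal (G (C (Sup k)) - G (C (Inf k)))"
      by (simp add: emeasure_interval_measure_Icc[OF ab(1) mono cont] GC)
  qed simp
  also have "\<dots> = ennreal (\<Sum>k\<in>D. G (C (Sup k)) - G (C (Inf k)))"
  proof (rule sum_ennreal)
    fix k assume "k \<in> D"
    then obtain a b where ab: "a \<le> b" "k = {a..b}" using Dbox by metis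
    then show "0 \<le> G (C (Sup k)) - G (C (Inf k))" using mono[OF ab(1)] by (simp add: GC)
  qed
  also have "(\<Sum>k\<in>D. G (C (Sup k)) - G (C (Inf k))) = (\<Sum>k\<in>D'. G (C (Sup k)) - G (C (Inf k)))"
  proof (rule sum.mono_neutral_right[OF fin])
    show "\<forall>k\<in>D - D'. G (C (Sup k)) - G (C (Inf k)) = 0"
    proof
      fix k assume k: "k \<in> D - D'"
      then obtain a b where ab: "a \<le> b" "k = {a..b}" using Dbox by (metis DiffD1)
      then have "C (Inf k) \<le> C (Sup k)" using C_mono by simp
      with k have "C (Inf k) = C (Sup k)" by (auto simp: D'_def)
      then show "G (C (Sup k)) - G (C (Inf k)) = 0" by simp
    qed
  qed (auto simp: D'_def)
  also have "\<dots> = (\<Sum>(x,y)\<in>E ` D'. G y - G x)"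
    by (subst sum.reindex[OF inj]) (simp add: E_def)
  also have "\<dots> \<le> var_sum G (E ` D')"
    by (intro sum_mono) auto
  also have "\<dots> \<le> e" by (rule \<delta>[OF short len])
  finally show ?thesis by (simp add: ennreal_leI)
qed

text \<open>Absolute continuity of the Stieltjes measure \<open>M\<close> is the point. A null set
  lies in an open U of length below \<delta> by outer regularity of Lebesgue measure. The compact
  subsets of U have measure at most e, and they determine the measure of U by inner regularity of
  the finite measure \<open>M\<close>.\<close>

lemma mono_AC_imp_primitive:
  assumes cd: "c \<le> d" and mono: "mono_on {c..d} G" and AC: "real_AC c d G"
  shows "\<exists>h. primitive_on c d G h"
proof -
  \<comment> \<open>The constant extension beyond [c, d] makes the Stieltjes measure finite and
    defined on the whole line.\<close>
  define H where "H x = G (max c (min d x))" for x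
  have HG: "H x = G x" if "c \<le> x" "x \<le> d" for x using that by (simp add: H_def)
  have H_mono: "H x \<le> H y" if "x \<le> y" for x y
    using that cd by (auto simp: H_def intro!: mono_onD[OF mono])
  have H_cont: "continuous_on UNIV H"
    unfolding H_def
    by (rule continuous_on_compose2[OF real_AC_imp_continuous_on[OF AC]])
       (use cd in \<open>auto intro!: continuous_intros\<close>)
  have H_const: "H x = H (max c (min d x))" for x using cd by (simp add: H_def)
  define M where "M = interval_measure H"
  have Icc: "emeasure M {x..y} = ennreal (H y - H x)" if "x \<le> y" for x y
    unfolding M_def by (rule emeasure_interval_measure_Icc[OF that H_mono H_cont])
  have sets_M: "sets M = sets borel" and space_M: "space M = UNIV"
    by (simp_all add: M_def)
  have fin: "emeasure M (space M) \<noteq> \<infinity>"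
  proof -
    have "emeasure M (space M) = emeasure M (\<Union>n. {-real n..real n})"
      unfolding space_M by (rule arg_cong[where f="emeasure M"])
        (auto, metis abs_le_iff abs_ge_self minus_le_iff real_arch_simple)
    also have "\<dots> = (SUP n. emeasure M {-real n..real n})"
      by (rule SUP_emeasure_incseq[symmetric]) (auto simp: sets_M incseq_def)
    also have "\<dots> \<le> ennreal (H d - H c)"
    proof (rule SUP_least)
      fix n :: nat
      have "H (real n) \<le> H d" "H c \<le> H (- real n)"
        using cd by (auto simp: H_def intro!: mono_onD[OF mono])
      then show "emeasure M {-real n..real n} \<le> ennreal (H d - H c)"
        by (subst Icc) (auto intro!: ennreal_leI)
    qed
    finally show ?thesis by (auto simp: top_unique)
  qed
  have ac: "absolutely_continuous lborel M"
    unfolding absolutely_continuous_def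
  proof
    fix A :: "real set" assume "A \<in> null_sets lborel"
    then have A: "A \<in> sets borel" "emeasure lborel A = 0" by auto
    have "emeasure M A \<le> 0 + ennreal e" if "0 < e" for e
    proof -
      obtain \<delta> where d: "\<delta> > 0" "\<And>P. short_sums c d P \<Longrightarrow> total_length P < \<delta> \<Longrightarrow> var_sum G P < e"
        using AC \<open>0 < e\<close> unfolding real_AC_iff by meson
      have dH: "var_sum H P \<le> e" if P: "short_sums c d P" "total_length P < \<delta>" for P
      proof -
        have "var_sum H P = var_sum G P"
        proof (rule sum.cong)
          fix z assume "z \<in> P"
          then show "(case z of (x, y) \<Rightarrow> \<bar>H y - H x\<bar>) = (case z of (x, y) \<Rightarrow> \<bar>G y - G x\<bar>)"
            using P(1) by (auto simp: short_sums_def HG)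
        qed simp
        then show ?thesis using d(2)[OF P] by simp
      qed
      obtain U where U: "open U" "A \<subseteq> U" "emeasure lborel (U - A) < ennreal \<delta>"
        using outer_regular_lborel[OF A(1) \<open>\<delta> > 0\<close>] by blast
      have "emeasure lborel U \<le> emeasure lborel ((U - A) \<union> A)"
        by (rule emeasure_mono) (use A U in auto)
      also have "\<dots> \<le> emeasure lborel (U - A) + emeasure lborel A"
        by (rule emeasure_subadditive) (use A U in auto)
      finally have U\<delta>: "emeasure lborel U < ennreal \<delta>" using U(3) A(2) by simp
      have "emeasure M A \<le> emeasure M U"
        by (rule emeasure_mono[OF U(2)]) (use U sets_M in auto)
      also have "\<dots> = (SUP K \<in> {K. K \<subseteq> U \<and> compact K}. emeasure M K)"
        by (rule inner_regular) (use sets_M fin U in auto)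
      also have "\<dots> \<le> ennreal e"
        by (rule SUP_least, unfold M_def)
          (rule interval_measure_compact_le[OF H_mono H_cont H_const cd dH U(1) U\<delta>], auto)
      finally show ?thesis by simp
    qed
    then have "emeasure M A \<le> 0"
      by (rule ennreal_le_epsilon)
    then show "A \<in> null_sets M" using A sets_M by (auto simp: null_sets_def)
  qed
  obtain f where f: "f \<in> borel_measurable lborel" "density lborel f = M"
    using sigma_finite_measure.Radon_Nikodym[OF sigma_finite_lborel ac] sets_M by auto
  have f_fin: "AE x in lborel. f x \<noteq> \<infinity>"
  proof (rule nn_integral_PInf_AE[OF f(1)])
    have "emeasure M UNIV = (\<integral>\<^sup>+x. f x \<partial>lborel)"
      using f by (subst f(2)[symmetric], subst emeasure_density) auto
    then show "integral\<^sup>N lborel f \<noteq> \<infinity>" using fin space_M by simp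
  qed
  \<comment> \<open>The value 0 that \<open>enn2real\<close> gives to infinity concerns a null set
    only, by \<open>f_fin\<close>.\<close>
  define h where "h x = enn2real (f x)" for x
  have h_meas: "h \<in> borel_measurable borel" using f(1) by (simp add: h_def[abs_def])
  have h_nn: "0 \<le> h x" for x by (simp add: h_def)
  have prim: "(h has_integral (G y - G x)) {x..y}" if xy: "c \<le> x" "x \<le> y" "y \<le> d" for x y
  proof -
    have "((\<lambda>z. h z * indicator {x..y} z) has_integral (G y - G x)) UNIV"
    proof (rule nn_integral_has_integral)
      have "(\<integral>\<^sup>+z. ennreal (h z * indicator {x..y} z) \<partial>lborel) = (\<integral>\<^sup>+z. f z * indicator {x..y} z \<partial>lborel)"
        by (rule nn_integral_cong_AE, use f_fin in eventually_elim)
          (auto simp: h_def indicator_def less_top[symmetric])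
      also have "\<dots> = emeasure M {x..y}"
        using f by (subst f(2)[symmetric], subst emeasure_density) auto
      finally show "(\<integral>\<^sup>+z. ennreal (h z * indicator {x..y} z) \<partial>lborel) = ennreal (G y - G x)"
        using xy by (simp add: Icc HG)
      show "0 \<le> G y - G x" using xy by (auto intro!: mono_onD[OF mono])
    qed (use h_meas h_nn in \<open>auto intro!: borel_measurable_times\<close>)
    moreover have "(\<lambda>z. h z * indicator {x..y} z) = (\<lambda>z. if z \<in> {x..y} then h z else 0)"
      by auto
    ultimately show ?thesis by (simp only: has_integral_restrict_UNIV)
  qed
  have "h absolutely_integrable_on {c..d}"
    by (rule nonnegative_absolutely_integrable_1) (use prim[of c d] cd in \<open>auto simp: h_def\<close>)
  with prim show ?thesis unfolding primitive_on_def by blast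
qed

lemma primitive_on_diff:
  "primitive_on c d g1 h1 \<Longrightarrow> primitive_on c d g2 h2 \<Longrightarrow> primitive_on c d (\<lambda>x. g1 x - g2 x) (\<lambda>x. h1 x - h2 x)"
  unfolding primitive_on_def
proof (intro conjI allI impI; elim conjE)
  fix x y assume *: "\<forall>x y. c \<le> x \<and> x \<le> y \<and> y \<le> d \<longrightarrow> (h1 has_integral g1 y - g1 x) {x..y}"
    "\<forall>x y. c \<le> x \<and> x \<le> y \<and> y \<le> d \<longrightarrow> (h2 has_integral g2 y - g2 x) {x..y}"
    and xy: "c \<le> x" "x \<le> y" "y \<le> d"
  have "((\<lambda>x. h1 x - h2 x) has_integral (g1 y - g1 x) - (g2 y - g2 x)) {x..y}"
    by (rule has_integral_diff) (use * xy in blast)+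
  then show "((\<lambda>x. h1 x - h2 x) has_integral g1 y - g2 y - (g1 x - g2 x)) {x..y}"
    by (simp add: algebra_simps)
qed (auto intro: set_integral_diff)

lemma real_AC_diff:
  assumes "real_AC c d g1" "real_AC c d g2"
  shows "real_AC c d (\<lambda>x. g1 x - g2 x)"
  unfolding real_AC_iff
proof (intro allI impI)
  fix e :: real assume "e > 0"
  obtain \<delta>1 where 1: "\<delta>1 > 0" "\<And>P. short_sums c d P \<Longrightarrow> total_length P < \<delta>1 \<Longrightarrow> var_sum g1 P < e/2"
    using assms(1) \<open>e > 0\<close> unfolding real_AC_iff by (meson half_gt_zero)
  obtain \<delta>2 where 2: "\<delta>2 > 0" "\<And>P. short_sums c d P \<Longrightarrow> total_length P < \<delta>2 \<Longrightarrow> var_sum g2 P < e/2"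
    using assms(2) \<open>e > 0\<close> unfolding real_AC_iff by (meson half_gt_zero)
  have "(\<Sum>(x, y)\<in>P. \<bar>g1 y - g2 y - (g1 x - g2 x)\<bar>) < e"
    if "short_sums c d P" "total_length P < min \<delta>1 \<delta>2" for P
  proof -
    have "(\<Sum>(x, y)\<in>P. \<bar>g1 y - g2 y - (g1 x - g2 x)\<bar>) \<le> (\<Sum>(x, y)\<in>P. \<bar>g1 y - g1 x\<bar> + \<bar>g2 y - g2 x\<bar>)"
      by (intro sum_mono) auto
    also have "\<dots> = var_sum g1 P + var_sum g2 P"
      by (simp add: case_prod_unfold sum.distrib)
    finally show ?thesis using 1(2)[of P] 2(2)[of P] that by simp
  qed
  then show "\<exists>\<delta>>0. \<forall>P. short_sums c d P \<and> total_length P < \<delta> \<longrightarrow> (\<Sum>(x, y)\<in>P. \<bar>g1 y - g2 y - (g1 x - g2 x)\<bar>) < e"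
    using 1(1) 2(1) by (intro exI[of _ "min \<delta>1 \<delta>2"]) auto
qed

lemma primitive_on_combine:
  assumes 1: "primitive_on c m g h1" and 2: "primitive_on m d g h2" and m: "c \<le> m" "m \<le> d"
  shows "primitive_on c d g (\<lambda>x. if x \<le> m then h1 x else h2 x)" (is "primitive_on _ _ _ ?h")
proof -
  have h1: "(?h has_integral (g y - g x)) {x..y}" if "c \<le> x" "x \<le> y" "y \<le> m" for x y
    by (rule has_integral_eq[of _ h1]) (use 1 that in \<open>auto simp: primitive_on_def\<close>)
  have h2: "(?h has_integral (g y - g x)) {x..y}" if "m \<le> x" "x \<le> y" "y \<le> d" for x y
    by (rule has_integral_spike_finite[of "{m}" _ _ h2]) (use 2 that in \<open>auto simp: primitive_on_def\<close>)
  have "(?h has_integral (g y - g x)) {x..y}" if xy: "c \<le> x" "x \<le> y" "y \<le> d" for x y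
  proof (cases "y \<le> m \<or> m \<le> x")
    case True
    then show ?thesis using h1 h2 xy by auto
  next
    case False
    then have "(?h has_integral ((g m - g x) + (g y - g m))) {x..y}"
      using xy by (intro has_integral_combine[of x m y] h1 h2) auto
    then show ?thesis by simp
  qed
  moreover have "?h absolutely_integrable_on {c..d}"
  proof -
    have "?h absolutely_integrable_on {c..m}"
      by (rule absolutely_integrable_spike[where f=h1 and S="{}"]) (use 1 in \<open>auto simp: primitive_on_def\<close>)
    moreover have "?h absolutely_integrable_on {m..d}"
      by (rule absolutely_integrable_spike[where f=h2 and S="{m}"]) (use 2 in \<open>auto simp: primitive_on_def\<close>)
    moreover have "{c..d} = {c..m} \<union> {m..d}" using m by auto
    ultimately show ?thesis by (simp add: absolutely_integrable_Un)
  qed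
  ultimately show ?thesis unfolding primitive_on_def by blast
qed

text \<open>On an interval shorter than \<delta> all sums of increments are at most 1, so the
  positive variation is finite there and g splits into monotone absolutely continuous functions.
  Steps of length \<delta>/2 exhaust [c, d], and the densities are glued.\<close>

theorem real_AC_imp_primitive:
  assumes cd: "c \<le> d" and AC: "real_AC c d g"
  obtains h where "primitive_on c d g h"
proof -
  obtain \<delta> where d: "\<delta> > 0" "\<And>P. short_sums c d P \<Longrightarrow> total_length P < \<delta> \<Longrightarrow> var_sum g P < 1"
    using AC unfolding real_AC_iff by (meson zero_less_one)
  have loc: "\<exists>h. primitive_on x y g h" if xy: "c \<le> x" "x \<le> y" "y \<le> d" "y - x < \<delta>" for x y
  proof -
    have B: "inc_sum g P \<le> 1" if "short_sums x y P" for P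
    proof -
      have "short_sums c d P" using that xy short_sums_mono by blast
      moreover have "total_length P < \<delta>" using short_sums_length_Icc[OF that xy(2)] xy by simp
      ultimately show ?thesis using d(2) inc_sum_le_abs[of g P] by fastforce
    qed
    have ACg: "real_AC x y g" by (rule real_AC_mono[OF AC xy(1,3)])
    let ?p = "pos_variation x g"
    have ACp: "real_AC x y ?p" using pos_variation_AC[OF B ACg] by blast
    have "mono_on {x..y} ?p"
      using pos_variation_add(1)[OF B] by (auto intro!: mono_onI)
    then obtain h1 where h1: "primitive_on x y ?p h1"
      using mono_AC_imp_primitive[OF xy(2) _ ACp] by blast
    have "mono_on {x..y} (\<lambda>z. ?p z - g z)"
    proof (rule mono_onI)
      fix r s assume "r \<in> {x..y}" "s \<in> {x..y}" "r \<le> s"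
      then show "?p r - g r \<le> ?p s - g s" using pos_variation_add(2)[where c=x and d=y and x=r and y=s, OF B] by auto
    qed
    then obtain h2 where h2: "primitive_on x y (\<lambda>z. ?p z - g z) h2"
      using mono_AC_imp_primitive[OF xy(2) _ real_AC_diff[OF ACp ACg]] by blast
    from primitive_on_diff[OF h1 h2] show ?thesis by auto
  qed
  have "\<exists>h. primitive_on c (min d (c + real n * (\<delta>/2))) g h" for n
  proof (induction n)
    case 0
    show ?case using loc[of c c] cd d(1) by simp
  next
    case (Suc n)
    define z where "z = real n * (\<delta>/2)"
    let ?m = "min d (c + z)" and ?m' = "min d (c + (z + \<delta>/2))"
    have nn: "0 \<le> z" using d(1) by (simp add: z_def)
    obtain h1 where h1: "primitive_on c ?m g h1" using Suc by (auto simp: z_def)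
    have eq: "real (Suc n) * (\<delta>/2) = z + \<delta>/2" by (simp add: z_def algebra_simps)
    have "\<exists>h. primitive_on ?m ?m' g h"
      by (rule loc) (use cd d(1) nn in \<open>auto simp: min_def\<close>)
    then obtain h2 where "primitive_on ?m ?m' g h2" by blast
    have "c \<le> ?m" "?m \<le> ?m'" using cd d(1) nn by (auto simp: min_def)
    with primitive_on_combine[OF h1 \<open>primitive_on ?m ?m' g h2\<close>] have "\<exists>h. primitive_on c ?m' g h"
      by blast
    then show ?case unfolding eq .
  qed
  moreover obtain n where "(d - c) / (\<delta>/2) \<le> real n" using real_arch_simple by blast
  then have "min d (c + real n * (\<delta>/2)) = d" using d(1) by (simp add: field_simps)
  ultimately show ?thesis using that by metis
qed

text \<open>Absolute continuity of the integral. The part of |h| above a level n has integral below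
  e/2, and the part below that level contributes at most n times the total length; this dictates
  \<delta>.\<close>

lemma absolutely_integrable_small_sums:
  fixes h :: "real \<Rightarrow> real"
  assumes h: "h absolutely_integrable_on {c..d}" and "0 < e"
  obtains \<delta> where "\<delta> > 0"
    "\<And>P. short_sums c d P \<Longrightarrow> total_length P < \<delta> \<Longrightarrow> (\<Sum>(x, y)\<in>P. integral {x..y} (\<lambda>x. \<bar>h x\<bar>)) < e"
proof -
  define k where "k = (\<lambda>x. \<bar>h x\<bar>)"
  have k: "k absolutely_integrable_on {c..d}"
    unfolding k_def using h by (rule set_integrable_abs)
  define m where "m = (\<lambda>n x. min (k x) (real n))"
  have m_int: "m n absolutely_integrable_on {c..d}" for n
    unfolding m_def by (rule absolutely_integrable_min_1[OF k]) simp
  have "(\<lambda>n. integral {c..d} (\<lambda>x. k x - m n x)) \<longlonglongrightarrow> integral {c..d} (\<lambda>x. 0)"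
  proof (rule dominated_convergence(2))
    show "(\<lambda>x. k x - m n x) integrable_on {c..d}" for n
      using k m_int by (intro integrable_diff) (auto simp: absolutely_integrable_on_def)
    show "k integrable_on {c..d}" using k by (simp add: absolutely_integrable_on_def)
    show "norm (k x - m n x) \<le> k x" for n x by (auto simp: m_def k_def min_def)
    show "(\<lambda>n. k x - m n x) \<longlonglongrightarrow> 0" for x
    proof (rule tendsto_eventually)
      obtain N where "k x \<le> real N" using real_arch_simple by blast
      then show "\<forall>\<^sub>F n in sequentially. k x - m n x = 0"
        unfolding eventually_sequentially by (intro exI[of _ N]) (auto simp: m_def)
    qed
  qed
  then have "(\<lambda>n. integral {c..d} (\<lambda>x. k x - m n x)) \<longlonglongrightarrow> 0" by simp
  then have "\<forall>\<^sub>F n in sequentially. integral {c..d} (\<lambda>x. k x - m n x) < e/2"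
    using order_tendstoD(2)[of _ 0 sequentially "e/2"] \<open>0 < e\<close> by simp
  then obtain n where n: "integral {c..d} (\<lambda>x. k x - m n x) < e/2"
    by (auto simp: eventually_sequentially)
  define \<delta> where "\<delta> = e / (2 * (real n + 1))"
  have d: "\<delta> > 0" using \<open>0 < e\<close> by (simp add: \<delta>_def)
  have "(\<Sum>(x, y)\<in>P. integral {x..y} k) < e"
    if P: "short_sums c d P" "total_length P < \<delta>" for P
  proof -
    have fin: "finite P" and Pb: "\<And>x y. (x,y) \<in> P \<Longrightarrow> c \<le> x \<and> x < y \<and> y \<le> d"
      using P(1) by (auto simp: short_sums_def)
    have int: "k integrable_on {x..y}" "m n integrable_on {x..y}" if "(x,y) \<in> P" for x y
      using Pb[OF that] k m_int
      by (meson absolutely_integrable_on_def atLeastatMost_subset_iff integrable_on_subinterval order_less_imp_le)+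
    have "(\<Sum>(x, y)\<in>P. integral {x..y} k) \<le> (\<Sum>(x, y)\<in>P. integral {x..y} (\<lambda>x. k x - m n x) + n * (y - x))"
    proof (rule sum_mono, clarify)
      fix x y assume xy: "(x,y) \<in> P"
      have "integral {x..y} k = integral {x..y} (\<lambda>x. (k x - m n x)) + integral {x..y} (m n)"
        using int[OF xy] by (simp add: integral_diff)
      also have "integral {x..y} (m n) \<le> integral {x..y} (\<lambda>_. real n)"
        using int[OF xy] by (intro integral_le) (auto simp: m_def)
      also have "\<dots> = n * (y - x)" using Pb[OF xy] by simp
      finally show "integral {x..y} k \<le> integral {x..y} (\<lambda>x. k x - m n x) + n * (y - x)" by simp
    qed
    also have "\<dots> = (\<Sum>(x, y)\<in>P. integral {x..y} (\<lambda>x. k x - m n x)) + n * total_length P"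
      by (simp add: case_prod_unfold sum.distrib sum_distrib_left)
    also have "(\<Sum>(x, y)\<in>P. integral {x..y} (\<lambda>x. k x - m n x)) \<le> integral {c..d} (\<lambda>x. k x - m n x)"
    proof -
      have km: "(\<lambda>x. k x - m n x) integrable_on {c..d}"
        using k m_int by (intro integrable_diff) (auto simp: absolutely_integrable_on_def)
      have nn: "0 \<le> k x - m n x" for x by (simp add: m_def)
      have "(\<Sum>(x, y)\<in>P. integral {x..y} (\<lambda>x. k x - m n x)) = (\<Sum>z\<in>P. integral {fst z<..<snd z} (\<lambda>x. k x - m n x))"
        by (rule sum.cong) (auto simp: integral_open_interval_real)
      also have "\<dots> = integral (\<Union>z\<in>P. {fst z<..<snd z}) (\<lambda>x. k x - m n x)"
      proof (rule integral_unique[symmetric], rule has_integral_UN[OF fin])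
        fix z assume z: "z \<in> P"
        have "(\<lambda>x. k x - m n x) integrable_on {fst z..snd z}"
          using int[of "fst z" "snd z"] z by (intro integrable_diff) auto
        then show "((\<lambda>x. k x - m n x) has_integral integral {fst z<..<snd z} (\<lambda>x. k x - m n x)) {fst z<..<snd z}"
          by (simp add: integrable_integral integrable_on_open_interval_real)
      next
        show "pairwise (\<lambda>i i'. negligible ({fst i<..<snd i} \<inter> {fst i'<..<snd i'})) P"
        proof (rule pairwiseI)
          fix i i' assume "i \<in> P" "i' \<in> P" "i \<noteq> i'"
          then have "{fst i<..<snd i} \<inter> {fst i'<..<snd i'} = {}"
            using P(1) by (fastforce simp: short_sums_def disjoint_family_on_def)
          then show "negligible ({fst i<..<snd i} \<inter> {fst i'<..<snd i'})" by simp
        qed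
      qed
      also have "\<dots> \<le> integral {c..d} (\<lambda>x. k x - m n x)"
      proof (rule integral_subset_le)
        show "(\<lambda>x. k x - m n x) integrable_on (\<Union>z\<in>P. {fst z<..<snd z})"
        proof -
          have "(\<lambda>x. k x - m n x) absolutely_integrable_on {c..d}"
            using km nn by (intro nonnegative_absolutely_integrable_1) auto
          then have "(\<lambda>x. k x - m n x) absolutely_integrable_on (\<Union>z\<in>P. {fst z<..<snd z})"
            by (rule set_integrable_subset) (use fin Pb in \<open>auto intro!: sets.finite_UN, fastforce+\<close>)
          then show ?thesis by (simp add: absolutely_integrable_on_def)
        qed
      qed (use km nn Pb in \<open>auto, fastforce+\<close>)
      finally show ?thesis .
    qed
    also have "n * total_length P \<le> n * \<delta>"
      using P(2) by (intro mult_left_mono) auto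
    also have "\<dots> \<le> e/2"
      using \<open>0 < e\<close> by (simp add: \<delta>_def field_simps)
    finally show ?thesis using n by simp
  qed
  then show ?thesis using d that by (simp add: k_def)
qed

lemma primitive_on_imp_real_AC:
  assumes "primitive_on c d g h"
  shows "real_AC c d g"
  unfolding real_AC_iff
proof (intro allI impI)
  fix e :: real assume "0 < e"
  have h: "h absolutely_integrable_on {c..d}"
    and hi: "\<And>x y. c \<le> x \<Longrightarrow> x \<le> y \<Longrightarrow> y \<le> d \<Longrightarrow> (h has_integral (g y - g x)) {x..y}"
    using assms by (auto simp: primitive_on_def)
  obtain \<delta> where d: "\<delta> > 0"
    "\<And>P. short_sums c d P \<Longrightarrow> total_length P < \<delta> \<Longrightarrow> (\<Sum>(x, y)\<in>P. integral {x..y} (\<lambda>x. \<bar>h x\<bar>)) < e"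
    using absolutely_integrable_small_sums[OF h \<open>0 < e\<close>] by blast
  have "var_sum g P < e" if P: "short_sums c d P" "total_length P < \<delta>" for P
  proof -
    have "var_sum g P \<le> (\<Sum>(x, y)\<in>P. integral {x..y} (\<lambda>x. \<bar>h x\<bar>))"
    proof (rule sum_mono, clarify)
      fix x y assume "(x,y) \<in> P"
      then have xy: "c \<le> x" "x \<le> y" "y \<le> d" using P(1) by (auto simp: short_sums_def)
      then have "h absolutely_integrable_on {x..y}" using h by (auto intro: absolutely_integrable_on_subinterval)
      then have "norm (integral {x..y} h) \<le> integral {x..y} (\<lambda>x. \<bar>h x\<bar>)"
        by (intro integral_norm_bound_integral) (auto simp: absolutely_integrable_on_def)
      then show "\<bar>g y - g x\<bar> \<le> integral {x..y} (\<lambda>x. \<bar>h x\<bar>)"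
        using integral_unique[OF hi[OF xy]] by simp
    qed
    then show ?thesis using d(2)[OF P] by simp
  qed
  then show "\<exists>\<delta>>0. \<forall>P. short_sums c d P \<and> total_length P < \<delta> \<longrightarrow> var_sum g P < e"
    using d(1) by blast
qed

lemma integrable_right_difference_quotient:
  fixes f :: "real \<Rightarrow> real"
  assumes "\<And>a b. f integrable_on {a..b}"
  obtains N where "negligible N"
    "\<And>x. x \<notin> N \<Longrightarrow> ((\<lambda>h. integral {x..x + h} f / h) \<longlongrightarrow> f x) (at_right 0)"
proof -
  obtain N where N: "negligible N"
    "\<And>x e. \<lbrakk>x \<notin> N; 0 < e\<rbrakk> \<Longrightarrow> \<exists>d>0. \<forall>h. 0 < h \<and> h < d \<longrightarrow>
       norm (integral (cbox x (x + h *\<^sub>R One)) f /\<^sub>R h ^ DIM(real) - f x) < e"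
    using integrable_ccontinuous_explicit[of f] assms by (metis cbox_interval)
  have "((\<lambda>h. integral {x..x + h} f / h) \<longlongrightarrow> f x) (at_right 0)" if "x \<notin> N" for x
    unfolding tendsto_iff eventually_at
  proof (intro allI impI)
    fix e :: real assume "0 < e"
    from N(2)[OF that this] obtain d where "d > 0" "\<forall>h. 0 < h \<and> h < d \<longrightarrow>
       norm (integral (cbox x (x + h *\<^sub>R One)) f /\<^sub>R h ^ DIM(real) - f x) < e" by blast
    then show "\<exists>d>0. \<forall>h\<in>{0<..}. h \<noteq> 0 \<and> dist h 0 < d \<longrightarrow> dist (integral {x..x + h} f / h) (f x) < e"
      by (intro exI[of _ d]) (auto simp: dist_real_def cbox_interval divide_inverse mult.commute)
  qed
  with N(1) show ?thesis using that by blast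
qed

text \<open>Lebesgue's differentiation theorem is used for averages over intervals to the right of a
  point. Averages to the left of x are averages to the right of -x for the reflected function, whose
  exceptional null set is reflected back.\<close>

lemma primitive_on_has_derivative:
  assumes "primitive_on c d g h"
  obtains N where "negligible N" "\<And>x. x \<in> {c<..<d} - N \<Longrightarrow> (g has_real_derivative h x) (at x)"
proof -
  have h: "h absolutely_integrable_on {c..d}"
    and hi: "\<And>x y. c \<le> x \<Longrightarrow> x \<le> y \<Longrightarrow> y \<le> d \<Longrightarrow> (h has_integral (g y - g x)) {x..y}"
    using assms by (auto simp: primitive_on_def)
  define f where "f = (\<lambda>x. if x \<in> {c..d} then h x else 0)"
  have "f integrable_on UNIV"
    unfolding f_def integrable_restrict_UNIV using h by (simp add: absolutely_integrable_on_def)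
  then have f_int: "f integrable_on {a..b}" for a b
    by (rule integrable_on_subinterval) simp
  have f_h: "integral {x..y} f = g y - g x" if "c \<le> x" "x \<le> y" "y \<le> d" for x y
    by (rule integral_unique, rule has_integral_eq[OF _ hi[OF that]]) (use that in \<open>auto simp: f_def\<close>)
  obtain N1 where N1: "negligible N1"
    "\<And>x. x \<notin> N1 \<Longrightarrow> ((\<lambda>h. integral {x..x + h} f / h) \<longlongrightarrow> f x) (at_right 0)"
    using integrable_right_difference_quotient[OF f_int] by blast
  have fr_int: "(\<lambda>x. f (-x)) integrable_on {a..b}" for a b
    using f_int[of "-b" "-a"] Henstock_Kurzweil_Integration.integrable_reflect_real[where f=f and a="-b" and b="-a"] by simp
  obtain N2 where N2: "negligible N2"
    "\<And>x. x \<notin> N2 \<Longrightarrow> ((\<lambda>h. integral {x..x + h} (\<lambda>x. f (-x)) / h) \<longlongrightarrow> f (-x)) (at_right 0)"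
    using integrable_right_difference_quotient[OF fr_int] by blast
  have neg: "negligible (N1 \<union> uminus ` N2)"
  proof -
    have "negligible (uminus ` N2)"
      by (rule negligible_differentiable_image_negligible[OF _ N2(1)])
        (auto intro!: derivative_intros differentiable_on_minus differentiable_on_id simp: differentiable_on_def)
    then show ?thesis using N1(1) by simp
  qed
  have "(g has_real_derivative h x) (at x)" if x: "x \<in> {c<..<d} - (N1 \<union> uminus ` N2)" for x
  proof -
    have xN: "x \<notin> N1" "-x \<notin> N2" using x by (auto simp: image_iff)
    have fx: "f x = h x" using x by (simp add: f_def)
    have "((\<lambda>k. (g (x + k) - g x) / k) \<longlongrightarrow> h x) (at_right 0)"
    proof (rule Lim_transform_eventually)
      show "((\<lambda>k. integral {x..x + k} f / k) \<longlongrightarrow> h x) (at_right 0)" using N1(2)[OF xN(1)] fx by simp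
      show "\<forall>\<^sub>F k in at_right 0. integral {x..x + k} f / k = (g (x + k) - g x) / k"
        unfolding eventually_at by (intro exI[of _ "d - x"]) (use x in \<open>auto simp: f_h dist_real_def\<close>)
    qed
    moreover have "((\<lambda>k. (g (x + k) - g x) / k) \<longlongrightarrow> h x) (at_left 0)"
    proof -
      have "((\<lambda>k. (g (x - k) - g x) / (- k)) \<longlongrightarrow> h x) (at_right 0)"
      proof (rule Lim_transform_eventually)
        show "((\<lambda>k. integral {-x..-x + k} (\<lambda>x. f (-x)) / k) \<longlongrightarrow> h x) (at_right 0)" using N2(2)[OF xN(2)] fx by simp
        have "integral {-x..-x + k} (\<lambda>x. f (-x)) = integral {x - k..x} f" for k
          using Henstock_Kurzweil_Integration.integral_reflect_real[where a="x-k" and b=x and f=f] by (simp add: algebra_simps)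
        then show "\<forall>\<^sub>F k in at_right 0. integral {-x..-x + k} (\<lambda>x. f (-x)) / k = (g (x - k) - g x) / (- k)"
          unfolding eventually_at by (intro exI[of _ "x - c"]) (use x in \<open>auto simp: f_h dist_real_def field_simps\<close>)
      qed
      then show ?thesis unfolding filterlim_at_left_to_right by simp
    qed
    ultimately have "((\<lambda>k. (g (x + k) - g x) / k) \<longlongrightarrow> h x) (at 0)"
      by (rule filterlim_split_at[rotated])
    then show ?thesis by (simp add: DERIV_def)
  qed
  with neg show ?thesis using that by blast
qed

text \<open>Some density exists because g is absolutely continuous. It agrees with the derivative of
  g, hence with k, off a null set, so k is a density as well. In this way equations that hold almost
  everywhere are integrated.\<close>

lemma real_AC_has_integral:
  assumes "c \<le> d" "real_AC c d g" "negligible N"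
    and "\<And>x. x \<in> {c<..<d} - N \<Longrightarrow> (g has_real_derivative k x) (at x)"
  shows "primitive_on c d g k"
proof -
  obtain h where h: "primitive_on c d g h"
    using real_AC_imp_primitive[OF assms(1,2)] by blast
  obtain N' where N': "negligible N'" "\<And>x. x \<in> {c<..<d} - N' \<Longrightarrow> (g has_real_derivative h x) (at x)"
    using primitive_on_has_derivative[OF h] by blast
  have eq: "k x = h x" if "x \<in> {c..d} - (N \<union> N' \<union> {c,d})" for x
    using DERIV_unique[OF assms(4) N'(2)] that by auto
  have neg: "negligible (N \<union> N' \<union> {c,d})" using assms(3) N'(1) by auto
  show ?thesis unfolding primitive_on_def
  proof (intro conjI allI impI)
    show "k absolutely_integrable_on {c..d}"
      by (rule absolutely_integrable_spike[OF _ neg eq]) (use h in \<open>auto simp: primitive_on_def\<close>)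
    fix x y assume xy: "c \<le> x \<and> x \<le> y \<and> y \<le> d"
    show "(k has_integral g y - g x) {x..y}"
      by (rule has_integral_spike[OF neg eq]) (use h xy in \<open>auto simp: primitive_on_def\<close>)
  qed
qed

lemma real_AC_mult:
  assumes "real_AC c d f" "real_AC c d g"
  shows "real_AC c d (\<lambda>x. f x * g x)"
proof -
  have "bounded (f ` {c..d})" "bounded (g ` {c..d})"
    using assms by (auto intro!: compact_imp_bounded compact_continuous_image real_AC_imp_continuous_on)
  then obtain B1 B2 where B: "B1 > 0" "\<And>x. x \<in> {c..d} \<Longrightarrow> \<bar>f x\<bar> \<le> B1" "B2 > 0" "\<And>x. x \<in> {c..d} \<Longrightarrow> \<bar>g x\<bar> \<le> B2"
    unfolding bounded_pos by (metis imageI real_norm_def)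
  show ?thesis unfolding real_AC_iff
  proof (intro allI impI)
    fix e :: real assume "e > 0"
    have pos: "e/(2*B2) > 0" "e/(2*B1) > 0" using B \<open>e > 0\<close> by simp_all
    obtain \<delta>1 where 1: "\<delta>1 > 0" "\<And>P. short_sums c d P \<Longrightarrow> total_length P < \<delta>1 \<Longrightarrow> var_sum f P < e/(2*B2)"
      using assms(1) pos(1) unfolding real_AC_iff by blast
    obtain \<delta>2 where 2: "\<delta>2 > 0" "\<And>P. short_sums c d P \<Longrightarrow> total_length P < \<delta>2 \<Longrightarrow> var_sum g P < e/(2*B1)"
      using assms(2) pos(2) unfolding real_AC_iff by blast
    have "(\<Sum>(x, y)\<in>P. \<bar>f y * g y - f x * g x\<bar>) < e"
      if P: "short_sums c d P" "total_length P < min \<delta>1 \<delta>2" for P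
    proof -
      have "(\<Sum>(x, y)\<in>P. \<bar>f y * g y - f x * g x\<bar>) \<le> (\<Sum>(x, y)\<in>P. B2 * \<bar>f y - f x\<bar> + B1 * \<bar>g y - g x\<bar>)"
      proof (rule sum_mono, clarify)
        fix x y assume "(x,y) \<in> P"
        then have xy: "x \<in> {c..d}" "y \<in> {c..d}" using P(1) by (auto simp: short_sums_def)
        have "f y * g y - f x * g x = (f y - f x) * g y + f x * (g y - g x)" by (simp add: algebra_simps)
        also have "\<bar>\<dots>\<bar> \<le> \<bar>f y - f x\<bar> * \<bar>g y\<bar> + \<bar>f x\<bar> * \<bar>g y - g x\<bar>"
          by (metis abs_mult abs_triangle_ineq)
        also have "\<dots> \<le> \<bar>f y - f x\<bar> * B2 + B1 * \<bar>g y - g x\<bar>"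
          using B(2,4) xy by (intro add_mono mult_mono) (auto simp: B less_imp_le[OF B(1)] less_imp_le[OF B(3)])
        finally show "\<bar>f y * g y - f x * g x\<bar> \<le> B2 * \<bar>f y - f x\<bar> + B1 * \<bar>g y - g x\<bar>" by (simp add: mult.commute)
      qed
      also have "\<dots> = B2 * var_sum f P + B1 * var_sum g P"
        by (simp add: case_prod_unfold sum.distrib sum_distrib_left)
      also have "\<dots> < B2 * (e/(2*B2)) + B1 * (e/(2*B1))"
        using 1(2)[of P] 2(2)[of P] P B by (intro add_strict_mono mult_strict_left_mono) auto
      also have "\<dots> = e" using B by (simp add: field_simps)
      finally show ?thesis .
    qed
    then show "\<exists>\<delta>>0. \<forall>P. short_sums c d P \<and> total_length P < \<delta> \<longrightarrow> (\<Sum>(x, y)\<in>P. \<bar>f y * g y - f x * g x\<bar>) < e"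
      using 1(1) 2(1) by (intro exI[of _ "min \<delta>1 \<delta>2"]) auto
  qed
qed

text \<open>Integration by parts for mere densities: the product is absolutely continuous and the
  product rule holds almost everywhere, which identifies its density.\<close>

lemma primitive_on_mult:
  assumes cd: "c \<le> d" and f: "primitive_on c d f f'" and g: "primitive_on c d g g'"
  shows "primitive_on c d (\<lambda>x. f x * g x) (\<lambda>x. f' x * g x + f x * g' x)"
proof -
  obtain N1 where N1: "negligible N1" "\<And>x. x \<in> {c<..<d} - N1 \<Longrightarrow> (f has_real_derivative f' x) (at x)"
    using primitive_on_has_derivative[OF f] by blast
  obtain N2 where N2: "negligible N2" "\<And>x. x \<in> {c<..<d} - N2 \<Longrightarrow> (g has_real_derivative g' x) (at x)"
    using primitive_on_has_derivative[OF g] by blast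
  show ?thesis
  proof (rule real_AC_has_integral[OF cd real_AC_mult])
    show "negligible (N1 \<union> N2)" using N1(1) N2(1) by simp
    fix x assume "x \<in> {c<..<d} - (N1 \<union> N2)"
    then show "((\<lambda>x. f x * g x) has_real_derivative f' x * g x + f x * g' x) (at x)"
      using DERIV_mult[OF N1(2) N2(2), of x] by (auto simp: mult.commute add.commute)
  qed (use f g in \<open>auto intro: primitive_on_imp_real_AC\<close>)
qed

section \<open>Linear systems with integrable coefficients\<close>

lemma primitive_on_subinterval:
  "primitive_on c d g h \<Longrightarrow> c \<le> c' \<Longrightarrow> d' \<le> d \<Longrightarrow> primitive_on c' d' g h"
  unfolding primitive_on_def
  by (auto intro: absolutely_integrable_on_subinterval)

lemma primitive_on_continuous: "primitive_on c d g h \<Longrightarrow> continuous_on {c..d} g"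
  by (intro real_AC_imp_continuous_on primitive_on_imp_real_AC)

lemma primitive_on_add:
  assumes "primitive_on c d g1 h1" "primitive_on c d g2 h2"
  shows "primitive_on c d (\<lambda>x. g1 x + g2 x) (\<lambda>x. h1 x + h2 x)"
  unfolding primitive_on_def
proof (intro conjI allI impI)
  fix x y assume xy: "c \<le> x \<and> x \<le> y \<and> y \<le> d"
  have "((\<lambda>x. h1 x + h2 x) has_integral (g1 y - g1 x) + (g2 y - g2 x)) {x..y}"
    by (rule has_integral_add) (use assms xy in \<open>auto simp: primitive_on_def\<close>)
  then show "((\<lambda>x. h1 x + h2 x) has_integral g1 y + g2 y - (g1 x + g2 x)) {x..y}"
    by (simp add: algebra_simps)
qed (use assms in \<open>auto simp: primitive_on_def intro: set_integral_add\<close>)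

lemma primitive_on_cmult:
  assumes "primitive_on c d g h"
  shows "primitive_on c d (\<lambda>x. a * g x) (\<lambda>x. a * h x)"
  unfolding primitive_on_def
proof (intro conjI allI impI)
  fix x y assume xy: "c \<le> x \<and> x \<le> y \<and> y \<le> d"
  have "((\<lambda>x. a * h x) has_integral a * (g y - g x)) {x..y}"
    by (rule has_integral_mult_right) (use assms xy in \<open>auto simp: primitive_on_def\<close>)
  then show "((\<lambda>x. a * h x) has_integral a * g y - a * g x) {x..y}"
    by (simp add: algebra_simps)
qed (use assms in \<open>auto simp: primitive_on_def intro: set_integrable_mult_right\<close>)

lemma primitive_on_const: "primitive_on c d (\<lambda>_. a) (\<lambda>_. 0)"
  by (auto simp: primitive_on_def set_integrable_def)

lemma primitive_on_sum:
  assumes "finite A" "\<And>i. i \<in> A \<Longrightarrow> primitive_on c d (g i) (h i)"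
  shows "primitive_on c d (\<lambda>x. \<Sum>i\<in>A. g i x) (\<lambda>x. \<Sum>i\<in>A. h i x)"
  using assms by (induction A rule: finite_induct) (simp_all add: primitive_on_const primitive_on_add)

lemma primitive_on_cong:
  assumes "primitive_on c d g h" "\<And>x. x \<in> {c..d} \<Longrightarrow> g x = g' x" "\<And>x. x \<in> {c..d} \<Longrightarrow> h x = h' x"
  shows "primitive_on c d g' h'"
proof -
  have "h' absolutely_integrable_on {c..d}"
    by (rule absolutely_integrable_spike[where f=h and S="{}"]) (use assms in \<open>auto simp: primitive_on_def\<close>)
  moreover have "(h' has_integral g' y - g' x) {x..y}" if "c \<le> x" "x \<le> y" "y \<le> d" for x y
    by (rule has_integral_eq[of _ h]) (use assms that in \<open>auto simp: primitive_on_def\<close>)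
  ultimately show ?thesis by (auto simp: primitive_on_def)
qed

lemma primitive_on_power:
  assumes cd: "c \<le> d" and g: "primitive_on c d g h"
  shows "primitive_on c d (\<lambda>x. g x ^ Suc n) (\<lambda>x. (real n + 1) * h x * g x ^ n)"
proof (induction n)
  case 0 then show ?case using g by simp
next
  case (Suc n)
  have "primitive_on c d (\<lambda>x. g x * g x ^ Suc n) (\<lambda>x. h x * g x ^ Suc n + g x * ((real n + 1) * h x * g x ^ n))"
    by (rule primitive_on_mult[OF cd g Suc])
  then show ?case
    by (rule primitive_on_cong) (auto simp: algebra_simps)
qed

text \<open>The kernel of the oriented integral from x0 to x. With a kernel the integral runs over
  the whole line on either side of x0, so that joint measurability in x and a parameter comes from
  the general theorem on parameter integrals (\<open>sint_measurable\<close>).\<close>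

definition signed_ind :: "real \<Rightarrow> real \<Rightarrow> real \<Rightarrow> real" where
  "signed_ind x0 x s = indicator {x0<..x} s - indicator {x<..x0} s"

definition sint :: "real \<Rightarrow> (real \<Rightarrow> real) \<Rightarrow> real \<Rightarrow> real" where
  "sint x0 g x = (LINT s|lebesgue. signed_ind x0 x s * g s)"

lemma sint_eq:
  assumes "g absolutely_integrable_on closed_segment x0 x"
  shows "sint x0 g x = (if x0 \<le> x then integral {x0..x} g else - integral {x..x0} g)"
proof (cases "x0 \<le> x")
  case True
  then have 1: "g absolutely_integrable_on {x0..x}" using assms by (simp add: closed_segment_eq_real_ivl)
  then have 2: "g absolutely_integrable_on {x0<..x}" by (rule set_integrable_subset) auto
  have "sint x0 g x = (LINT s:{x0<..x}|lebesgue. g s)"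
    using True by (simp add: sint_def signed_ind_def set_lebesgue_integral_def)
  also have "\<dots> = integral {x0<..x} g" by (rule set_lebesgue_integral_eq_integral(2)[OF 2])
  also have "\<dots> = integral {x0..x} g"
    by (rule integral_spike_set[OF negligible_subset[OF negligible_empty] negligible_subset[OF negligible_sing[of x0]]]) auto
  finally show ?thesis using True by simp
next
  case False
  then have 1: "g absolutely_integrable_on {x..x0}" using assms by (simp add: closed_segment_eq_real_ivl)
  then have 2: "g absolutely_integrable_on {x<..x0}" by (rule set_integrable_subset) auto
  have "sint x0 g x = - (LINT s:{x<..x0}|lebesgue. g s)"
    using False by (simp add: sint_def signed_ind_def set_lebesgue_integral_def)
  also have "(LINT s:{x<..x0}|lebesgue. g s) = integral {x<..x0} g" by (rule set_lebesgue_integral_eq_integral(2)[OF 2])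
  also have "\<dots> = integral {x..x0} g"
    by (rule integral_spike_set[OF negligible_subset[OF negligible_empty] negligible_subset[OF negligible_sing[of x]]]) auto
  finally show ?thesis using False by simp
qed

lemma sint_base [simp]: "sint x0 g x0 = 0"
  by (simp add: sint_def signed_ind_def)

lemma primitive_on_sint:
  assumes g: "g absolutely_integrable_on {c..d}" and x0: "c \<le> x0" "x0 \<le> d"
  shows "primitive_on c d (sint x0 g) g"
  unfolding primitive_on_def
proof (intro conjI allI impI)
  fix x y assume xy: "c \<le> x \<and> x \<le> y \<and> y \<le> d"
  have int: "g integrable_on {s..t}" if "c \<le> s" "t \<le> d" for s t
    using absolutely_integrable_on_subinterval[OF g, of s t] that by (auto simp: absolutely_integrable_on_def)
  have seg: "g absolutely_integrable_on closed_segment x0 z" if "c \<le> z" "z \<le> d" for z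
    using absolutely_integrable_on_subinterval[OF g] that x0 by (auto simp: closed_segment_eq_real_ivl)
  have "integral {x..y} g = sint x0 g y - sint x0 g x"
  proof -
    consider "x0 \<le> x" | "x < x0" "x0 \<le> y" | "y < x0" by linarith
    then show ?thesis
    proof cases
      case 1
      have "integral {x0..x} g + integral {x..y} g = integral {x0..y} g"
        by (rule Henstock_Kurzweil_Integration.integral_combine) (use 1 xy x0 int in auto)
      then show ?thesis using 1 xy x0 by (simp add: sint_eq seg)
    next
      case 2
      have "integral {x..x0} g + integral {x0..y} g = integral {x..y} g"
        by (rule Henstock_Kurzweil_Integration.integral_combine) (use 2 xy x0 int in auto)
      then show ?thesis using 2 xy x0 by (simp add: sint_eq seg)
    next
      case 3
      have "integral {x..y} g + integral {y..x0} g = integral {x..x0} g"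
        by (rule Henstock_Kurzweil_Integration.integral_combine) (use 3 xy x0 int in auto)
      then show ?thesis using 3 xy x0 by (simp add: sint_eq seg)
    qed
  qed
  then show "(g has_integral sint x0 g y - sint x0 g x) {x..y}"
    using int[of x y] xy by (simp add: has_integral_iff)
qed (use g in simp)

text \<open>\<open>picard \<dots> n\<close> is the \<open>n\<close>-th increment of Picard's iteration, not the \<open>n\<close>-th iterate.\<close>

fun picard :: "(real \<Rightarrow> real) \<Rightarrow> real \<Rightarrow> real \<Rightarrow> real \<Rightarrow> nat \<Rightarrow> (real \<Rightarrow> real) \<times> (real \<Rightarrow> real)" where
  "picard Q x0 \<xi> \<eta> 0 = (\<lambda>_. \<xi>, \<lambda>_. \<eta>)"
| "picard Q x0 \<xi> \<eta> (Suc n) =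
    (sint x0 (snd (picard Q x0 \<xi> \<eta> n)), sint x0 (\<lambda>s. Q s * fst (picard Q x0 \<xi> \<eta> n) s))"

definition sol_u :: "(real \<Rightarrow> real) \<Rightarrow> real \<Rightarrow> real \<Rightarrow> real \<Rightarrow> real \<Rightarrow> real" where
  "sol_u Q x0 \<xi> \<eta> x = (\<Sum>n. fst (picard Q x0 \<xi> \<eta> n) x)"

definition sol_w :: "(real \<Rightarrow> real) \<Rightarrow> real \<Rightarrow> real \<Rightarrow> real \<Rightarrow> real \<Rightarrow> real" where
  "sol_w Q x0 \<xi> \<eta> x = (\<Sum>n. snd (picard Q x0 \<xi> \<eta> n) x)"

text \<open>\<open>k\<close> dominates both coefficients of the system \<open>u' = w\<close>, \<open>w' = Q u\<close>.\<close>

locale ode_interval =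
  fixes c d x0 :: real and k :: "real \<Rightarrow> real"
  assumes x0: "c \<le> x0" "x0 \<le> d"
    and k_int: "k absolutely_integrable_on {c..d}"
    and k_ge: "\<And>x. 1 \<le> k x"
begin

text \<open>The distance from x0 to x measured with the weight k. Picard estimates take the form
  \<open>M * KK x ^ n / fact n\<close>.\<close>

definition KK :: "real \<Rightarrow> real" where "KK x = \<bar>sint x0 k x\<bar>"

lemma c_le_d: "c \<le> d" using x0 by simp

lemma prim_k: "primitive_on c d (sint x0 k) k"
  by (rule primitive_on_sint[OF k_int x0])

lemma sint_k_sign:
  assumes "x \<in> {c..d}"
  shows "x0 \<le> x \<Longrightarrow> 0 \<le> sint x0 k x" "x \<le> x0 \<Longrightarrow> sint x0 k x \<le> 0"
proof -
  have *: "sint x0 k s \<le> sint x0 k t" if "c \<le> s" "s \<le> t" "t \<le> d" for s t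
  proof -
    have "(k has_integral (sint x0 k t - sint x0 k s)) {s..t}"
      using prim_k that by (auto simp: primitive_on_def)
    then have "0 \<le> sint x0 k t - sint x0 k s"
      by (rule has_integral_nonneg) (use k_ge in \<open>auto intro: order_trans[OF zero_le_one]\<close>)
    then show ?thesis by simp
  qed
  show "x0 \<le> x \<Longrightarrow> 0 \<le> sint x0 k x" using *[of x0 x] assms x0 by simp
  show "x \<le> x0 \<Longrightarrow> sint x0 k x \<le> 0" using *[of x x0] assms x0 by simp
qed

lemma KK_has_integral:
  assumes x: "x \<in> {c..d}"
  shows "((\<lambda>s. k s * KK s ^ n) has_integral KK x ^ Suc n / (real n + 1)) (closed_segment x0 x)"
proof -
  let ?S = "sint x0 k"
  have S: "((\<lambda>s. (real n + 1) * k s * ?S s ^ n) has_integral (?S t ^ Suc n - ?S s ^ Suc n)) {s..t}"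
    if "c \<le> s" "s \<le> t" "t \<le> d" for s t
    using primitive_on_power[OF c_le_d prim_k, of n] that by (auto simp: primitive_on_def)
  show ?thesis
  proof (cases "x0 \<le> x")
    case True
    have "((\<lambda>s. ((real n + 1) * k s * ?S s ^ n) / (real n + 1)) has_integral (?S x ^ Suc n - ?S x0 ^ Suc n) / (real n + 1)) {x0..x}"
      by (rule has_integral_divide, rule S) (use x x0 True in auto)
    then have "((\<lambda>s. k s * ?S s ^ n) has_integral ?S x ^ Suc n / (real n + 1)) {x0..x}"
      by simp
    then have "((\<lambda>s. k s * KK s ^ n) has_integral ?S x ^ Suc n / (real n + 1)) {x0..x}"
      by (rule has_integral_eq[rotated]) (use x x0 True sint_k_sign in \<open>auto simp: KK_def\<close>)
    moreover have "KK x = ?S x" using sint_k_sign(1)[OF x True] by (simp add: KK_def)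
    ultimately show ?thesis using True by (simp add: closed_segment_eq_real_ivl)
  next
    case False
    \<comment> \<open>Left of x0 the oriented integral \<open>?S\<close> is nonpositive; the factor
      (-1)^n turns its powers into powers of \<open>KK\<close>.\<close>
    have "((\<lambda>s. ((real n + 1) * k s * ?S s ^ n) * ((-1)^n / (real n + 1))) has_integral (?S x0 ^ Suc n - ?S x ^ Suc n) * ((-1)^n / (real n + 1))) {x..x0}"
      by (rule has_integral_mult_left, rule S) (use x x0 False in auto)
    moreover have "(\<lambda>s. ((real n + 1) * k s * ?S s ^ n) * ((-1)^n / (real n + 1))) = (\<lambda>s. k s * (- ?S s) ^ n)"
      by (simp add: fun_eq_iff power_minus[of "?S _"])
    moreover have "(?S x0 ^ Suc n - ?S x ^ Suc n) * ((-1)^n / (real n + 1)) = (- ?S x) ^ Suc n / (real n + 1)"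
      by (simp add: power_minus[of "?S x"])
    ultimately have "((\<lambda>s. k s * (- ?S s) ^ n) has_integral (- ?S x) ^ Suc n / (real n + 1)) {x..x0}"
      by (simp only:)
    then have "((\<lambda>s. k s * KK s ^ n) has_integral (- ?S x) ^ Suc n / (real n + 1)) {x..x0}"
      by (rule has_integral_eq[rotated]) (use x x0 False sint_k_sign in \<open>auto simp: KK_def\<close>)
    moreover have "KK x = - ?S x" using sint_k_sign(2)[OF x] False by (simp add: KK_def)
    ultimately show ?thesis using False by (simp add: closed_segment_eq_real_ivl)
  qed
qed

text \<open>Integrating k times the n-th bound yields the bound of order n + 1. The uniqueness
  theorem and the convergence of Picard's iteration are both inductions over this step.\<close>

lemma primitive_bound_step:
  assumes g: "primitive_on c d \<phi> g" "\<phi> x0 = 0"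
    and bd: "\<And>s. s \<in> {c..d} \<Longrightarrow> \<bar>g s\<bar> \<le> k s * (M * KK s ^ n / fact n)"
    and x: "x \<in> {c..d}"
  shows "\<bar>\<phi> x\<bar> \<le> M * KK x ^ Suc n / fact (Suc n)"
proof -
  have seg: "closed_segment x0 x \<subseteq> {c..d}" using x x0 by (auto simp: closed_segment_eq_real_ivl)
  have gi: "(g has_integral (if x0 \<le> x then \<phi> x else - \<phi> x)) (closed_segment x0 x)"
  proof (cases "x0 \<le> x")
    case True
    then have "(g has_integral \<phi> x - \<phi> x0) {x0..x}" using g(1) x x0 by (auto simp: primitive_on_def)
    then show ?thesis using True g(2) by (simp add: closed_segment_eq_real_ivl)
  next
    case False
    then have "(g has_integral \<phi> x0 - \<phi> x) {x..x0}" using g(1) x x0 by (auto simp: primitive_on_def)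
    then show ?thesis using False g(2) by (simp add: closed_segment_eq_real_ivl)
  qed
  have "((\<lambda>s. (M / fact n) * (k s * KK s ^ n)) has_integral (M / fact n) * (KK x ^ Suc n / (real n + 1))) (closed_segment x0 x)"
    by (intro has_integral_mult_right KK_has_integral x)
  then have bi: "((\<lambda>s. k s * (M * KK s ^ n / fact n)) has_integral M * KK x ^ Suc n / fact (Suc n)) (closed_segment x0 x)"
    by (simp add: field_simps)
  have "\<bar>\<phi> x\<bar> = norm (integral (closed_segment x0 x) g)"
    using integral_unique[OF gi] by simp
  also have "\<dots> \<le> integral (closed_segment x0 x) (\<lambda>s. k s * (M * KK s ^ n / fact n))"
    by (rule integral_norm_bound_integral) (use gi bi bd seg in \<open>auto simp: has_integral_iff\<close>)
  also have "\<dots> = M * KK x ^ Suc n / fact (Suc n)" using bi by (rule integral_unique)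
  finally show ?thesis .
qed

lemma KK_bound: obtains B where "\<And>x. x \<in> {c..d} \<Longrightarrow> KK x \<le> B" "0 \<le> B"
proof -
  have "continuous_on {c..d} KK"
    unfolding KK_def using primitive_on_continuous[OF prim_k] by (intro continuous_intros)
  then have "bounded (KK ` {c..d})"
    by (intro compact_imp_bounded compact_continuous_image) auto
  then obtain B where "0 < B" "\<And>x. x \<in> {c..d} \<Longrightarrow> norm (KK x) \<le> B"
    unfolding bounded_pos by (metis imageI)
  then show ?thesis by (intro that[of B]) (auto simp: abs_le_iff)
qed

lemma absolutely_integrable_dominated:
  fixes Q f :: "real \<Rightarrow> real"
  assumes Q: "Q absolutely_integrable_on {c..d}" and f: "continuous_on {c..d} f"
  shows "(\<lambda>s. Q s * f s) absolutely_integrable_on {c..d}"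
proof -
  have "bounded (f ` {c..d})"
    using f by (intro compact_imp_bounded compact_continuous_image) auto
  moreover have "f \<in> borel_measurable (lebesgue_on {c..d})"
    using f by (intro continuous_imp_measurable_on_sets_lebesgue) auto
  ultimately have "(\<lambda>s. f s * Q s) absolutely_integrable_on {c..d}"
    using Q absolutely_integrable_bounded_measurable_product_real[of f "{c..d}" Q] by simp
  then show ?thesis by (simp add: mult.commute)
qed

text \<open>Starting from a common bound M of u and w, repeated integration gives the bounds
  \<open>M * KK x ^ n / fact n\<close> for every n, and these tend to 0.\<close>

theorem system_unique:
  assumes Qk: "\<And>x. x \<in> {c..d} \<Longrightarrow> \<bar>Q x\<bar> \<le> k x"
    and u: "primitive_on c d u w" and w: "primitive_on c d w (\<lambda>s. Q s * u s)"
    and 0: "u x0 = 0" "w x0 = 0" and x: "x \<in> {c..d}"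
  shows "u x = 0 \<and> w x = 0"
proof -
  have "bounded (u ` {c..d})" "bounded (w ` {c..d})"
    using u w by (auto intro!: compact_imp_bounded compact_continuous_image primitive_on_continuous)
  then obtain B1 B2 where B: "\<And>x. x \<in> {c..d} \<Longrightarrow> \<bar>u x\<bar> \<le> B1" "\<And>x. x \<in> {c..d} \<Longrightarrow> \<bar>w x\<bar> \<le> B2"
    unfolding bounded_iff by (metis imageI real_norm_def)
  define M where "M = max B1 B2"
  have "\<forall>x\<in>{c..d}. \<bar>u x\<bar> \<le> M * KK x ^ n / fact n \<and> \<bar>w x\<bar> \<le> M * KK x ^ n / fact n" for n
  proof (induction n)
    case 0 then show ?case using B by (fastforce simp: M_def)
  next
    case (Suc n)
    show ?case
    proof (intro ballI conjI)
      fix x assume x: "x \<in> {c..d}"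
      show "\<bar>u x\<bar> \<le> M * KK x ^ Suc n / fact (Suc n)"
      proof (rule primitive_bound_step[OF u 0(1) _ x])
        fix s assume s: "s \<in> {c..d}"
        have "\<bar>w s\<bar> \<le> 1 * (M * KK s ^ n / fact n)" using Suc s by simp
        also have "\<dots> \<le> k s * (M * KK s ^ n / fact n)"
          using Suc s k_ge by (intro mult_right_mono) (auto intro: order_trans[OF abs_ge_zero])
        finally show "\<bar>w s\<bar> \<le> k s * (M * KK s ^ n / fact n)" .
      qed
      show "\<bar>w x\<bar> \<le> M * KK x ^ Suc n / fact (Suc n)"
      proof (rule primitive_bound_step[OF w 0(2) _ x])
        fix s assume s: "s \<in> {c..d}"
        then show "\<bar>Q s * u s\<bar> \<le> k s * (M * KK s ^ n / fact n)"
          unfolding abs_mult using Suc Qk k_ge[of s] by (intro mult_mono) auto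
      qed
    qed
  qed
  then have *: "\<bar>u x\<bar> \<le> M * (KK x ^ n / fact n)" "\<bar>w x\<bar> \<le> M * (KK x ^ n / fact n)" for n
    using x by auto
  have "(\<lambda>n. KK x ^ n / fact n) \<longlonglongrightarrow> 0"
    using summable_LIMSEQ_zero[OF sums_summable[OF exp_converges[of "KK x"]]] by (simp add: divide_inverse mult.commute)
  then have "(\<lambda>n. M * (KK x ^ n / fact n)) \<longlonglongrightarrow> M * 0" by (intro tendsto_intros)
  then have lim: "(\<lambda>n. M * (KK x ^ n / fact n)) \<longlonglongrightarrow> 0" by simp
  have "\<bar>u x\<bar> \<le> 0" "\<bar>w x\<bar> \<le> 0"
    by (rule LIMSEQ_le_const[OF lim], use * in blast)+
  then show ?thesis by simp
qed

context
  fixes Q :: "real \<Rightarrow> real" and \<xi> \<eta> :: real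
  assumes Q_int: "Q absolutely_integrable_on {c..d}" and Qk: "\<And>x. x \<in> {c..d} \<Longrightarrow> \<bar>Q x\<bar> \<le> k x"
begin

lemma picard_step:
  "continuous_on {c..d} (fst (picard Q x0 \<xi> \<eta> n)) \<and> continuous_on {c..d} (snd (picard Q x0 \<xi> \<eta> n)) \<and>
   primitive_on c d (fst (picard Q x0 \<xi> \<eta> (Suc n))) (snd (picard Q x0 \<xi> \<eta> n)) \<and>
   primitive_on c d (snd (picard Q x0 \<xi> \<eta> (Suc n))) (\<lambda>s. Q s * fst (picard Q x0 \<xi> \<eta> n) s)"
proof (induction n)
  case 0
  have "primitive_on c d (sint x0 (\<lambda>_. \<eta>)) (\<lambda>_. \<eta>)"
    by (intro primitive_on_sint x0 absolutely_integrable_continuous_real continuous_intros)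
  moreover have "primitive_on c d (sint x0 (\<lambda>s. Q s * \<xi>)) (\<lambda>s. Q s * \<xi>)"
    by (intro primitive_on_sint x0 absolutely_integrable_dominated Q_int continuous_intros)
  ultimately show ?case by simp
next
  case (Suc n)
  let ?u = "fst (picard Q x0 \<xi> \<eta> (Suc n))" and ?w = "snd (picard Q x0 \<xi> \<eta> (Suc n))"
  have cont: "continuous_on {c..d} ?u" "continuous_on {c..d} ?w"
    using Suc primitive_on_continuous by blast+
  moreover have "primitive_on c d (sint x0 ?w) ?w"
    by (intro primitive_on_sint x0 absolutely_integrable_continuous_real cont)
  moreover have "primitive_on c d (sint x0 (\<lambda>s. Q s * ?u s)) (\<lambda>s. Q s * ?u s)"
    by (intro primitive_on_sint x0 absolutely_integrable_dominated Q_int cont)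
  ultimately show ?case by (simp only: picard.simps fst_conv snd_conv)
qed

lemma picard_bound:
  assumes M: "\<bar>\<xi>\<bar> \<le> M" "\<bar>\<eta>\<bar> \<le> M" and x: "x \<in> {c..d}"
  shows "\<bar>fst (picard Q x0 \<xi> \<eta> n) x\<bar> \<le> M * KK x ^ n / fact n"
    "\<bar>snd (picard Q x0 \<xi> \<eta> n) x\<bar> \<le> M * KK x ^ n / fact n"
proof -
  have "\<forall>x\<in>{c..d}. \<bar>fst (picard Q x0 \<xi> \<eta> n) x\<bar> \<le> M * KK x ^ n / fact n \<and>
    \<bar>snd (picard Q x0 \<xi> \<eta> n) x\<bar> \<le> M * KK x ^ n / fact n"
  proof (induction n)
    case 0 then show ?case using M by simp
  next
    case (Suc n)
    show ?case
    proof (intro ballI conjI)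
      fix x assume x: "x \<in> {c..d}"
      show "\<bar>fst (picard Q x0 \<xi> \<eta> (Suc n)) x\<bar> \<le> M * KK x ^ Suc n / fact (Suc n)"
      proof (rule primitive_bound_step[OF _ _ _ x])
        fix s assume s: "s \<in> {c..d}"
        have "\<bar>snd (picard Q x0 \<xi> \<eta> n) s\<bar> \<le> 1 * (M * KK s ^ n / fact n)" using Suc s by simp
        also have "\<dots> \<le> k s * (M * KK s ^ n / fact n)"
          using Suc s k_ge by (intro mult_right_mono) (auto intro: order_trans[OF abs_ge_zero])
        finally show "\<bar>snd (picard Q x0 \<xi> \<eta> n) s\<bar> \<le> k s * (M * KK s ^ n / fact n)" .
      qed (use picard_step in auto)
      show "\<bar>snd (picard Q x0 \<xi> \<eta> (Suc n)) x\<bar> \<le> M * KK x ^ Suc n / fact (Suc n)"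
      proof (rule primitive_bound_step[OF _ _ _ x])
        fix s assume s: "s \<in> {c..d}"
        then show "\<bar>Q s * fst (picard Q x0 \<xi> \<eta> n) s\<bar> \<le> k s * (M * KK s ^ n / fact n)"
          unfolding abs_mult using Suc Qk k_ge[of s] by (intro mult_mono) auto
      qed (use picard_step in auto)
    qed
  qed
  then show "\<bar>fst (picard Q x0 \<xi> \<eta> n) x\<bar> \<le> M * KK x ^ n / fact n"
    "\<bar>snd (picard Q x0 \<xi> \<eta> n) x\<bar> \<le> M * KK x ^ n / fact n"
    using x by auto
qed

lemma exp_sums: "(\<lambda>n. M * KK x ^ n / fact n) sums (M * exp (KK x))"
  using sums_mult[OF exp_converges[of "KK x"], of M] by (simp add: divide_inverse mult_ac)

lemma sol_bound:
  assumes M: "\<bar>\<xi>\<bar> \<le> M" "\<bar>\<eta>\<bar> \<le> M" and x: "x \<in> {c..d}"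
  shows "(\<lambda>n. fst (picard Q x0 \<xi> \<eta> n) x) sums sol_u Q x0 \<xi> \<eta> x"
    "(\<lambda>n. snd (picard Q x0 \<xi> \<eta> n) x) sums sol_w Q x0 \<xi> \<eta> x"
    "\<bar>\<Sum>i<n. fst (picard Q x0 \<xi> \<eta> i) x\<bar> \<le> M * exp (KK x)"
    "\<bar>\<Sum>i<n. snd (picard Q x0 \<xi> \<eta> i) x\<bar> \<le> M * exp (KK x)"
    "\<bar>sol_u Q x0 \<xi> \<eta> x\<bar> \<le> M * exp (KK x)"
    "\<bar>sol_w Q x0 \<xi> \<eta> x\<bar> \<le> M * exp (KK x)"
proof -
  have M0: "0 \<le> M" using M by simp
  have sm: "summable (\<lambda>n. M * KK x ^ n / fact n)" using exp_sums by (rule sums_summable)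
  have sum_le: "(\<Sum>i<n. M * KK x ^ i / fact i) \<le> M * exp (KK x)" for n
    using sum_le_suminf[OF sm, of "{..<n}"] sums_unique[OF exp_sums[of M x]] M0 by (auto simp: KK_def)
  show 1: "(\<lambda>n. fst (picard Q x0 \<xi> \<eta> n) x) sums sol_u Q x0 \<xi> \<eta> x"
    unfolding sol_u_def
    by (rule summable_sums, rule summable_comparison_test'[OF sm]) (use picard_bound(1)[OF M x] in auto)
  show 2: "(\<lambda>n. snd (picard Q x0 \<xi> \<eta> n) x) sums sol_w Q x0 \<xi> \<eta> x"
    unfolding sol_w_def
    by (rule summable_sums, rule summable_comparison_test'[OF sm]) (use picard_bound(2)[OF M x] in auto)
  show 3: "\<bar>\<Sum>i<n. fst (picard Q x0 \<xi> \<eta> i) x\<bar> \<le> M * exp (KK x)" for n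
    by (rule order_trans[OF sum_abs], rule order_trans[OF sum_mono sum_le]) (rule picard_bound[OF M x])
  show 4: "\<bar>\<Sum>i<n. snd (picard Q x0 \<xi> \<eta> i) x\<bar> \<le> M * exp (KK x)" for n
    by (rule order_trans[OF sum_abs], rule order_trans[OF sum_mono sum_le]) (rule picard_bound[OF M x])
  show "\<bar>sol_u Q x0 \<xi> \<eta> x\<bar> \<le> M * exp (KK x)"
    by (rule LIMSEQ_le_const2[OF tendsto_rabs]) (use 1 3 in \<open>auto simp: sums_def\<close>)
  show "\<bar>sol_w Q x0 \<xi> \<eta> x\<bar> \<le> M * exp (KK x)"
    by (rule LIMSEQ_le_const2[OF tendsto_rabs]) (use 2 4 in \<open>auto simp: sums_def\<close>)
qed

lemma sol_initial: "sol_u Q x0 \<xi> \<eta> x0 = \<xi>" "sol_w Q x0 \<xi> \<eta> x0 = \<eta>"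
proof -
  have "fst (picard Q x0 \<xi> \<eta> n) x0 = (if n = 0 then \<xi> else 0)"
    "snd (picard Q x0 \<xi> \<eta> n) x0 = (if n = 0 then \<eta> else 0)" for n
    by (cases n; simp)+
  then have "(\<lambda>n. fst (picard Q x0 \<xi> \<eta> n) x0) sums \<xi>" "(\<lambda>n. snd (picard Q x0 \<xi> \<eta> n) x0) sums \<eta>"
    using sums_If_finite[of "\<lambda>n. n = 0" "\<lambda>_. \<xi>"] sums_If_finite[of "\<lambda>n. n = 0" "\<lambda>_. \<eta>"] by simp_all
  then show "sol_u Q x0 \<xi> \<eta> x0 = \<xi>" "sol_w Q x0 \<xi> \<eta> x0 = \<eta>"
    by (simp_all add: sol_u_def sol_w_def sums_iff)
qed

text \<open>The partial sums satisfy integrated equations, and dominated convergence carries these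
  to the limit, with the majorant C for the sums of w and \<open>C * \<bar>Q x\<bar>\<close> for Q
  times the sums of u.\<close>

theorem sol_system:
  "primitive_on c d (sol_u Q x0 \<xi> \<eta>) (sol_w Q x0 \<xi> \<eta>)"
  "primitive_on c d (sol_w Q x0 \<xi> \<eta>) (\<lambda>s. Q s * sol_u Q x0 \<xi> \<eta> s)"
proof -
  let ?u = "sol_u Q x0 \<xi> \<eta>" and ?w = "sol_w Q x0 \<xi> \<eta>"
  define U where "U = (\<lambda>n x. \<Sum>i<n. fst (picard Q x0 \<xi> \<eta> i) x)"
  define W where "W = (\<lambda>n x. \<Sum>i<n. snd (picard Q x0 \<xi> \<eta> i) x)"
  define M where "M = max \<bar>\<xi>\<bar> \<bar>\<eta>\<bar>"
  have M: "\<bar>\<xi>\<bar> \<le> M" "\<bar>\<eta>\<bar> \<le> M" by (auto simp: M_def)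
  obtain B where B: "\<And>x. x \<in> {c..d} \<Longrightarrow> KK x \<le> B" using KK_bound by blast
  define C where "C = M * exp B"
  have MC: "M * exp (KK x) \<le> C" if "x \<in> {c..d}" for x
    using B[OF that] M by (auto simp: C_def intro: mult_left_mono)
  note sb = sol_bound[OF M]
  have Ulim: "(\<lambda>n. U n x) \<longlonglongrightarrow> ?u x" and Wlim: "(\<lambda>n. W n x) \<longlonglongrightarrow> ?w x"
    and Ub: "\<bar>U n x\<bar> \<le> C" and Wb: "\<bar>W n x\<bar> \<le> C" and ub: "\<bar>?u x\<bar> \<le> C" and wb: "\<bar>?w x\<bar> \<le> C" if "x \<in> {c..d}" for x n
    using sb[OF that] MC[OF that] unfolding U_def W_def sums_def by (auto intro: order_trans)
  have U_Suc: "U (Suc n) x = \<xi> + (\<Sum>i<n. fst (picard Q x0 \<xi> \<eta> (Suc i)) x)"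
    and W_Suc: "W (Suc n) x = \<eta> + (\<Sum>i<n. snd (picard Q x0 \<xi> \<eta> (Suc i)) x)" for n x
    by (simp_all only: U_def W_def sum.lessThan_Suc_shift picard.simps fst_conv snd_conv)
  \<comment> \<open>The zeroth increment is constant, and increment i + 1 of u integrates increment
    i of w. Hence n + 1 terms on one side belong to n terms on the other.\<close>
  have primU: "primitive_on c d (U (Suc n)) (W n)" for n
  proof -
    have "primitive_on c d (\<lambda>x. \<xi> + (\<Sum>i<n. fst (picard Q x0 \<xi> \<eta> (Suc i)) x)) (\<lambda>x. 0 + (\<Sum>i<n. snd (picard Q x0 \<xi> \<eta> i) x))"
      by (intro primitive_on_add primitive_on_const primitive_on_sum) (use picard_step in auto)
    then show ?thesis by (rule primitive_on_cong) (simp_all add: U_Suc W_def del: picard.simps)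
  qed
  have primW: "primitive_on c d (W (Suc n)) (\<lambda>x. Q x * U n x)" for n
  proof -
    have "primitive_on c d (\<lambda>x. \<eta> + (\<Sum>i<n. snd (picard Q x0 \<xi> \<eta> (Suc i)) x)) (\<lambda>x. 0 + (\<Sum>i<n. Q x * fst (picard Q x0 \<xi> \<eta> i) x))"
      by (intro primitive_on_add primitive_on_const primitive_on_sum) (use picard_step in auto)
    then show ?thesis by (rule primitive_on_cong) (simp_all add: W_Suc U_def sum_distrib_left del: picard.simps)
  qed
  have limit: "primitive_on c d f g"
    if prim: "\<And>n. primitive_on c d (F (Suc n)) (G n)"
      and Fl: "\<And>x. x \<in> {c..d} \<Longrightarrow> (\<lambda>n. F n x) \<longlonglongrightarrow> f x"
      and Gl: "\<And>x. x \<in> {c..d} \<Longrightarrow> (\<lambda>n. G n x) \<longlonglongrightarrow> g x"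
      and Gb: "\<And>n x. x \<in> {c..d} \<Longrightarrow> \<bar>G n x\<bar> \<le> H x" and gb: "\<And>x. x \<in> {c..d} \<Longrightarrow> \<bar>g x\<bar> \<le> H x"
      and H: "H absolutely_integrable_on {c..d}" for F G f g H
  proof -
    have hi: "(g has_integral (f y - f x)) {x..y}" if xy: "c \<le> x" "x \<le> y" "y \<le> d" for x y
    proof -
      have Hi: "H integrable_on {x..y}"
        using absolutely_integrable_on_subinterval[OF H, of x y] xy by (auto simp: absolutely_integrable_on_def)
      have Gi: "(G n has_integral (F (Suc n) y - F (Suc n) x)) {x..y}" for n
        using prim[of n] xy by (auto simp: primitive_on_def)
      have "g integrable_on {x..y}" and lim: "(\<lambda>n. integral {x..y} (G n)) \<longlonglongrightarrow> integral {x..y} g"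
        using dominated_convergence[of G "{x..y}" H g] Gi Hi Gb Gl xy by (auto simp: has_integral_iff)
      moreover have "(\<lambda>n. F (Suc n) y - F (Suc n) x) \<longlonglongrightarrow> f y - f x"
        using xy by (intro tendsto_diff LIMSEQ_Suc Fl) auto
      then have "(\<lambda>n. integral {x..y} (G n)) \<longlonglongrightarrow> f y - f x"
        by (simp only: integral_unique[OF Gi])
      ultimately show ?thesis using LIMSEQ_unique by (auto simp: has_integral_iff)
    qed
    moreover have "g absolutely_integrable_on {c..d}"
      by (rule absolutely_integrable_integrable_bound[of _ _ H])
        (use gb hi[of c d] c_le_d H in \<open>auto simp: has_integral_iff absolutely_integrable_on_def\<close>)
    ultimately show ?thesis by (auto simp: primitive_on_def)
  qed
  show "primitive_on c d ?u ?w"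
    by (rule limit[OF primU Ulim Wlim Wb wb]) (auto intro: absolutely_integrable_continuous_real)
  have QC: "\<bar>Q x * y\<bar> \<le> C * \<bar>Q x\<bar>" if "\<bar>y\<bar> \<le> C" for x y
    using mult_right_mono[OF that, of "\<bar>Q x\<bar>"] by (simp add: abs_mult mult.commute)
  show "primitive_on c d ?w (\<lambda>s. Q s * ?u s)"
  proof (rule limit[OF primW Wlim])
    show "(\<lambda>x. C * \<bar>Q x\<bar>) absolutely_integrable_on {c..d}"
      using Q_int by (intro set_integrable_mult_right set_integrable_abs) auto
  qed (use Ulim Ub ub QC in \<open>auto intro!: tendsto_intros\<close>)
qed

end

end

subsection \<open>Dependence on parameters\<close>

lemma (in ode_interval) sint_tendsto:
  assumes g: "\<And>j. g j absolutely_integrable_on {c..d}" and H: "H absolutely_integrable_on {c..d}"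
    and bd: "\<And>j s. s \<in> {c..d} \<Longrightarrow> \<bar>g j s\<bar> \<le> H s"
    and lim: "\<And>s. s \<in> {c..d} \<Longrightarrow> (\<lambda>j. g j s) \<longlonglongrightarrow> g' s"
    and g': "g' absolutely_integrable_on {c..d}" and x: "x \<in> {c..d}"
  shows "(\<lambda>j. sint x0 (g j) x) \<longlonglongrightarrow> sint x0 g' x"
proof -
  have dc: "(\<lambda>j. integral {s..t} (g j)) \<longlonglongrightarrow> integral {s..t} g'" if "c \<le> s" "t \<le> d" for s t
  proof (rule dominated_convergence(2)[where h=H])
    have sub: "{s..t} \<subseteq> {c..d}" using that by auto
    show "g j integrable_on {s..t}" for j
      using absolutely_integrable_on_subinterval[OF g sub] by (simp add: absolutely_integrable_on_def)
    show "H integrable_on {s..t}"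
      using absolutely_integrable_on_subinterval[OF H sub] by (simp add: absolutely_integrable_on_def)
  qed (use that bd lim in auto)
  have seg: "closed_segment x0 x \<subseteq> {c..d}" using x x0 by (auto simp: closed_segment_eq_real_ivl)
  have "f absolutely_integrable_on closed_segment x0 x" if "f absolutely_integrable_on {c..d}" for f :: "real \<Rightarrow> real"
    using set_integrable_subset[OF that _ seg] by (simp add: closed_segment_eq_real_ivl)
  then have eq: "sint x0 f x = (if x0 \<le> x then integral {x0..x} f else - integral {x..x0} f)"
    if "f absolutely_integrable_on {c..d}" for f
    using that by (intro sint_eq) blast
  show ?thesis
    unfolding eq[OF g] eq[OF g'] using x x0 by (auto intro!: tendsto_minus dc)
qed

lemma (in ode_interval) picard_tendsto:
  assumes Q: "\<And>j. Q j absolutely_integrable_on {c..d}" "\<And>j x. x \<in> {c..d} \<Longrightarrow> \<bar>Q j x\<bar> \<le> k x"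
    and Q': "Q' absolutely_integrable_on {c..d}" "\<And>x. x \<in> {c..d} \<Longrightarrow> \<bar>Q' x\<bar> \<le> k x"
    and Qlim: "\<And>x. x \<in> {c..d} \<Longrightarrow> (\<lambda>j. Q j x) \<longlonglongrightarrow> Q' x"
    and init: "\<xi> \<longlonglongrightarrow> \<xi>'" "\<eta> \<longlonglongrightarrow> \<eta>'" "\<And>j. \<bar>\<xi> j\<bar> \<le> M" "\<And>j. \<bar>\<eta> j\<bar> \<le> M" "\<bar>\<xi>'\<bar> \<le> M" "\<bar>\<eta>'\<bar> \<le> M"
    and x: "x \<in> {c..d}"
  shows "(\<lambda>j. fst (picard (Q j) x0 (\<xi> j) (\<eta> j) n) x) \<longlonglongrightarrow> fst (picard Q' x0 \<xi>' \<eta>' n) x \<and>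
    (\<lambda>j. snd (picard (Q j) x0 (\<xi> j) (\<eta> j) n) x) \<longlonglongrightarrow> snd (picard Q' x0 \<xi>' \<eta>' n) x"
  using x
proof (induction n arbitrary: x)
  case 0 then show ?case using init by simp
next
  case (Suc n)
  obtain B where B: "\<And>x. x \<in> {c..d} \<Longrightarrow> KK x \<le> B" using KK_bound by blast
  define C where "C = M * B ^ n / fact n"
  have M0: "0 \<le> M" using init(5) by simp
  have C: "M * KK x ^ n / fact n \<le> C" if "x \<in> {c..d}" for x
    unfolding C_def using B[OF that] M0 by (intro divide_right_mono mult_left_mono power_mono) (auto simp: KK_def)
  note step = picard_step[OF Q(1) Q(2)] and step' = picard_step[OF Q'(1) Q'(2)]
  have bd: "\<bar>fst (picard (Q j) x0 (\<xi> j) (\<eta> j) n) x\<bar> \<le> C" "\<bar>snd (picard (Q j) x0 (\<xi> j) (\<eta> j) n) x\<bar> \<le> C"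
    if "x \<in> {c..d}" for x j
    using picard_bound[OF Q(1) Q(2) init(3,4) that] C[OF that] order_trans by blast+
  have C0: "0 \<le> C" using bd(1)[of x0 0] x0 by (auto intro: order_trans[OF abs_ge_zero])
  have 1: "(\<lambda>j. sint x0 (snd (picard (Q j) x0 (\<xi> j) (\<eta> j) n)) x) \<longlonglongrightarrow> sint x0 (snd (picard Q' x0 \<xi>' \<eta>' n)) x"
    by (rule sint_tendsto[where H="\<lambda>_. C"])
      (use step step' bd Suc in \<open>auto intro!: absolutely_integrable_continuous_real\<close>)
  have 2: "(\<lambda>j. sint x0 (\<lambda>s. Q j s * fst (picard (Q j) x0 (\<xi> j) (\<eta> j) n) s) x) \<longlonglongrightarrow>
      sint x0 (\<lambda>s. Q' s * fst (picard Q' x0 \<xi>' \<eta>' n) s) x"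
  proof (rule sint_tendsto[where H="\<lambda>s. C * k s"])
    show "(\<lambda>s. C * k s) absolutely_integrable_on {c..d}"
      using k_int by (rule set_integrable_mult_right)
    show "\<bar>Q j s * fst (picard (Q j) x0 (\<xi> j) (\<eta> j) n) s\<bar> \<le> C * k s" if "s \<in> {c..d}" for j s
      unfolding abs_mult using mult_mono[OF Q(2)[OF that] bd(1)[OF that], of j j] C0
      by (simp add: mult.commute order_trans[OF abs_ge_zero Q(2)[OF that]])
  qed (use step step' Suc Q Q' Qlim in \<open>auto intro!: absolutely_integrable_dominated tendsto_mult\<close>)
  from 1 2 show ?case by simp
qed

text \<open>Each Picard increment converges, and all of them have the common summable majorant
  \<open>M * KK x ^ n / fact n\<close>; Tannery's theorem exchanges limit and sum.\<close>

lemma (in ode_interval) sol_tendsto: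
  assumes Q: "\<And>j. Q j absolutely_integrable_on {c..d}" "\<And>j x. x \<in> {c..d} \<Longrightarrow> \<bar>Q j x\<bar> \<le> k x"
    and Q': "Q' absolutely_integrable_on {c..d}" "\<And>x. x \<in> {c..d} \<Longrightarrow> \<bar>Q' x\<bar> \<le> k x"
    and Qlim: "\<And>x. x \<in> {c..d} \<Longrightarrow> (\<lambda>j. Q j x) \<longlonglongrightarrow> Q' x"
    and init: "\<xi> \<longlonglongrightarrow> \<xi>'" "\<eta> \<longlonglongrightarrow> \<eta>'" "\<And>j. \<bar>\<xi> j\<bar> \<le> M" "\<And>j. \<bar>\<eta> j\<bar> \<le> M" "\<bar>\<xi>'\<bar> \<le> M" "\<bar>\<eta>'\<bar> \<le> M"
    and x: "x \<in> {c..d}"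
  shows "(\<lambda>j. sol_u (Q j) x0 (\<xi> j) (\<eta> j) x) \<longlonglongrightarrow> sol_u Q' x0 \<xi>' \<eta>' x"
    "(\<lambda>j. sol_w (Q j) x0 (\<xi> j) (\<eta> j) x) \<longlonglongrightarrow> sol_w Q' x0 \<xi>' \<eta>' x"
proof -
  have sm: "summable (\<lambda>n. M * KK x ^ n / fact n)"
    using exp_sums[OF Q', of M x] by (rule sums_summable)
  note pb = picard_bound[OF Q(1) Q(2) init(3,4) x]
  note pt = picard_tendsto[OF assms]
  show "(\<lambda>j. sol_u (Q j) x0 (\<xi> j) (\<eta> j) x) \<longlonglongrightarrow> sol_u Q' x0 \<xi>' \<eta>' x"
    unfolding sol_u_def
    using tannerys_theorem[OF conjunct1[OF pt] _ sm] pb by (simp add: always_eventually case_prod_unfold)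
  show "(\<lambda>j. sol_w (Q j) x0 (\<xi> j) (\<eta> j) x) \<longlonglongrightarrow> sol_w Q' x0 \<xi>' \<eta>' x"
    unfolding sol_w_def
    using tannerys_theorem[OF conjunct2[OF pt] _ sm] pb by (simp add: always_eventually case_prod_unfold)
qed

text \<open>The parameter is \<open>z = (r, u(x\<^sub>0), u'(x\<^sub>0))\<close>.\<close>

definition sl_u :: "(real \<Rightarrow> real) \<Rightarrow> real \<Rightarrow> real \<times> real \<times> real \<Rightarrow> real \<Rightarrow> real" where
  "sl_u q x0 z x = sol_u (\<lambda>s. q s - fst z) x0 (fst (snd z)) (snd (snd z)) x"

definition sl_w :: "(real \<Rightarrow> real) \<Rightarrow> real \<Rightarrow> real \<times> real \<times> real \<Rightarrow> real \<Rightarrow> real" where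
  "sl_w q x0 z x = sol_w (\<lambda>s. q s - fst z) x0 (fst (snd z)) (snd (snd z)) x"

lemma absolutely_integrable_shift:
  fixes q :: "real \<Rightarrow> real"
  assumes "q absolutely_integrable_on {c..d}"
  shows "(\<lambda>s. q s - r) absolutely_integrable_on {c..d}"
  by (intro set_integral_diff assms absolutely_integrable_continuous_real continuous_intros)

text \<open>The function 1 + |q| + R dominates the coefficient 1 of u' = w and the coefficient q - r
  of the second equation for all |r| \<le> R simultaneously, so estimates are uniform in the
  eigenvalue parameter.\<close>

lemma ode_interval_shift:
  assumes q: "q absolutely_integrable_on {c..d}" and x0: "c \<le> x0" "x0 \<le> d" and R: "0 \<le> R"
  shows "ode_interval c d x0 (\<lambda>s. 1 + \<bar>q s\<bar> + R)"
proof
  have "(\<lambda>s. 1 + R + \<bar>q s\<bar>) absolutely_integrable_on {c..d}"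
    by (intro set_integral_add set_integrable_abs q absolutely_integrable_continuous_real continuous_intros)
  then show "(\<lambda>s. 1 + \<bar>q s\<bar> + R) absolutely_integrable_on {c..d}"
    by (simp add: add_ac)
qed (use x0 R in auto)

lemma sl_initial: "q absolutely_integrable_on {x0..x0} \<Longrightarrow> sl_u q x0 z x0 = fst (snd z)" "q absolutely_integrable_on {x0..x0} \<Longrightarrow> sl_w q x0 z x0 = snd (snd z)"
proof -
  assume q: "q absolutely_integrable_on {x0..x0}"
  interpret ode_interval x0 x0 x0 "\<lambda>s. 1 + \<bar>q s\<bar> + \<bar>fst z\<bar>"
    by (rule ode_interval_shift[OF q]) auto
  have "(\<lambda>s. q s - fst z) absolutely_integrable_on {x0..x0}" by (rule absolutely_integrable_shift[OF q])
  from sol_initial[OF this] show "sl_u q x0 z x0 = fst (snd z)" "sl_w q x0 z x0 = snd (snd z)"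
    by (auto simp: sl_u_def sl_w_def)
qed

lemma sl_system:
  assumes q: "q absolutely_integrable_on {c..d}" and x0: "c \<le> x0" "x0 \<le> d"
  shows "primitive_on c d (sl_u q x0 z) (sl_w q x0 z)"
    "primitive_on c d (sl_w q x0 z) (\<lambda>s. (q s - fst z) * sl_u q x0 z s)"
proof -
  interpret ode_interval c d x0 "\<lambda>s. 1 + \<bar>q s\<bar> + \<bar>fst z\<bar>"
    by (rule ode_interval_shift[OF q x0]) auto
  have "(\<lambda>s. q s - fst z) absolutely_integrable_on {c..d}" by (rule absolutely_integrable_shift[OF q])
  from sol_system[OF this, of "fst (snd z)" "snd (snd z)"]
  show "primitive_on c d (sl_u q x0 z) (sl_w q x0 z)"
    "primitive_on c d (sl_w q x0 z) (\<lambda>s. (q s - fst z) * sl_u q x0 z s)"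
    by (auto simp: sl_u_def[abs_def] sl_w_def[abs_def])
qed

text \<open>A convergent sequence of parameters is bounded, so one dominating function serves the
  whole sequence. The uniform bound B is the one used to pass to the limit in the integrals of u
  squared.\<close>

lemma sl_tendsto:
  assumes q: "q absolutely_integrable_on {c..d}" and x0: "c \<le> x0" "x0 \<le> d" and z: "Z \<longlonglongrightarrow> z"
  obtains B where "\<And>x. x \<in> {c..d} \<Longrightarrow> (\<lambda>j. sl_u q x0 (Z j) x) \<longlonglongrightarrow> sl_u q x0 z x"
    "\<And>x. x \<in> {c..d} \<Longrightarrow> (\<lambda>j. sl_w q x0 (Z j) x) \<longlonglongrightarrow> sl_w q x0 z x"
    "\<And>x j. x \<in> {c..d} \<Longrightarrow> \<bar>sl_u q x0 (Z j) x\<bar> \<le> B"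
proof -
  have lims: "(\<lambda>j. fst (Z j)) \<longlonglongrightarrow> fst z" "(\<lambda>j. fst (snd (Z j))) \<longlonglongrightarrow> fst (snd z)" "(\<lambda>j. snd (snd (Z j))) \<longlonglongrightarrow> snd (snd z)"
    by (intro tendsto_intros z)+
  have bdd: "\<exists>R. \<forall>j. \<bar>s j\<bar> \<le> R" if "s \<longlonglongrightarrow> l" for s :: "nat \<Rightarrow> real" and l
    using convergent_imp_Bseq[OF convergentI[OF that]] by (auto simp: Bseq_def)
  obtain R1 R2 R3 where R: "\<And>j. \<bar>fst (Z j)\<bar> \<le> R1" "\<And>j. \<bar>fst (snd (Z j))\<bar> \<le> R2" "\<And>j. \<bar>snd (snd (Z j))\<bar> \<le> R3"
    using lims[THEN bdd] by blast
  define R where "R = max R1 \<bar>fst z\<bar>"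
  define M where "M = Max {R2, R3, \<bar>fst (snd z)\<bar>, \<bar>snd (snd z)\<bar>}"
  have R0: "0 \<le> R" by (simp add: R_def le_max_iff_disj)
  interpret ode_interval c d x0 "\<lambda>s. 1 + \<bar>q s\<bar> + R"
    by (rule ode_interval_shift[OF q x0 R0])
  have M: "\<bar>fst (snd (Z j))\<bar> \<le> M" "\<bar>snd (snd (Z j))\<bar> \<le> M" "\<bar>fst (snd z)\<bar> \<le> M" "\<bar>snd (snd z)\<bar> \<le> M" for j
    using R(2)[of j] R(3)[of j] by (auto simp: M_def le_max_iff_disj)
  have Qi: "(\<lambda>s. q s - r) absolutely_integrable_on {c..d}" for r by (rule absolutely_integrable_shift[OF q])
  have Qb: "\<bar>q s - fst (Z j)\<bar> \<le> 1 + \<bar>q s\<bar> + R" "\<bar>q s - fst z\<bar> \<le> 1 + \<bar>q s\<bar> + R" for s j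
    using R(1)[of j] by (auto simp: R_def)
  have Ql: "(\<lambda>j. q s - fst (Z j)) \<longlonglongrightarrow> q s - fst z" for s
    by (intro tendsto_intros lims)
  note st = sol_tendsto[where Q="\<lambda>j s. q s - fst (Z j)", OF Qi Qb(1) Qi Qb(2) Ql lims(2,3) M]
  obtain B where B: "\<And>x. x \<in> {c..d} \<Longrightarrow> KK x \<le> B" using KK_bound by blast
  have M0: "0 \<le> M" using M(3) by simp
  show ?thesis
  proof (rule that[of "M * exp B"])
    show "\<bar>sl_u q x0 (Z j) x\<bar> \<le> M * exp B" if "x \<in> {c..d}" for x j
    proof -
      have "\<bar>sl_u q x0 (Z j) x\<bar> \<le> M * exp (KK x)"
        unfolding sl_u_def by (rule sol_bound(5)[OF Qi Qb(1) M(1,2) that])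
      also have "\<dots> \<le> M * exp B" using B[OF that] M0 by (intro mult_left_mono) auto
      finally show ?thesis .
    qed
  qed (use st in \<open>auto simp: sl_u_def sl_w_def\<close>)
qed

lemma sl_continuous:
  assumes q: "q absolutely_integrable_on closed_segment x0 x"
  shows "continuous_on UNIV (\<lambda>z. sl_u q x0 z x)" "continuous_on UNIV (\<lambda>z. sl_w q x0 z x)"
proof -
  define c d where "c = min x0 x" and "d = max x0 x"
  have q': "q absolutely_integrable_on {c..d}"
    using q by (simp add: c_def d_def closed_segment_eq_real_ivl min_def max_def split: if_splits)
  have x: "c \<le> x0" "x0 \<le> d" "x \<in> {c..d}" by (auto simp: c_def d_def)
  show "continuous_on UNIV (\<lambda>z. sl_u q x0 z x)"
    by (rule continuous_on_sequentiallyI, rule sl_tendsto[OF q' x(1,2)], assumption) (use x in auto)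
  show "continuous_on UNIV (\<lambda>z. sl_w q x0 z x)"
    by (rule continuous_on_sequentiallyI, rule sl_tendsto[OF q' x(1,2)], assumption) (use x in auto)
qed

lemma sl_u_continuous_on:
  assumes q: "q absolutely_integrable_on {c..d}" and x0: "c \<le> x0" "x0 \<le> d"
  shows "continuous_on {c..d} (sl_u q x0 z)" "continuous_on {c..d} (sl_w q x0 z)"
  using sl_system[OF assms] primitive_on_continuous by blast+

lemma sl_square_integral_continuous:
  assumes q: "q absolutely_integrable_on {c..d}" and x0: "c \<le> x0" "x0 \<le> d"
  shows "continuous_on UNIV (\<lambda>z. LINT x:{c..d}|lebesgue. (sl_u q x0 z x)\<^sup>2)"
proof (rule continuous_on_sequentiallyI)
  fix Z :: "nat \<Rightarrow> real \<times> real \<times> real" and z assume "Z \<longlonglongrightarrow> z"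
  from sl_tendsto[OF q x0 this] obtain B where
    B: "\<And>x. x \<in> {c..d} \<Longrightarrow> (\<lambda>j. sl_u q x0 (Z j) x) \<longlonglongrightarrow> sl_u q x0 z x"
    "\<And>x j. x \<in> {c..d} \<Longrightarrow> \<bar>sl_u q x0 (Z j) x\<bar> \<le> B" by metis
  have int: "(\<lambda>x. (sl_u q x0 z x)\<^sup>2) absolutely_integrable_on {c..d}" for z
    by (intro absolutely_integrable_continuous_real continuous_intros sl_u_continuous_on assms)
  have "(\<lambda>j. integral {c..d} (\<lambda>x. (sl_u q x0 (Z j) x)\<^sup>2)) \<longlonglongrightarrow> integral {c..d} (\<lambda>x. (sl_u q x0 z x)\<^sup>2)"
  proof (rule dominated_convergence(2)[where h="\<lambda>_. B\<^sup>2"])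
    show "(\<lambda>x. (sl_u q x0 (Z j) x)\<^sup>2) integrable_on {c..d}" for j
      using int by (simp add: absolutely_integrable_on_def)
    show "norm ((sl_u q x0 (Z j) x)\<^sup>2) \<le> B\<^sup>2" if "x \<in> {c..d}" for j x
      using power_mono[OF B(2)[OF that, of j], of 2] by simp
  qed (auto intro!: tendsto_intros B)
  then show "(\<lambda>j. LINT x:{c..d}|lebesgue. (sl_u q x0 (Z j) x)\<^sup>2) \<longlonglongrightarrow> (LINT x:{c..d}|lebesgue. (sl_u q x0 z x)\<^sup>2)"
    by (simp only: set_lebesgue_integral_eq_integral(2)[OF int])
qed

subsection \<open>Joint measurability\<close>

lemma sigma_finite_lebesgue: "sigma_finite_measure (lebesgue :: real measure)"
proof
  show "\<exists>A::real set set. countable A \<and> A \<subseteq> sets lebesgue \<and> \<Union>A = space lebesgue \<and> (\<forall>a\<in>A. emeasure lebesgue a \<noteq> \<infinity>)"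
  proof (intro exI[of _ "range (\<lambda>n. {-real n..real n})"] conjI ballI)
    have "\<exists>n. x \<in> {-real n..real n}" for x :: real
    proof -
      obtain n where "\<bar>x\<bar> \<le> real n" using real_arch_simple by blast
      then show ?thesis by (intro exI[of _ n]) auto
    qed
    then show "\<Union>(range (\<lambda>n. {-real n..real n})) = space lebesgue" by auto
  qed auto
qed

lemma borel_measurable_lebesgue_id: "(\<lambda>x::real. x) \<in> borel_measurable lebesgue"
  by (simp add: measurable_completion)

lemma sint_measurable:
  fixes g :: "'a \<Rightarrow> real \<Rightarrow> real"
  assumes [measurable]: "(\<lambda>(\<omega>, s). g \<omega> s) \<in> borel_measurable (N \<Otimes>\<^sub>M lebesgue)"
  shows "(\<lambda>(\<omega>, x). sint x0 (g \<omega>) x) \<in> borel_measurable (N \<Otimes>\<^sub>M lebesgue)"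
proof -
  let ?P = "(N \<Otimes>\<^sub>M (lebesgue :: real measure)) \<Otimes>\<^sub>M (lebesgue :: real measure)"
  have g: "(\<lambda>p. g (fst (fst p)) (snd p)) \<in> borel_measurable ?P"
    using measurable_compose[of "\<lambda>p. (fst (fst p), snd p)" ?P "N \<Otimes>\<^sub>M lebesgue" "\<lambda>(\<omega>, s). g \<omega> s" borel]
    by simp
  have [measurable]: "(\<lambda>p. snd (fst p)) \<in> borel_measurable ?P" "(\<lambda>p. snd p) \<in> borel_measurable ?P"
  proof -
    have A: "(\<lambda>p. snd (fst p)) \<in> measurable ?P lebesgue" and B: "(\<lambda>p. snd p) \<in> measurable ?P lebesgue" by simp_all
    show "(\<lambda>p. snd (fst p)) \<in> borel_measurable ?P"
      by (rule measurable_compose[OF A borel_measurable_lebesgue_id])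
    show "(\<lambda>p. snd p) \<in> borel_measurable ?P"
      by (rule measurable_compose[OF B borel_measurable_lebesgue_id])
  qed
  have [measurable]: "(\<lambda>p. signed_ind x0 (snd (fst p)) (snd p)) \<in> borel_measurable ?P"
    unfolding signed_ind_def indicator_def greaterThanAtMost_iff by measurable
  have "(\<lambda>(z, s). signed_ind x0 (snd z) s * g (fst z) s) \<in> borel_measurable ?P"
    unfolding case_prod_unfold using g by (intro borel_measurable_times) measurable
  then have "(\<lambda>z. LINT s|lebesgue. signed_ind x0 (snd z) s * g (fst z) s) \<in> borel_measurable (N \<Otimes>\<^sub>M lebesgue)"
    by (rule sigma_finite_measure.borel_measurable_lebesgue_integral[OF sigma_finite_lebesgue])
  then show ?thesis by (simp add: sint_def case_prod_unfold)
qed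

lemma picard_measurable:
  assumes Q[measurable]: "(\<lambda>(\<omega>, s). Q \<omega> s) \<in> borel_measurable (N \<Otimes>\<^sub>M lebesgue)"
  shows "(\<lambda>(\<omega>, x). fst (picard (Q \<omega>) x0 \<xi> \<eta> n) x) \<in> borel_measurable (N \<Otimes>\<^sub>M lebesgue) \<and>
    (\<lambda>(\<omega>, x). snd (picard (Q \<omega>) x0 \<xi> \<eta> n) x) \<in> borel_measurable (N \<Otimes>\<^sub>M lebesgue)"
proof (induction n)
  case (Suc n)
  have "(\<lambda>(\<omega>, s). Q \<omega> s * fst (picard (Q \<omega>) x0 \<xi> \<eta> n) s) \<in> borel_measurable (N \<Otimes>\<^sub>M lebesgue)"
    using Q Suc by (auto simp: case_prod_unfold intro: borel_measurable_times)
  then show ?case using Suc by (auto intro: sint_measurable)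
qed (auto simp: case_prod_unfold)

text \<open>Every Picard increment is an oriented integral of a jointly measurable function, and the
  sum of a series of measurable functions is measurable.\<close>

lemma sl_measurable_pair:
  assumes q[measurable]: "(\<lambda>(\<omega>, s). q \<omega> s) \<in> borel_measurable (N \<Otimes>\<^sub>M lebesgue)"
  shows "(\<lambda>(\<omega>, x). sl_u (q \<omega>) x0 z x) \<in> borel_measurable (N \<Otimes>\<^sub>M lebesgue)"
    "(\<lambda>(\<omega>, x). sl_w (q \<omega>) x0 z x) \<in> borel_measurable (N \<Otimes>\<^sub>M lebesgue)"
proof -
  have "(\<lambda>(\<omega>, s). q \<omega> s - fst z) \<in> borel_measurable (N \<Otimes>\<^sub>M lebesgue)"
    using q by (simp add: case_prod_unfold)
  note pm = picard_measurable[OF this]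
  show "(\<lambda>(\<omega>, x). sl_u (q \<omega>) x0 z x) \<in> borel_measurable (N \<Otimes>\<^sub>M lebesgue)"
    "(\<lambda>(\<omega>, x). sl_w (q \<omega>) x0 z x) \<in> borel_measurable (N \<Otimes>\<^sub>M lebesgue)"
    unfolding sl_u_def sl_w_def sol_u_def sol_w_def case_prod_unfold
    using pm by (auto simp: case_prod_unfold intro!: borel_measurable_suminf)
qed

lemma sl_measurable:
  assumes q: "(\<lambda>(\<omega>, s). q \<omega> s) \<in> borel_measurable (N \<Otimes>\<^sub>M lebesgue)"
  shows "(\<lambda>\<omega>. sl_u (q \<omega>) x0 z x) \<in> borel_measurable N"
    "(\<lambda>\<omega>. sl_w (q \<omega>) x0 z x) \<in> borel_measurable N"
    "(\<lambda>\<omega>. LINT x:{c..d}|lebesgue. (sl_u (q \<omega>) x0 z x)\<^sup>2) \<in> borel_measurable N"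
proof -
  note m = sl_measurable_pair[OF q]
  have p: "(\<lambda>\<omega>. (\<omega>, x)) \<in> measurable N (N \<Otimes>\<^sub>M lebesgue)" by simp
  show "(\<lambda>\<omega>. sl_u (q \<omega>) x0 z x) \<in> borel_measurable N"
    "(\<lambda>\<omega>. sl_w (q \<omega>) x0 z x) \<in> borel_measurable N"
    using measurable_compose[OF p m(1)] measurable_compose[OF p m(2)] by simp_all
  have ind: "indicator {c..d} \<in> borel_measurable (lebesgue :: real measure)"
    by (rule borel_measurable_indicator) simp
  have "(\<lambda>p. indicator {c..d} (snd p) * (sl_u (q (fst p)) x0 z (snd p))\<^sup>2) \<in> borel_measurable (N \<Otimes>\<^sub>M lebesgue)"
    using m(1)[of x0 z]
    by (intro borel_measurable_times borel_measurable_power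
        measurable_compose[OF measurable_snd ind])
      (auto simp: case_prod_unfold)
  then show "(\<lambda>\<omega>. LINT x:{c..d}|lebesgue. (sl_u (q \<omega>) x0 z x)\<^sup>2) \<in> borel_measurable N"
    unfolding set_lebesgue_integral_def
    by (intro sigma_finite_measure.borel_measurable_lebesgue_integral[OF sigma_finite_lebesgue])
      (simp add: case_prod_unfold)
qed

section \<open>Real solutions and eigenvalues\<close>

text \<open>The equation u'' = Q u as a system, integrated over compact subintervals; w carries u',
  and Q is q - r for the eigenvalue parameter r.\<close>

definition is_solution :: "ereal \<Rightarrow> ereal \<Rightarrow> (real \<Rightarrow> real) \<Rightarrow> (real \<Rightarrow> real) \<Rightarrow> (real \<Rightarrow> real) \<Rightarrow> bool" where
  "is_solution a b Q u w \<longleftrightarrow> (\<forall>c d. a < ereal c \<and> c \<le> d \<and> ereal d < b \<longrightarrow>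
     primitive_on c d u w \<and> primitive_on c d w (\<lambda>s. Q s * u s))"

definition real_bc :: "real filter \<Rightarrow> real \<Rightarrow> (real \<Rightarrow> real) \<Rightarrow> (real \<Rightarrow> real) \<Rightarrow> bool" where
  "real_bc F \<theta> u w \<longleftrightarrow> (\<exists>y y'. (u \<longlongrightarrow> y) F \<and> (w \<longlongrightarrow> y') F \<and> y * cos \<theta> + y' * sin \<theta> = 0)"

text \<open>Square integrability of \<open>tau q u\<close> is implied by that of u through
  \<open>tau q u = r * u\<close>. Nontriviality can be stated pointwise because solutions are
  continuous.\<close>

definition real_eigenfunction ::
    "ereal \<Rightarrow> ereal \<Rightarrow> real \<Rightarrow> real \<Rightarrow> (real \<Rightarrow> real) \<Rightarrow> real \<Rightarrow> (real \<Rightarrow> real) \<Rightarrow> (real \<Rightarrow> real) \<Rightarrow> bool" where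
  "real_eigenfunction a b \<alpha> \<beta> q r u w \<longleftrightarrow>
     is_solution a b (\<lambda>s. q s - r) u w \<and> (\<exists>x\<in>einterval a b. u x \<noteq> 0) \<and>
     set_integrable lebesgue (einterval a b) (\<lambda>x. (u x)\<^sup>2) \<and>
     (regular_left a b q \<longrightarrow> real_bc (at_right (real_of_ereal a)) \<alpha> u w) \<and>
     (regular_right a b q \<longrightarrow> real_bc (at_left (real_of_ereal b)) \<beta> u w)"

section \<open>Solutions in the integrated sense\<close>

lemma Icc_subset_einterval:
  assumes "a < ereal c" "ereal d < b"
  shows "{c..d} \<subseteq> einterval a b"
proof
  fix x assume "x \<in> {c..d}"
  then have "ereal c \<le> ereal x" "ereal x \<le> ereal d" by auto
  then show "x \<in> einterval a b" using assms unfolding einterval_iff using less_le_trans le_less_trans by blast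
qed

lemma continuous_on_einterval:
  fixes f :: "real \<Rightarrow> 'a::topological_space"
  assumes "\<And>c d. a < ereal c \<Longrightarrow> c \<le> d \<Longrightarrow> ereal d < b \<Longrightarrow> continuous_on {c..d} f"
  shows "continuous_on (einterval a b) f"
proof (rule continuous_at_imp_continuous_on, rule ballI)
  fix x assume x: "x \<in> einterval a b"
  then obtain e where e: "e > 0" "cball x e \<subseteq> einterval a b"
    using open_contains_cball[of "einterval a b"] by auto
  have "{x - e..x + e} \<subseteq> einterval a b" using e by (simp add: cball_eq_atLeastAtMost)
  then have "continuous_on {x - e..x + e} f"
    using e(1) by (intro assms) (auto simp: einterval_iff subset_iff)
  moreover have "x \<in> interior {x - e..x + e}" using e(1) by simp
  ultimately show "isCont f x" by (rule continuous_on_interior)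
qed

lemma set_borel_measurable_lebesgue_continuous:
  fixes f :: "real \<Rightarrow> 'a::real_normed_vector"
  assumes "continuous_on (einterval a b) f"
  shows "set_borel_measurable lebesgue (einterval a b) f"
  unfolding set_borel_measurable_def
  by (intro measurable_completion)
     (use borel_measurable_continuous_on_indicator[OF borel_einterval assms] in simp)

lemma primitive_on_C1:
  assumes g: "primitive_on c d g h" and h: "continuous_on {c..d} h" and x: "x \<in> {c<..<d}"
  shows "(g has_real_derivative h x) (at x)"
proof -
  have eq: "\<forall>y\<in>{c<..<d}. g c + integral {c..y} h = g y"
  proof
    fix y assume "y \<in> {c<..<d}"
    then have "(h has_integral g y - g c) {c..y}" using g by (auto simp: primitive_on_def)
    then show "g c + integral {c..y} h = g y" by (simp add: integral_unique)
  qed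
  have "((\<lambda>x. g c + integral {c..x} h) has_real_derivative 0 + h x) (at x within {c..d})"
    using x by (intro DERIV_add integral_has_real_derivative h) auto
  then have "((\<lambda>x. g c + integral {c..x} h) has_real_derivative h x) (at x)"
    using at_within_interior[of x "{c..d}"] x by simp
  then show ?thesis
    by (rule has_field_derivative_transform_within_open[where S="{c<..<d}"]) (use eq x in auto)
qed

lemma is_solution_primitive:
  assumes "is_solution a b Q u w" "a < ereal c" "c \<le> d" "ereal d < b"
  shows "primitive_on c d u w" "primitive_on c d w (\<lambda>s. Q s * u s)"
  using assms unfolding is_solution_def by blast+

lemma einterval_nbhd:
  assumes "x \<in> einterval a b"
  obtains c d where "a < ereal c" "c < x" "x < d" "ereal d < b"
proof -
  obtain c where "a < ereal c" "ereal c < ereal x" using ereal_dense2[of a "ereal x"] assms by (auto simp: einterval_iff)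
  moreover obtain d where "ereal x < ereal d" "ereal d < b" using ereal_dense2[of "ereal x" b] assms by (auto simp: einterval_iff)
  ultimately show ?thesis using that[of c d] by auto
qed

lemma is_solution_continuous:
  assumes "is_solution a b Q u w"
  shows "continuous_on (einterval a b) u" "continuous_on (einterval a b) w"
  using assms by (auto intro!: continuous_on_einterval dest: is_solution_primitive intro: primitive_on_continuous)

lemma is_solution_has_derivative:
  assumes "is_solution a b Q u w" "x \<in> einterval a b"
  shows "(u has_real_derivative w x) (at x)"
proof -
  obtain c d where cd: "a < ereal c" "c < x" "x < d" "ereal d < b" using einterval_nbhd[OF assms(2)] by blast
  from is_solution_primitive[OF assms(1) cd(1) _ cd(4)] cd show ?thesis
    by (intro primitive_on_C1[of c d]) (auto intro: primitive_on_continuous)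
qed

lemma is_solution_AE_derivative:
  assumes "is_solution a b Q u w"
  shows "AE x in lebesgue. x \<in> einterval a b \<longrightarrow> (w has_real_derivative Q x * u x) (at x)"
proof (cases "a < b")
  case True
  obtain L U :: "nat \<Rightarrow> real" where UL: "einterval a b = (\<Union>i. {L i .. U i})"
    "\<And>i. L i < U i" "\<And>i. a < ereal (L i)" "\<And>i. ereal (U i) < b"
    by (rule einterval_Icc_approximation[OF True]) (rule that; assumption)
  have "AE x in lebesgue. x \<in> {L i..U i} \<longrightarrow> (w has_real_derivative Q x * u x) (at x)" for i
  proof -
    have "primitive_on (L i) (U i) w (\<lambda>s. Q s * u s)"
      by (rule is_solution_primitive[OF assms]) (use UL(2)[of i] UL(3,4) in auto)
    from primitive_on_has_derivative[OF this] obtain N where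
      N: "negligible N" "\<And>x. x \<in> {L i<..<U i} - N \<Longrightarrow> (w has_real_derivative Q x * u x) (at x)" by blast
    have "negligible (N \<union> {L i, U i})" using N(1) by simp
    moreover have "{x. \<not> (x \<in> {L i..U i} \<longrightarrow> (w has_real_derivative Q x * u x) (at x))} \<subseteq> N \<union> {L i, U i}"
    proof
      fix x assume "x \<in> {x. \<not> (x \<in> {L i..U i} \<longrightarrow> (w has_real_derivative Q x * u x) (at x))}"
      then have "x \<in> {L i..U i}" "x \<notin> {L i<..<U i} - N" using N(2)[of x] by auto
      then show "x \<in> N \<union> {L i, U i}" by auto
    qed
    ultimately show ?thesis unfolding eventually_ae_filter_negligible by blast
  qed
  then have "AE x in lebesgue. \<forall>i. x \<in> {L i..U i} \<longrightarrow> (w has_real_derivative Q x * u x) (at x)"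
    unfolding AE_all_countable by blast
  then show ?thesis by (rule AE_mp) (auto simp: UL(1))
qed (auto simp: einterval_def)

section \<open>Passage between complex eigenfunctions and real solutions\<close>

lemma abs_continuous_on_part:
  assumes "abs_continuous_on c d \<phi>" and f: "\<And>z z'. \<bar>f z - f z'\<bar> \<le> cmod (z - z')"
  shows "real_AC c d (\<lambda>x. f (\<phi> x))"
  unfolding real_AC_iff
proof (intro allI impI)
  fix e :: real assume "e > 0"
  then obtain \<delta> where d: "\<delta> > 0" "\<And>P. finite P \<and>
        (\<forall>(x, y)\<in>P. c \<le> x \<and> x \<le> y \<and> y \<le> d) \<and>
        disjoint_family_on (\<lambda>(x, y). {x<..<y}) P \<and>
        total_length P < \<delta> \<Longrightarrow> (\<Sum>(x, y)\<in>P. cmod (\<phi> y - \<phi> x)) < e"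
    using assms(1) unfolding abs_continuous_on_def by meson
  have "(\<Sum>(x, y)\<in>P. \<bar>f (\<phi> y) - f (\<phi> x)\<bar>) < e" if P: "short_sums c d P" "total_length P < \<delta>" for P
  proof -
    have "(\<Sum>(x, y)\<in>P. \<bar>f (\<phi> y) - f (\<phi> x)\<bar>) \<le> (\<Sum>(x, y)\<in>P. cmod (\<phi> y - \<phi> x))"
      by (rule sum_mono) (use f in auto)
    also have "\<dots> < e" using P by (intro d(2)) (auto simp: short_sums_def)
    finally show ?thesis .
  qed
  then show "\<exists>\<delta>>0. \<forall>P. short_sums c d P \<and> total_length P < \<delta> \<longrightarrow>
      (\<Sum>(x, y)\<in>P. \<bar>f (\<phi> y) - f (\<phi> x)\<bar>) < e"
    using d(1) by blast
qed

lemma abs_continuous_on_Re_Im: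
  assumes "abs_continuous_on c d \<phi>"
  shows "real_AC c d (\<lambda>x. Re (\<phi> x))" "real_AC c d (\<lambda>x. Im (\<phi> x))"
  by (rule abs_continuous_on_part[OF assms], simp add: abs_Re_le_cmod abs_Im_le_cmod flip: minus_complex.simps)+

lemma abs_continuous_on_cong:
  assumes "abs_continuous_on c d \<phi>" "\<And>x. x \<in> {c..d} \<Longrightarrow> \<phi> x = \<psi> x"
  shows "abs_continuous_on c d \<psi>"
  unfolding abs_continuous_on_def
proof (intro allI impI)
  fix e :: real assume "e > 0"
  then obtain \<delta> where d: "\<delta> > 0" "\<And>P. finite P \<and>
        (\<forall>(x, y)\<in>P. c \<le> x \<and> x \<le> y \<and> y \<le> d) \<and>
        disjoint_family_on (\<lambda>(x, y). {x<..<y}) P \<and>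
        total_length P < \<delta> \<Longrightarrow> (\<Sum>(x, y)\<in>P. cmod (\<phi> y - \<phi> x)) < e"
    using assms(1) unfolding abs_continuous_on_def by meson
  have "(\<Sum>(x, y)\<in>P. cmod (\<psi> y - \<psi> x)) < e" if P: "finite P \<and>
        (\<forall>(x, y)\<in>P. c \<le> x \<and> x \<le> y \<and> y \<le> d) \<and>
        disjoint_family_on (\<lambda>(x, y). {x<..<y}) P \<and>
        total_length P < \<delta>" for P
  proof -
    have "(\<Sum>(x, y)\<in>P. cmod (\<psi> y - \<psi> x)) = (\<Sum>(x, y)\<in>P. cmod (\<phi> y - \<phi> x))"
      by (rule sum.cong) (use P assms(2) in \<open>fastforce\<close>)+
    then show ?thesis using d(2)[OF P] by simp
  qed
  then show "\<exists>\<delta>>0. \<forall>P. finite P \<and>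
        (\<forall>(x, y)\<in>P. c \<le> x \<and> x \<le> y \<and> y \<le> d) \<and>
        disjoint_family_on (\<lambda>(x, y). {x<..<y}) P \<and>
        total_length P < \<delta> \<longrightarrow> (\<Sum>(x, y)\<in>P. cmod (\<psi> y - \<psi> x)) < e"
    using d(1) by blast
qed

text \<open>\<open>D1 \<phi>\<close> is absolutely continuous, so its real and imaginary parts have
  densities. These are its derivatives almost everywhere, and the equation, having real
  coefficients, identifies them with q - r times the parts of \<phi>.\<close>

lemma AC2_is_solution:
  assumes \<phi>: "\<phi> \<in> AC2 a b" and eq: "ae_eq_on (einterval a b) (tau q \<phi>) (\<lambda>x. complex_of_real r * \<phi> x)"
  shows "is_solution a b (\<lambda>s. q s - r) (\<lambda>x. Re (\<phi> x)) (\<lambda>x. Re (D1 \<phi> x))"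
    "is_solution a b (\<lambda>s. q s - r) (\<lambda>x. Im (\<phi> x)) (\<lambda>x. Im (D1 \<phi> x))"
proof -
  have *: "primitive_on c d (\<lambda>x. Re (\<phi> x)) (\<lambda>x. Re (D1 \<phi> x)) \<and> primitive_on c d (\<lambda>x. Im (\<phi> x)) (\<lambda>x. Im (D1 \<phi> x)) \<and>
     primitive_on c d (\<lambda>x. Re (D1 \<phi> x)) (\<lambda>x. (q x - r) * Re (\<phi> x)) \<and>
     primitive_on c d (\<lambda>x. Im (D1 \<phi> x)) (\<lambda>x. (q x - r) * Im (\<phi> x))"
    if cd: "a < ereal c" "c \<le> d" "ereal d < b" for c d
  proof -
    have S: "x \<in> einterval a b" if "x \<in> {c<..<d}" for x
      using Icc_subset_einterval[OF cd(1,3)] that by auto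
    have AC: "abs_continuous_on c d \<phi>" "abs_continuous_on c d (D1 \<phi>)"
      using \<phi> cd by (auto simp: AC2_def locally_AC_def)
    note AC' = abs_continuous_on_Re_Im[OF AC(1)] abs_continuous_on_Re_Im[OF AC(2)]
    have D: "(\<phi> has_vector_derivative D1 \<phi> x) (at x)" if "x \<in> {c<..<d}" for x
      unfolding D1_def using \<phi> S[OF that] by (simp add: AC2_def vector_derivative_works[symmetric])
    have 1: "primitive_on c d (\<lambda>x. Re (\<phi> x)) (\<lambda>x. Re (D1 \<phi> x))"
      by (rule real_AC_has_integral[OF cd(2) AC'(1) negligible_empty])
        (use D in \<open>auto simp: has_vector_derivative_complex_iff has_real_derivative_iff_has_vector_derivative\<close>)
    have 2: "primitive_on c d (\<lambda>x. Im (\<phi> x)) (\<lambda>x. Im (D1 \<phi> x))"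
      by (rule real_AC_has_integral[OF cd(2) AC'(2) negligible_empty])
        (use D in \<open>auto simp: has_vector_derivative_complex_iff has_real_derivative_iff_has_vector_derivative\<close>)
    obtain h1 h2 where h: "primitive_on c d (\<lambda>x. Re (D1 \<phi> x)) h1" "primitive_on c d (\<lambda>x. Im (D1 \<phi> x)) h2"
      using real_AC_imp_primitive[OF cd(2) AC'(3)] real_AC_imp_primitive[OF cd(2) AC'(4)] by metis
    obtain N1 where N1: "negligible N1" "\<And>x. x \<in> {c<..<d} - N1 \<Longrightarrow> ((\<lambda>x. Re (D1 \<phi> x)) has_real_derivative h1 x) (at x)"
      using primitive_on_has_derivative[OF h(1)] by blast
    obtain N2 where N2: "negligible N2" "\<And>x. x \<in> {c<..<d} - N2 \<Longrightarrow> ((\<lambda>x. Im (D1 \<phi> x)) has_real_derivative h2 x) (at x)"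
      using primitive_on_has_derivative[OF h(2)] by blast
    obtain N3 where N3: "negligible N3" "\<And>x. x \<in> einterval a b - N3 \<Longrightarrow> tau q \<phi> x = complex_of_real r * \<phi> x"
      using eq unfolding ae_eq_on_def eventually_ae_filter_negligible by auto
    have h12: "h1 x = (q x - r) * Re (\<phi> x) \<and> h2 x = (q x - r) * Im (\<phi> x)" if x: "x \<in> {c<..<d} - (N1 \<union> N2 \<union> N3)" for x
    proof -
      have "(D1 \<phi> has_vector_derivative Complex (h1 x) (h2 x)) (at x)"
        using N1(2)[of x] N2(2)[of x] x
        by (simp add: has_vector_derivative_complex_iff has_real_derivative_iff_has_vector_derivative)
      then have "D1 (D1 \<phi>) x = Complex (h1 x) (h2 x)"
        by (simp add: D1_def[of "D1 \<phi>"] vector_derivative_at)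
      moreover have "tau q \<phi> x = complex_of_real r * \<phi> x" using N3(2) S x by blast
      ultimately show ?thesis
        by (auto simp: tau_def complex_eq_iff algebra_simps)
    qed
    have neg: "negligible (N1 \<union> N2 \<union> N3)" using N1 N2 N3 by simp
    have 3: "primitive_on c d (\<lambda>x. Re (D1 \<phi> x)) (\<lambda>x. (q x - r) * Re (\<phi> x))"
      by (rule real_AC_has_integral[OF cd(2) AC'(3) neg]) (use N1(2) h12 in force)
    have 4: "primitive_on c d (\<lambda>x. Im (D1 \<phi> x)) (\<lambda>x. (q x - r) * Im (\<phi> x))"
      by (rule real_AC_has_integral[OF cd(2) AC'(4) neg]) (use N2(2) h12 in force)
    from 1 2 3 4 show ?thesis by blast
  qed
  then show "is_solution a b (\<lambda>s. q s - r) (\<lambda>x. Re (\<phi> x)) (\<lambda>x. Re (D1 \<phi> x))"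
    "is_solution a b (\<lambda>s. q s - r) (\<lambda>x. Im (\<phi> x)) (\<lambda>x. Im (D1 \<phi> x))"
    by (auto simp: is_solution_def)
qed

lemma L2_part:
  assumes "\<phi> \<in> L2 S" "S \<in> sets lebesgue" "set_borel_measurable lebesgue S (\<lambda>x. f (\<phi> x))" and f: "\<And>z. \<bar>f z\<bar> \<le> cmod z"
  shows "set_integrable lebesgue S (\<lambda>x. (f (\<phi> x) :: real)\<^sup>2)"
proof (rule set_integrable_bound)
  show "set_integrable lebesgue S (\<lambda>x. (cmod (\<phi> x))\<^sup>2)" using assms(1) by (simp add: L2_def)
  have "(\<lambda>x. indicator S x * f (\<phi> x)) \<in> borel_measurable lebesgue"
    using assms(3) by (simp add: set_borel_measurable_def)
  then have "(\<lambda>x. (indicator S x * f (\<phi> x))\<^sup>2) \<in> borel_measurable lebesgue"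
    by (rule borel_measurable_power)
  moreover have "(\<lambda>x. (indicator S x * f (\<phi> x))\<^sup>2) = (\<lambda>x. indicator S x *\<^sub>R (f (\<phi> x))\<^sup>2)"
    by (auto simp: indicator_def)
  ultimately show "set_borel_measurable lebesgue S (\<lambda>x. (f (\<phi> x))\<^sup>2)"
    by (simp add: set_borel_measurable_def)
  show "AE x in lebesgue. x \<in> S \<longrightarrow> norm ((f (\<phi> x))\<^sup>2) \<le> norm ((cmod (\<phi> x))\<^sup>2)"
    using power_mono[OF f, of _ 2] by simp
qed

text \<open>With q, r and the angles real, the real and imaginary parts of a complex eigenfunction
  satisfy the same equation and boundary conditions, and one of them is not identically
  zero.\<close>

lemma SL_eigenvalue_imp_real:
  assumes "r \<in> SL_eigenvalues a b \<alpha> \<beta> q"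
  obtains u w where "real_eigenfunction a b \<alpha> \<beta> q r u w"
proof -
  let ?S = "einterval a b"
  obtain \<phi> where \<phi>: "\<phi> \<in> SL_domain a b \<alpha> \<beta> q" "\<not> ae_eq_on ?S \<phi> (\<lambda>x. 0)"
    "ae_eq_on ?S (tau q \<phi>) (\<lambda>x. complex_of_real r * \<phi> x)"
    using assms by (auto simp: SL_eigenvalues_def eigenvalues_def)
  have AC2: "\<phi> \<in> AC2 a b" and L2: "\<phi> \<in> L2 ?S" using \<phi>(1) by (auto simp: SL_domain_def max_domain_def)
  note sol = AC2_is_solution[OF AC2 \<phi>(3)]
  have "\<exists>x. x \<in> ?S \<and> \<phi> x \<noteq> 0"
  proof (rule ccontr)
    assume "\<nexists>x. x \<in> ?S \<and> \<phi> x \<noteq> 0"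
    then have "ae_eq_on ?S \<phi> (\<lambda>x. 0)" unfolding ae_eq_on_def by (intro always_eventually) auto
    with \<phi>(2) show False ..
  qed
  then obtain x where x: "x \<in> ?S" "\<phi> x \<noteq> 0" by blast
  have bc: "real_bc F \<theta> (\<lambda>x. Re (\<phi> x)) (\<lambda>x. Re (D1 \<phi> x)) \<and> real_bc F \<theta> (\<lambda>x. Im (\<phi> x)) (\<lambda>x. Im (D1 \<phi> x))"
    if bc: "boundary_condition F \<theta> \<phi>" for F \<theta>
  proof -
    obtain y y' where y: "(\<phi> \<longlongrightarrow> y) F" "(D1 \<phi> \<longlongrightarrow> y') F"
      "y * complex_of_real (cos \<theta>) + y' * complex_of_real (sin \<theta>) = 0"
      using bc unfolding boundary_condition_def by blast
    have "Re y * cos \<theta> + Re y' * sin \<theta> = 0" "Im y * cos \<theta> + Im y' * sin \<theta> = 0"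
      using arg_cong[OF y(3), of Re] arg_cong[OF y(3), of Im] by simp_all
    then show ?thesis unfolding real_bc_def
      using tendsto_Re[OF y(1)] tendsto_Re[OF y(2)] tendsto_Im[OF y(1)] tendsto_Im[OF y(2)] by blast
  qed
  have meas: "?S \<in> sets lebesgue" by simp
  have "Re (\<phi> x) \<noteq> 0 \<or> Im (\<phi> x) \<noteq> 0" using x(2) by (simp add: complex_eq_iff)
  then show ?thesis
  proof
    assume "Re (\<phi> x) \<noteq> 0"
    then have "real_eigenfunction a b \<alpha> \<beta> q r (\<lambda>x. Re (\<phi> x)) (\<lambda>x. Re (D1 \<phi> x))"
      unfolding real_eigenfunction_def using sol(1) x(1) bc \<phi>(1)
      by (auto simp: SL_domain_def intro!: L2_part[OF L2 meas] abs_Re_le_cmod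
           set_borel_measurable_lebesgue_continuous is_solution_continuous(1)[OF sol(1)])
    then show ?thesis by (rule that)
  next
    assume "Im (\<phi> x) \<noteq> 0"
    then have "real_eigenfunction a b \<alpha> \<beta> q r (\<lambda>x. Im (\<phi> x)) (\<lambda>x. Im (D1 \<phi> x))"
      unfolding real_eigenfunction_def using sol(2) x(1) bc \<phi>(1)
      by (auto simp: SL_domain_def intro!: L2_part[OF L2 meas] abs_Im_le_cmod
           set_borel_measurable_lebesgue_continuous is_solution_continuous(1)[OF sol(2)])
    then show ?thesis by (rule that)
  qed
qed

lemma continuous_AE_zero:
  fixes f :: "real \<Rightarrow> 'a::real_normed_vector"
  assumes "open S" "continuous_on S f" "AE x in lebesgue. x \<in> S \<longrightarrow> f x = 0" "x \<in> S"
  shows "f x = 0"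
proof (rule ccontr)
  assume nz: "f x \<noteq> 0"
  have "open (S \<inter> f -` (- {0}))" using continuous_on_open_vimage[OF assms(1)] assms(2)
    by (metis Int_commute open_Compl closed_singleton)
  moreover have "negligible (S \<inter> f -` (- {0}))"
    using assms(3) unfolding eventually_ae_filter_negligible by (auto elim!: negligible_subset)
  ultimately have "S \<inter> f -` (- {0}) = {}" using open_not_negligible by blast
  then show False using nz assms(4) by auto
qed

lemma real_imp_SL_eigenvalue:
  assumes ab: "a < b" and ef: "real_eigenfunction a b \<alpha> \<beta> q r u w"
  shows "r \<in> SL_eigenvalues a b \<alpha> \<beta> q"
proof -
  let ?S = "einterval a b" and ?\<phi> = "\<lambda>x. complex_of_real (u x)"
  have sol: "is_solution a b (\<lambda>s. q s - r) u w" and nz: "\<exists>x\<in>?S. u x \<noteq> 0"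
    and int: "set_integrable lebesgue ?S (\<lambda>x. (u x)\<^sup>2)"
    and bc: "regular_left a b q \<Longrightarrow> real_bc (at_right (real_of_ereal a)) \<alpha> u w"
      "regular_right a b q \<Longrightarrow> real_bc (at_left (real_of_ereal b)) \<beta> u w"
    using ef by (auto simp: real_eigenfunction_def)
  have vd: "(?\<phi> has_vector_derivative complex_of_real (w x)) (at x)" if "x \<in> ?S" for x
    using is_solution_has_derivative[OF sol that]
    by (simp add: has_vector_derivative_complex_iff has_real_derivative_iff_has_vector_derivative)
  have D1: "D1 ?\<phi> x = complex_of_real (w x)" if "x \<in> ?S" for x
    unfolding D1_def using vd[OF that] by (rule vector_derivative_at)
  have sub: "x \<in> ?S" if "a < ereal c" "ereal d < b" "x \<in> {c..d}" for c d x
    using Icc_subset_einterval[OF that(1,2)] that(3) by blast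
  have AC2: "?\<phi> \<in> AC2 a b"
    unfolding AC2_def mem_Collect_eq
  proof (intro conjI ballI)
    fix x assume "x \<in> ?S"
    then show "?\<phi> differentiable (at x)" using vd by (meson differentiableI_vector)
  next
    show "locally_AC a b ?\<phi>" unfolding locally_AC_def
      using is_solution_primitive[OF sol] primitive_on_imp_real_AC unfolding real_AC_def by blast
    show "locally_AC a b (D1 ?\<phi>)" unfolding locally_AC_def
    proof (intro allI impI)
      fix c d assume cd: "a < ereal c \<and> c \<le> d \<and> ereal d < b"
      then have "abs_continuous_on c d (\<lambda>x. complex_of_real (w x))"
        using is_solution_primitive[OF sol] primitive_on_imp_real_AC unfolding real_AC_def by blast
      then show "abs_continuous_on c d (D1 ?\<phi>)"
        by (rule abs_continuous_on_cong) (use cd sub D1 in auto)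
    qed
  qed
  have ae: "AE x in lebesgue. x \<in> ?S \<longrightarrow> tau q ?\<phi> x = complex_of_real r * ?\<phi> x"
    using is_solution_AE_derivative[OF sol]
  proof eventually_elim
    case (elim x)
    show ?case
    proof
      assume x: "x \<in> ?S"
      then have "((\<lambda>x. complex_of_real (w x)) has_vector_derivative complex_of_real ((q x - r) * u x)) (at x)"
        using elim by (simp add: has_vector_derivative_complex_iff has_real_derivative_iff_has_vector_derivative)
      then have "(D1 ?\<phi> has_vector_derivative complex_of_real ((q x - r) * u x)) (at x)"
        by (rule has_vector_derivative_transform_within_open[of _ _ _ ?S]) (use x D1 in auto)
      then have "D1 (D1 ?\<phi>) x = complex_of_real ((q x - r) * u x)"
        by (simp add: D1_def[of "D1 ?\<phi>"] vector_derivative_at)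
      then show "tau q ?\<phi> x = complex_of_real r * ?\<phi> x"
        by (simp add: tau_def algebra_simps)
    qed
  qed
  have cont: "continuous_on ?S u" by (rule is_solution_continuous[OF sol])
  have \<phi>_meas: "set_borel_measurable lebesgue ?S ?\<phi>"
    by (intro set_borel_measurable_lebesgue_continuous continuous_intros cont)
  have L2\<phi>: "?\<phi> \<in> L2 ?S" using \<phi>_meas int by (simp add: L2_def)
  \<comment> \<open>Only almost everywhere does \<open>tau q ?\<phi>\<close> equal r times the
    continuous function; completeness of Lebesgue measure transfers measurability.\<close>
  have L2\<tau>: "tau q ?\<phi> \<in> L2 ?S"
  proof -
    have ae1: "AE x in lebesgue. indicator ?S x *\<^sub>R (complex_of_real r * ?\<phi> x) = indicator ?S x *\<^sub>R tau q ?\<phi> x"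
      using ae by eventually_elim (auto simp: indicator_def)
    have m1: "(\<lambda>x. indicator ?S x *\<^sub>R (complex_of_real r * ?\<phi> x)) \<in> borel_measurable lebesgue"
      unfolding set_borel_measurable_def[symmetric]
      by (intro set_borel_measurable_lebesgue_continuous continuous_intros cont)
    have m2: "(\<lambda>x. indicator ?S x *\<^sub>R tau q ?\<phi> x) \<in> borel_measurable lebesgue"
      by (rule borel_measurable_AE[OF m1 ae1])
    have "integrable lebesgue (\<lambda>x. r\<^sup>2 * (indicator ?S x *\<^sub>R (u x)\<^sup>2))"
      using int unfolding set_integrable_def by (rule integrable_mult_right)
    moreover have "(\<lambda>x. r\<^sup>2 * (indicator ?S x *\<^sub>R (u x)\<^sup>2)) = (\<lambda>x. (cmod (indicator ?S x *\<^sub>R (complex_of_real r * ?\<phi> x)))\<^sup>2)"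
      by (auto simp: indicator_def norm_mult power_mult_distrib)
    ultimately have "integrable lebesgue (\<lambda>x. (cmod (indicator ?S x *\<^sub>R (complex_of_real r * ?\<phi> x)))\<^sup>2)"
      by (simp only:)
    moreover have "(\<lambda>x. (cmod (indicator ?S x *\<^sub>R tau q ?\<phi> x))\<^sup>2) \<in> borel_measurable lebesgue"
      by (rule measurable_compose[OF m2, of "\<lambda>z. (cmod z)\<^sup>2"]) measurable
    moreover have "AE x in lebesgue. (cmod (indicator ?S x *\<^sub>R (complex_of_real r * ?\<phi> x)))\<^sup>2 = (cmod (indicator ?S x *\<^sub>R tau q ?\<phi> x))\<^sup>2"
      using ae1 by (rule AE_mp) auto
    ultimately have "integrable lebesgue (\<lambda>x. (cmod (indicator ?S x *\<^sub>R tau q ?\<phi> x))\<^sup>2)"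
      by (rule integrable_cong_AE_imp)
    moreover have "(\<lambda>x. (cmod (indicator ?S x *\<^sub>R tau q ?\<phi> x))\<^sup>2) = (\<lambda>x. indicator ?S x *\<^sub>R (cmod (tau q ?\<phi> x))\<^sup>2)"
      by (auto simp: indicator_def)
    ultimately show ?thesis using m2 by (simp add: L2_def set_borel_measurable_def set_integrable_def)
  qed
  have bcc: "boundary_condition F \<theta> ?\<phi>" if rb: "real_bc F \<theta> u w" and ev: "\<forall>\<^sub>F x in F. x \<in> ?S" for F \<theta>
  proof -
    obtain y y' where y: "(u \<longlongrightarrow> y) F" "(w \<longlongrightarrow> y') F" "y * cos \<theta> + y' * sin \<theta> = 0"
      using rb unfolding real_bc_def by blast
    have "(D1 ?\<phi> \<longlongrightarrow> complex_of_real y') F"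
      by (rule Lim_transform_eventually[OF tendsto_of_real[OF y(2)]])
        (use ev D1 in \<open>auto elim: eventually_mono\<close>)
    moreover have "complex_of_real y * complex_of_real (cos \<theta>) + complex_of_real y' * complex_of_real (sin \<theta>) = 0"
      using y(3) by (metis of_real_0 of_real_add of_real_mult)
    ultimately show ?thesis unfolding boundary_condition_def using tendsto_of_real[OF y(1)] by blast
  qed
  have evl: "\<forall>\<^sub>F x in at_right (real_of_ereal a). x \<in> ?S" if rl: "regular_left a b q"
  proof -
    obtain a0 where a0: "a = ereal a0" using rl ab by (cases a) (auto simp: regular_left_def)
    obtain c where c: "ereal a0 < ereal c" "ereal c < b" using ereal_dense2[of a b] ab a0 by auto
    show ?thesis unfolding eventually_at_right_field a0
      using c by (intro exI[of _ c]) (auto simp: einterval_iff intro: less_trans[of "ereal _" "ereal c"])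
  qed
  have evr: "\<forall>\<^sub>F x in at_left (real_of_ereal b). x \<in> ?S" if rr: "regular_right a b q"
  proof -
    obtain b0 where b0: "b = ereal b0" using rr ab by (cases b) (auto simp: regular_right_def)
    obtain c where c: "a < ereal c" "ereal c < ereal b0" using ereal_dense2[of a b] ab b0 by auto
    show ?thesis unfolding eventually_at_left_field b0
      using c by (intro exI[of _ c]) (auto simp: einterval_iff intro: less_trans[of _ "ereal c" "ereal _"])
  qed
  have "?\<phi> \<in> SL_domain a b \<alpha> \<beta> q"
    using AC2 L2\<phi> L2\<tau> bc bcc evl evr by (auto simp: SL_domain_def max_domain_def)
  moreover have "\<not> ae_eq_on ?S ?\<phi> (\<lambda>x. 0)"
  proof
    assume "ae_eq_on ?S ?\<phi> (\<lambda>x. 0)"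
    then have "AE x in lebesgue. x \<in> ?S \<longrightarrow> u x = 0" by (simp add: ae_eq_on_def)
    from continuous_AE_zero[OF open_einterval cont this] nz show False by blast
  qed
  ultimately show ?thesis
    using ae unfolding SL_eigenvalues_def eigenvalues_def ae_eq_on_def mem_Collect_eq
    by (intro bexI[of _ ?\<phi>] conjI)
qed

section \<open>Wronskians at the endpoints\<close>

text \<open>Since \<open>integral\<close> is 0 for functions that are not integrable, such a bound
  expresses square integrability only for suitable functions, here continuous ones
  (\<open>set_integrable_iff_sqint\<close>). In this form it behaves well under shrinking and
  reflecting the interval.\<close>

definition sqint :: "ereal \<Rightarrow> ereal \<Rightarrow> (real \<Rightarrow> real) \<Rightarrow> bool" where
  "sqint a b u \<longleftrightarrow> (\<exists>B. \<forall>c d. a < ereal c \<and> c \<le> d \<and> ereal d < b \<longrightarrow> integral {c..d} (\<lambda>x. (u x)\<^sup>2) \<le> B)"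

lemma continuous_on_einterval_Icc:
  assumes "continuous_on (einterval a b) f" "a < ereal c" "ereal d < b"
  shows "continuous_on {c..d} f"
  by (rule continuous_on_subset[OF assms(1) Icc_subset_einterval[OF assms(2,3)]])

lemma square_integrable_Icc:
  assumes "continuous_on (einterval a b) u" "a < ereal c" "ereal d < b"
  shows "(\<lambda>x. (u x :: real)\<^sup>2) absolutely_integrable_on {c..d}" "(\<lambda>x. (u x)\<^sup>2) integrable_on {c..d}"
proof -
  show "(\<lambda>x. (u x)\<^sup>2) absolutely_integrable_on {c..d}"
    by (intro absolutely_integrable_continuous_real continuous_intros continuous_on_einterval_Icc[OF assms])
  then show "(\<lambda>x. (u x)\<^sup>2) integrable_on {c..d}" by (simp add: absolutely_integrable_on_def)
qed

lemma sqint_mono: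
  assumes "sqint a b u" "a \<le> a'" "b' \<le> b"
  shows "sqint a' b' u"
  using assms unfolding sqint_def by (meson le_less_trans less_le_trans)

lemma set_integrable_iff_sqint:
  assumes cont: "continuous_on (einterval a b) u"
  shows "set_integrable lebesgue (einterval a b) (\<lambda>x. (u x)\<^sup>2) \<longleftrightarrow> sqint a b u"
proof
  assume L: "set_integrable lebesgue (einterval a b) (\<lambda>x. (u x)\<^sup>2)"
  have "integral {c..d} (\<lambda>x. (u x)\<^sup>2) \<le> integral (einterval a b) (\<lambda>x. (u x)\<^sup>2)"
    if "a < ereal c" "c \<le> d" "ereal d < b" for c d
  proof (rule integral_subset_le)
    show "{c..d} \<subseteq> einterval a b" by (rule Icc_subset_einterval[OF that(1,3)])
    show "(\<lambda>x. (u x)\<^sup>2) integrable_on einterval a b" using L by (simp add: absolutely_integrable_on_def)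
  qed (use square_integrable_Icc[OF cont] that in auto)
  then show "sqint a b u" unfolding sqint_def by blast
next
  assume "sqint a b u"
  then obtain B where B: "\<And>c d. a < ereal c \<Longrightarrow> c \<le> d \<Longrightarrow> ereal d < b \<Longrightarrow> integral {c..d} (\<lambda>x. (u x)\<^sup>2) \<le> B"
    unfolding sqint_def by blast
  show "set_integrable lebesgue (einterval a b) (\<lambda>x. (u x)\<^sup>2)"
  proof (cases "a < b")
    case True
    obtain L U :: "nat \<Rightarrow> real" where UL: "einterval a b = (\<Union>i. {L i .. U i})"
      "incseq U" "decseq L" "\<And>i. L i < U i" "\<And>i. a < ereal (L i)" "\<And>i. ereal (U i) < b"
      by (rule einterval_Icc_approximation[OF True]) (rule that; assumption)
    define g where "g = (\<lambda>n x. if x \<in> {L n..U n} then (u x)\<^sup>2 else 0)"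
    have mono: "{L m..U m} \<subseteq> {L n..U n}" if "m \<le> n" for m n
      using UL(2,3) that by (auto simp: incseq_def decseq_def intro: order_trans)
    have sub: "{L n..U n} \<subseteq> einterval a b" for n using UL(1) by auto
    have gi: "(g n has_integral integral {L n..U n} (\<lambda>x. (u x)\<^sup>2)) (einterval a b)" for n
      unfolding g_def has_integral_restrict[OF sub]
      using square_integrable_Icc(2)[OF cont UL(5)[of n] UL(6)[of n]] by (rule integrable_integral)
    have "(\<lambda>x. (u x)\<^sup>2) integrable_on einterval a b \<and> (\<lambda>n. integral (einterval a b) (g n)) \<longlonglongrightarrow> integral (einterval a b) (\<lambda>x. (u x)\<^sup>2)"
    proof (rule monotone_convergence_increasing)
      show "g n integrable_on einterval a b" for n using gi by blast
      show "g n x \<le> g (Suc n) x" for n x using mono[of n "Suc n"] by (auto simp: g_def)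
      show "(\<lambda>n. g n x) \<longlonglongrightarrow> (u x)\<^sup>2" if "x \<in> einterval a b" for x
      proof -
        have "\<exists>i. x \<in> {L i..U i}" using that UL(1) by auto
        then obtain i where "x \<in> {L i..U i}" by blast
        then have "g n x = (u x)\<^sup>2" if "i \<le> n" for n using mono[OF that] by (auto simp: g_def)
        then show ?thesis by (intro tendsto_eventually) (auto simp: eventually_sequentially)
      qed
      have "norm (integral (einterval a b) (g n)) \<le> B" for n
      proof -
        have "0 \<le> integral {L n..U n} (\<lambda>x. (u x)\<^sup>2)"
          by (rule integral_nonneg) (use square_integrable_Icc(2)[OF cont UL(5)[of n] UL(6)[of n]] in auto)
        then show ?thesis using B[OF UL(5)[of n] _ UL(6)[of n]] UL(4)[of n] integral_unique[OF gi] by simp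
      qed
      then show "bounded (range (\<lambda>n. integral (einterval a b) (g n)))"
        unfolding bounded_iff by blast
    qed
    then show ?thesis by (intro nonnegative_absolutely_integrable_1) auto
  next
    case False
    then have "einterval a b = {}" by (auto simp: einterval_def dest: less_trans)
    then show ?thesis by (simp add: set_integrable_def)
  qed
qed

text \<open>Let the integral over some [c, d] come within e of the supremum over all compact
  subintervals. Then the integral over any interval to the right of d is below e, since otherwise
  the supremum would be exceeded.\<close>

lemma sqint_tail:
  assumes cont: "continuous_on (einterval a b) u" and sq: "sqint a b u" and ab: "a < b" and e: "0 < e"
  obtains c where "c \<in> einterval a b" "\<And>x y. c \<le> x \<Longrightarrow> x \<le> y \<Longrightarrow> ereal y < b \<Longrightarrow> integral {x..y} (\<lambda>x. (u x)\<^sup>2) < e"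
proof -
  let ?I = "\<lambda>c d. integral {c..d} (\<lambda>x. (u x)\<^sup>2)"
  define A where "A = {?I c d | c d. a < ereal c \<and> c \<le> d \<and> ereal d < b}"
  obtain z where z: "a < ereal z" "ereal z < b" using ereal_dense2[OF ab] by blast
  have ne: "A \<noteq> {}" using z unfolding A_def by blast
  have bdd: "bdd_above A" using sq unfolding sqint_def bdd_above_def A_def by blast
  have "Sup A - e < Sup A" using e by simp
  from less_cSupE[OF this ne] obtain c d where cd: "a < ereal c" "c \<le> d" "ereal d < b" "Sup A - e < ?I c d"
    unfolding A_def by blast
  show ?thesis
  proof (rule that[of d])
    show "d \<in> einterval a b" using cd by (auto simp: einterval_iff intro: less_le_trans[of a "ereal c"])
    fix x y assume xy: "d \<le> x" "x \<le> y" "ereal y < b"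
    have int: "(\<lambda>x. (u x)\<^sup>2) integrable_on {c..y}"
      by (rule square_integrable_Icc[OF cont cd(1) xy(3)])
    have i2: "(\<lambda>x. (u x)\<^sup>2) integrable_on {s..t}" if "c \<le> s" "t \<le> y" for s t
      by (rule integrable_on_subinterval[OF int]) (use that in auto)
    have "?I c d + ?I d y = ?I c y"
      by (rule Henstock_Kurzweil_Integration.integral_combine) (use cd xy int in auto)
    moreover have "?I d x + ?I x y = ?I d y"
      by (rule Henstock_Kurzweil_Integration.integral_combine) (use cd xy i2[of d y] in auto)
    moreover have "0 \<le> ?I d x" using cd xy i2[of d x] by (intro integral_nonneg) auto
    moreover have "?I c y \<le> Sup A"
    proof (rule cSup_upper[OF _ bdd])
      have "c \<le> y" using cd xy by simp
      then show "?I c y \<in> A" unfolding A_def using cd(1) xy(3) by blast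
    qed
    ultimately show "?I x y < e" using cd(4) by linarith
  qed
qed

text \<open>Lagrange's identity: in the two product rules the terms with w1 and w2 cancel.\<close>

lemma wronskian_primitive:
  assumes cd: "c \<le> d"
    and 1: "primitive_on c d u1 w1" "primitive_on c d w1 (\<lambda>s. Q1 s * u1 s)"
    and 2: "primitive_on c d u2 w2" "primitive_on c d w2 (\<lambda>s. Q2 s * u2 s)"
  shows "primitive_on c d (\<lambda>x. u1 x * w2 x - w1 x * u2 x) (\<lambda>s. (Q2 s - Q1 s) * (u1 s * u2 s))"
  by (rule primitive_on_cong[OF primitive_on_diff[OF primitive_on_mult[OF cd 1(1) 2(2)] primitive_on_mult[OF cd 1(2) 2(1)]]])
     (auto simp: algebra_simps)

text \<open>Convergence to 0 at b, written without a filter so that finite and infinite b are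
  treated alike.\<close>

definition vanishes_right :: "ereal \<Rightarrow> ereal \<Rightarrow> (real \<Rightarrow> real) \<Rightarrow> bool" where
  "vanishes_right a b W \<longleftrightarrow> (\<forall>e>0. \<exists>c\<in>einterval a b. \<forall>x. c \<le> x \<and> ereal x < b \<longrightarrow> \<bar>W x\<bar> < e)"

text \<open>The Cauchy-Schwarz argument with the integral m of the square of g replaced by 1 + m:
  the choice t = B / (1 + m) then needs no separate case for g = 0.\<close>

lemma integral_product_square_le:
  fixes f g :: "real \<Rightarrow> real"
  assumes "continuous_on {c..d} f" "continuous_on {c..d} g"
  shows "(integral {c..d} (\<lambda>x. f x * g x))\<^sup>2 \<le> integral {c..d} (\<lambda>x. (f x)\<^sup>2) * (1 + integral {c..d} (\<lambda>x. (g x)\<^sup>2))"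
proof -
  define B where "B = integral {c..d} (\<lambda>x. f x * g x)"
  define Y where "Y = integral {c..d} (\<lambda>x. (f x)\<^sup>2)"
  define m where "m = integral {c..d} (\<lambda>x. (g x)\<^sup>2)"
  have int: "(\<lambda>x. f x * g x) integrable_on {c..d}" "(\<lambda>x. (f x)\<^sup>2) integrable_on {c..d}" "(\<lambda>x. (g x)\<^sup>2) integrable_on {c..d}"
    using assms by (auto intro!: integrable_continuous_real continuous_intros)
  have m: "0 \<le> m" unfolding m_def by (rule integral_nonneg[OF int(3)]) simp
  define t where "t = B / (1 + m)"
  have "((\<lambda>x. (f x)\<^sup>2 - 2 * t * (f x * g x) + t\<^sup>2 * (g x)\<^sup>2) has_integral (Y - 2 * t * B + t\<^sup>2 * m)) {c..d}"
    unfolding Y_def B_def m_def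
    by (intro has_integral_add has_integral_diff has_integral_mult_right integrable_integral int)
  moreover have "(\<lambda>x. (f x)\<^sup>2 - 2 * t * (f x * g x) + t\<^sup>2 * (g x)\<^sup>2) = (\<lambda>x. (f x - t * g x)\<^sup>2)"
    by (auto simp: power2_eq_square algebra_simps)
  ultimately have "0 \<le> Y - 2 * t * B + t\<^sup>2 * m"
    by (auto dest!: has_integral_nonneg)
  also have "t\<^sup>2 * m \<le> t * B"
  proof -
    have "t\<^sup>2 * m \<le> t\<^sup>2 * (1 + m)" by (intro mult_left_mono) auto
    also have "\<dots> = t * B" using m by (simp add: t_def power2_eq_square)
    finally show ?thesis .
  qed
  finally have "t * B \<le> Y" by (simp add: mult.commute)
  then have "B\<^sup>2 / (1 + m) \<le> Y" by (simp add: t_def power2_eq_square)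
  then show ?thesis using m by (simp add: B_def[symmetric] Y_def[symmetric] m_def[symmetric] pos_divide_le_eq)
qed

lemma square_sum_le: "(x + y)\<^sup>2 \<le> 2 * x\<^sup>2 + 2 * (y :: real)\<^sup>2"
  using zero_le_power2[of "x - y"] by (simp add: power2_eq_square algebra_simps)

text \<open>If \<open>W = W(u\<^sub>1, u\<^sub>2)\<close> stayed away from \<open>0\<close>, every further solution
  \<open>y = (u\<^sub>1 W(y, u\<^sub>2) + u\<^sub>2 W(u\<^sub>1, y)) / W\<close> would be square integrable as well: here \<open>W(u\<^sub>1, y)\<close> is
  constant and \<open>W(y, u\<^sub>2)\<close> is controlled by \<open>\<integral> y u\<^sub>2\<close>, so \<open>\<integral> y\<^sup>2 \<le> C + \<integral> y\<^sup>2 / 2\<close> near the endpoint.\<close>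

lemma limit_point_wronskian_right:
  assumes ab: "a < b"
    and s1: "is_solution a b (\<lambda>s. q s - r1) u1 w1" and s2: "is_solution a b (\<lambda>s. q s - r2) u2 w2"
    and s3: "is_solution a b (\<lambda>s. q s - r1) y z"
    and sq: "sqint a b u1" "sqint a b u2" and nsq: "\<And>c. c \<in> einterval a b \<Longrightarrow> \<not> sqint (ereal c) b y"
  shows "vanishes_right a b (\<lambda>x. u1 x * w2 x - w1 x * u2 x)"
proof (rule ccontr)
  define W where "W x = u1 x * w2 x - w1 x * u2 x" for x
  define \<rho> where "\<rho> = r1 - r2"
  assume "\<not> ?thesis"
  then obtain e where e: "e > 0" and far: "\<And>c. c \<in> einterval a b \<Longrightarrow> \<exists>x. c \<le> x \<and> ereal x < b \<and> e \<le> \<bar>W x\<bar>"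
    unfolding vanishes_right_def W_def by (auto simp: not_less)
  note c1 = is_solution_continuous[OF s1] and c2 = is_solution_continuous[OF s2] and c3 = is_solution_continuous[OF s3]
  \<comment> \<open>Chosen so that |\<rho>| times \<epsilon> stays below \<eta> = e/2. This bounds
    the oscillation of W near b, since W has the density \<rho> u1 u2 and u1, u2 have small
    tails.\<close>
  define \<epsilon> where "\<epsilon> = e / (2 * (1 + \<bar>\<rho>\<bar>))"
  have \<epsilon>: "\<epsilon> > 0" using e by (auto simp: \<epsilon>_def)
  obtain B2 where B2: "\<And>c d. a < ereal c \<Longrightarrow> c \<le> d \<Longrightarrow> ereal d < b \<Longrightarrow> integral {c..d} (\<lambda>x. (u2 x)\<^sup>2) \<le> B2"
    using sq(2) unfolding sqint_def by blast
  define m where "m = 1 + \<bar>B2\<bar>"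
  define \<eta> where "\<eta> = e / 2"
  \<comment> \<open>Makes \<open>K3 * \<epsilon>1\<close> at most 1/2, so that the multiple of
    \<open>Y x\<close> on the right of the final estimate is absorbed by the left side.\<close>
  define \<epsilon>1 where "\<epsilon>1 = \<eta>\<^sup>2 / (8 * (1 + \<rho>\<^sup>2 * m))"
  have m: "m > 0" by (simp add: m_def)
  have \<eta>: "\<eta> > 0" using e by (simp add: \<eta>_def)
  have \<epsilon>1: "\<epsilon>1 > 0" using \<eta> m by (auto simp: \<epsilon>1_def intro!: divide_pos_pos add_pos_nonneg)
  obtain k1 where k1: "k1 \<in> einterval a b" "\<And>x y. k1 \<le> x \<Longrightarrow> x \<le> y \<Longrightarrow> ereal y < b \<Longrightarrow> integral {x..y} (\<lambda>x. (u1 x)\<^sup>2) < min \<epsilon> \<epsilon>1"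
    using sqint_tail[OF c1(1) sq(1) ab, of "min \<epsilon> \<epsilon>1"] \<epsilon> \<epsilon>1 by auto
  obtain k2 where k2: "k2 \<in> einterval a b" "\<And>x y. k2 \<le> x \<Longrightarrow> x \<le> y \<Longrightarrow> ereal y < b \<Longrightarrow> integral {x..y} (\<lambda>x. (u2 x)\<^sup>2) < \<epsilon>"
    using sqint_tail[OF c2(1) sq(2) ab \<epsilon>] by blast
  define k where "k = max k1 k2"
  have k: "k \<in> einterval a b" using k1(1) k2(1) by (auto simp: k_def max_def)
  then have ak: "a < ereal k" "ereal k < b" by (auto simp: einterval_iff)
  have ax: "a < ereal x" if "k \<le> x" for x using ak that by (auto intro: less_le_trans[of a "ereal k"])
  have prims: "primitive_on c d u1 w1" "primitive_on c d w1 (\<lambda>s. (q s - r1) * u1 s)"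
    "primitive_on c d u2 w2" "primitive_on c d w2 (\<lambda>s. (q s - r2) * u2 s)"
    "primitive_on c d y z" "primitive_on c d z (\<lambda>s. (q s - r1) * y s)"
    if "k \<le> c" "c \<le> d" "ereal d < b" for c d
    using is_solution_primitive[OF s1 ax[OF that(1)] that(2,3)] is_solution_primitive[OF s2 ax[OF that(1)] that(2,3)]
      is_solution_primitive[OF s3 ax[OF that(1)] that(2,3)] by auto
  have cont: "continuous_on {c..d} u1" "continuous_on {c..d} u2" "continuous_on {c..d} y"
    if "k \<le> c" "ereal d < b" for c d
    using continuous_on_einterval_Icc[OF c1(1) ax[OF that(1)] that(2)] continuous_on_einterval_Icc[OF c2(1) ax[OF that(1)] that(2)]
      continuous_on_einterval_Icc[OF c3(1) ax[OF that(1)] that(2)] by auto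
  have W_osc: "\<bar>W d - W c\<bar> < \<eta>" if cd: "k \<le> c" "c \<le> d" "ereal d < b" for c d
  proof -
    have "primitive_on c d W (\<lambda>s. (q s - r2 - (q s - r1)) * (u1 s * u2 s))"
      unfolding W_def using wronskian_primitive[OF cd(2) prims(1-4)[OF cd]] .
    then have hi: "((\<lambda>s. \<rho> * (u1 s * u2 s)) has_integral (W d - W c)) {c..d}"
      using cd by (auto simp: primitive_on_def \<rho>_def)
    have int: "(\<lambda>s. (u1 s)\<^sup>2) integrable_on {c..d}" "(\<lambda>s. (u2 s)\<^sup>2) integrable_on {c..d}"
      using cont[OF cd(1,3)] by (auto intro!: integrable_continuous_real continuous_intros)
    have hb: "((\<lambda>s. \<bar>\<rho>\<bar> * (((u1 s)\<^sup>2 + (u2 s)\<^sup>2) / 2)) has_integral \<bar>\<rho>\<bar> * ((integral {c..d} (\<lambda>s. (u1 s)\<^sup>2) + integral {c..d} (\<lambda>s. (u2 s)\<^sup>2)) / 2)) {c..d}"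
      by (intro has_integral_mult_right has_integral_divide has_integral_add integrable_integral int)
    have "\<bar>W d - W c\<bar> = norm (integral {c..d} (\<lambda>s. \<rho> * (u1 s * u2 s)))" using integral_unique[OF hi] by simp
    also have "\<dots> \<le> integral {c..d} (\<lambda>s. \<bar>\<rho>\<bar> * (((u1 s)\<^sup>2 + (u2 s)\<^sup>2) / 2))"
    proof (rule integral_norm_bound_integral)
      fix s
      have "\<bar>u1 s * u2 s\<bar> \<le> ((u1 s)\<^sup>2 + (u2 s)\<^sup>2) / 2"
        using zero_le_power2[of "\<bar>u1 s\<bar> - \<bar>u2 s\<bar>"] by (simp add: power2_eq_square algebra_simps abs_mult)
      then show "norm (\<rho> * (u1 s * u2 s)) \<le> \<bar>\<rho>\<bar> * (((u1 s)\<^sup>2 + (u2 s)\<^sup>2) / 2)"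
        unfolding real_norm_def abs_mult[of \<rho>] by (intro mult_left_mono) auto
    qed (use hi hb in auto)
    also have "\<dots> = \<bar>\<rho>\<bar> * ((integral {c..d} (\<lambda>s. (u1 s)\<^sup>2) + integral {c..d} (\<lambda>s. (u2 s)\<^sup>2)) / 2)" by (rule integral_unique[OF hb])
    also have "\<dots> \<le> \<bar>\<rho>\<bar> * \<epsilon>"
      using k1(2)[of c d] k2(2)[of c d] cd by (intro mult_left_mono) (auto simp: k_def)
    also have "\<dots> < (1 + \<bar>\<rho>\<bar>) * \<epsilon>" using \<epsilon> by simp
    also have "\<dots> = \<eta>"
    proof -
      have "1 + \<bar>\<rho>\<bar> \<noteq> 0" by (simp add: add_pos_nonneg order_less_imp_not_eq2)
      then show ?thesis unfolding \<epsilon>_def \<eta>_def by (metis mult.commute nonzero_mult_divide_mult_cancel_left2 times_divide_eq_right)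
    qed
    finally show ?thesis .
  qed
  \<comment> \<open>Beyond every x there is a point with |W| \<ge> e, and between x and that point W
    changes by less than e/2.\<close>
  have W_low: "\<eta> \<le> \<bar>W x\<bar>" if x: "k \<le> x" "ereal x < b" for x
  proof -
    have "x \<in> einterval a b" using ax x by (auto simp: einterval_iff)
    from far[OF this] obtain x' where x': "x \<le> x'" "ereal x' < b" "e \<le> \<bar>W x'\<bar>" by blast
    have "\<bar>W x' - W x\<bar> < \<eta>" using W_osc x x' by blast
    then show ?thesis using x'(3) unfolding \<eta>_def by arith
  qed
  \<comment> \<open>\<open>A\<close> is W(y, u2) and \<open>V\<close> is W(u1, y). The latter is
    constant because y is taken for the parameter r1 of u1.\<close>
  define A where "A x = y x * w2 x - z x * u2 x" for x
  define V where "V x = u1 x * z x - w1 x * y x" for x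
  define Y where "Y x = integral {k..x} (\<lambda>s. (y s)\<^sup>2)" for x
  have A_eq: "A x = A k + \<rho> * integral {k..x} (\<lambda>s. y s * u2 s)" if x: "k \<le> x" "ereal x < b" for x
  proof -
    have "primitive_on k x A (\<lambda>s. (q s - r2 - (q s - r1)) * (y s * u2 s))"
      unfolding A_def using wronskian_primitive[OF x(1) prims(5,6,3,4)[OF order.refl x]] .
    then have hi: "((\<lambda>s. \<rho> * (y s * u2 s)) has_integral (A x - A k)) {k..x}"
      using x by (auto simp: primitive_on_def \<rho>_def)
    have "A x - A k = integral {k..x} (\<lambda>s. \<rho> * (y s * u2 s))" by (rule integral_unique[OF hi, symmetric])
    also have "\<dots> = \<rho> * integral {k..x} (\<lambda>s. y s * u2 s)"
      by (rule Henstock_Kurzweil_Integration.integral_mult_right)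
    finally show ?thesis by simp
  qed
  have V_eq: "V x = V k" if x: "k \<le> x" "ereal x < b" for x
  proof -
    have "primitive_on k x V (\<lambda>s. (q s - r1 - (q s - r1)) * (u1 s * y s))"
      unfolding V_def using wronskian_primitive[OF x(1) prims(1,2,5,6)[OF order.refl x]] .
    then have "((\<lambda>s. 0) has_integral (V x - V k)) {k..x}" using x by (auto simp: primitive_on_def)
    then show ?thesis by (simp add: has_integral_0_eq)
  qed
  have u2k: "integral {k..x} (\<lambda>s. (u2 s)\<^sup>2) \<le> m - 1" if "k \<le> x" "ereal x < b" for x
    using B2[OF ak(1) that] by (simp add: m_def)
  have y_int: "(\<lambda>s. (y s)\<^sup>2) integrable_on {k..x}" "(\<lambda>s. (u1 s)\<^sup>2) integrable_on {k..x}" "(\<lambda>s. (u2 s)\<^sup>2) integrable_on {k..x}"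
    if "ereal x < b" for x
    using cont[OF order.refl that] by (auto intro!: integrable_continuous_real continuous_intros)
  have Y_mono: "Y s \<le> Y x" if "k \<le> s" "s \<le> x" "ereal x < b" for s x
  proof -
    have "ereal s < b" using that by (auto intro: le_less_trans[of _ "ereal x"])
    then show ?thesis unfolding Y_def using that by (intro integral_subset_le y_int) auto
  qed
  have Y0: "0 \<le> Y x" if "ereal x < b" for x unfolding Y_def by (rule integral_nonneg[OF y_int(1)[OF that]]) simp
  define K1 where "K1 = 4 / \<eta>\<^sup>2 * (A k)\<^sup>2"
  define K2 where "K2 = 2 / \<eta>\<^sup>2 * (V k)\<^sup>2"
  define K3 where "K3 = 4 / \<eta>\<^sup>2 * (\<rho>\<^sup>2 * m)"
  have K: "0 \<le> K1" "0 \<le> K2" "0 \<le> K3" using \<eta> m by (auto simp: K1_def K2_def K3_def)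
  have pointwise: "(y s)\<^sup>2 \<le> (K1 + K3 * Y x) * (u1 s)\<^sup>2 + K2 * (u2 s)\<^sup>2" if s: "k \<le> s" "s \<le> x" "ereal x < b" for s x
  proof -
    have sb: "ereal s < b" using s by (auto intro: le_less_trans[of _ "ereal x"])
    have "(integral {k..s} (\<lambda>s. y s * u2 s))\<^sup>2 \<le> Y s * (1 + integral {k..s} (\<lambda>s. (u2 s)\<^sup>2))"
      unfolding Y_def by (rule integral_product_square_le) (use cont[OF order.refl sb] in auto)
    also have "\<dots> \<le> Y x * m"
      using Y_mono[OF s] u2k[OF s(1) sb] Y0[OF s(3)] integral_nonneg[OF y_int(3)[OF sb]] by (intro mult_mono) auto
    finally have 1: "(integral {k..s} (\<lambda>s. y s * u2 s))\<^sup>2 \<le> m * Y x" by (simp add: mult.commute)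
    have "(A s)\<^sup>2 \<le> 2 * (A k)\<^sup>2 + 2 * (\<rho> * integral {k..s} (\<lambda>s. y s * u2 s))\<^sup>2"
      unfolding A_eq[OF s(1) sb] by (rule square_sum_le)
    also have "\<dots> \<le> 2 * (A k)\<^sup>2 + 2 * (\<rho>\<^sup>2 * (m * Y x))"
      unfolding power_mult_distrib using mult_left_mono[OF 1, of "\<rho>\<^sup>2"] by simp
    finally have 2: "(A s)\<^sup>2 \<le> 2 * (A k)\<^sup>2 + 2 * (\<rho>\<^sup>2 * (m * Y x))" .
    have "\<eta>\<^sup>2 * (y s)\<^sup>2 \<le> (W s)\<^sup>2 * (y s)\<^sup>2"
      using power_mono[OF W_low[OF s(1) sb], of 2] \<eta> by (intro mult_right_mono) auto
    also have "\<dots> = (u1 s * A s + u2 s * V k)\<^sup>2"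
      unfolding V_eq[OF s(1) sb, symmetric] by (simp add: W_def A_def V_def power_mult_distrib[symmetric] algebra_simps)
    also have "\<dots> \<le> 2 * (u1 s * A s)\<^sup>2 + 2 * (u2 s * V k)\<^sup>2" by (rule square_sum_le)
    also have "\<dots> \<le> 2 * ((u1 s)\<^sup>2 * (2 * (A k)\<^sup>2 + 2 * (\<rho>\<^sup>2 * (m * Y x)))) + 2 * ((u2 s)\<^sup>2 * (V k)\<^sup>2)"
      unfolding power_mult_distrib using mult_left_mono[OF 2, of "(u1 s)\<^sup>2"] by simp
    also have "\<dots> = \<eta>\<^sup>2 * ((K1 + K3 * Y x) * (u1 s)\<^sup>2 + K2 * (u2 s)\<^sup>2)"
      using \<eta> by (simp add: K1_def K2_def K3_def field_simps)
    finally show ?thesis using \<eta> by simp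
  qed
  have Y_bound: "Y x \<le> 2 * (K1 * \<epsilon>1 + K2 * m)" if x: "k \<le> x" "ereal x < b" for x
  proof -
    let ?I1 = "integral {k..x} (\<lambda>s. (u1 s)\<^sup>2)" and ?I2 = "integral {k..x} (\<lambda>s. (u2 s)\<^sup>2)"
    have hb: "((\<lambda>s. (K1 + K3 * Y x) * (u1 s)\<^sup>2 + K2 * (u2 s)\<^sup>2) has_integral (K1 + K3 * Y x) * ?I1 + K2 * ?I2) {k..x}"
      by (intro has_integral_add has_integral_mult_right integrable_integral y_int x)
    have "Y x \<le> (K1 + K3 * Y x) * ?I1 + K2 * ?I2"
      unfolding Y_def by (rule has_integral_le[OF integrable_integral[OF y_int(1)[OF x(2)]] hb[unfolded Y_def]])
        (use pointwise x in \<open>auto simp: Y_def\<close>)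
    also have "\<dots> \<le> (K1 + K3 * Y x) * \<epsilon>1 + K2 * m"
      using k1(2)[of k x] x u2k[OF x] K Y0[OF x(2)] m
      by (intro add_mono mult_left_mono) (auto simp: k_def)
    also have "K3 * Y x * \<epsilon>1 \<le> Y x / 2"
    proof -
      have aux: "4 / \<eta>\<^sup>2 * P * (\<eta>\<^sup>2 / (8 * (1 + P))) \<le> 1/2" if "0 \<le> P" for P :: real
      proof -
        have "4 / \<eta>\<^sup>2 * P * (\<eta>\<^sup>2 / (8 * (1 + P))) = P / (2 * (1 + P))"
          using \<eta> that by (simp add: divide_simps)
        also have "\<dots> \<le> 1/2" using that by (simp add: divide_le_eq)
        finally show ?thesis .
      qed
      have "K3 * \<epsilon>1 \<le> 1/2"
        unfolding K3_def \<epsilon>1_def using m by (intro aux) simp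
      then have "K3 * \<epsilon>1 * Y x \<le> 1/2 * Y x" using Y0[OF x(2)] by (intro mult_right_mono) auto
      then show ?thesis by (simp add: mult_ac)
    qed
    then have "(K1 + K3 * Y x) * \<epsilon>1 + K2 * m \<le> K1 * \<epsilon>1 + Y x / 2 + K2 * m" by (simp add: algebra_simps)
    finally show ?thesis by simp
  qed
  have "sqint (ereal k) b y"
    unfolding sqint_def
  proof (intro exI allI impI)
    fix c d assume cd: "ereal k < ereal c \<and> c \<le> d \<and> ereal d < b"
    have "integral {c..d} (\<lambda>x. (y x)\<^sup>2) \<le> Y d"
      unfolding Y_def using cd y_int(1)[of d]
      by (intro integral_subset_le) (auto intro: integrable_on_subinterval)
    also have "\<dots> \<le> 2 * (K1 * \<epsilon>1 + K2 * m)" using cd by (intro Y_bound) auto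
    finally show "integral {c..d} (\<lambda>x. (y x)\<^sup>2) \<le> 2 * (K1 * \<epsilon>1 + K2 * m)" .
  qed
  with nsq[OF k] show False ..
qed

section \<open>Reflection at 0: from the right endpoint to the left one\<close>

lemma primitive_on_reflect:
  assumes "primitive_on c d g h"
  shows "primitive_on (-d) (-c) (\<lambda>x. g (-x)) (\<lambda>x. - h (-x))"
  unfolding primitive_on_def
proof (intro conjI allI impI)
  have "h integrable_on {c..d}" "(\<lambda>x. norm (h x)) integrable_on {c..d}"
    using assms by (auto simp: primitive_on_def absolutely_integrable_on_def)
  then have "(\<lambda>x. h (-x)) absolutely_integrable_on {-d..-c}"
    unfolding absolutely_integrable_on_def
    by (simp add: Henstock_Kurzweil_Integration.integrable_reflect_real[where f=h]
        Henstock_Kurzweil_Integration.integrable_reflect_real[where f="\<lambda>x. norm (h x)", simplified])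
  then show "(\<lambda>x. - h (-x)) absolutely_integrable_on {-d..-c}"
    using set_integrable_mult_right[of "-1" lebesgue "{-d..-c}" "\<lambda>x. h (-x)"] by simp
  fix x y assume xy: "- d \<le> x \<and> x \<le> y \<and> y \<le> - c"
  then have "(h has_integral (g (-x) - g (-y))) {-y..-x}" using assms by (auto simp: primitive_on_def)
  then have "((\<lambda>x. h (-x)) has_integral (g (-x) - g (-y))) {- (- x)..- (- y)}"
    by (simp only: has_integral_reflect_real)
  from has_integral_neg[OF this] show "((\<lambda>x. - h (-x)) has_integral g (-y) - g (-x)) {x..y}"
    by simp
qed

lemma ereal_uminus_bounds: "- b < ereal c \<longleftrightarrow> ereal (- c) < b" "ereal c < - a \<longleftrightarrow> a < ereal (- c)"
  using ereal_uminus_less_reorder[of b "ereal c"] ereal_less_uminus_reorder[of "ereal c" a] by simp_all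

lemma is_solution_reflect:
  assumes "is_solution a b Q u w"
  shows "is_solution (-b) (-a) (\<lambda>s. Q (-s)) (\<lambda>s. u (-s)) (\<lambda>s. - w (-s))"
  unfolding is_solution_def
proof (intro allI impI)
  fix c d assume cd: "- b < ereal c \<and> c \<le> d \<and> ereal d < - a"
  then have "primitive_on (-d) (-c) u w" "primitive_on (-d) (-c) w (\<lambda>s. Q s * u s)"
    using is_solution_primitive[OF assms, of "-d" "-c"] by (auto simp: ereal_uminus_bounds)
  note p = primitive_on_reflect[OF this(1)] primitive_on_reflect[OF this(2)]
  show "primitive_on c d (\<lambda>s. u (-s)) (\<lambda>s. - w (-s)) \<and>
       primitive_on c d (\<lambda>s. - w (-s)) (\<lambda>s. Q (-s) * u (-s))"
    using p(1) primitive_on_cmult[OF p(2), of "-1"] by simp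
qed

lemma sqint_reflect: "sqint (-b) (-a) (\<lambda>x. u (-x)) \<longleftrightarrow> sqint a b u"
proof -
  have 1: "sqint (-b) (-a) (\<lambda>x. u (-x))" if "sqint a b u" for a b u
  proof -
    obtain B where B: "\<And>c d. a < ereal c \<Longrightarrow> c \<le> d \<Longrightarrow> ereal d < b \<Longrightarrow> integral {c..d} (\<lambda>x. (u x)\<^sup>2) \<le> B"
      using \<open>sqint a b u\<close> unfolding sqint_def by blast
    have "integral {c..d} (\<lambda>x. (u (-x))\<^sup>2) \<le> B" if "- b < ereal c" "c \<le> d" "ereal d < - a" for c d
      using B[of "-d" "-c"] that Henstock_Kurzweil_Integration.integral_reflect_real[where a="-d" and b="-c" and f="\<lambda>x. (u x)\<^sup>2"]
      by (simp add: ereal_uminus_bounds)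
    then show ?thesis unfolding sqint_def by blast
  qed
  show ?thesis using 1[of a b u] 1[of "-b" "-a" "\<lambda>x. u (-x)"] by auto
qed

definition vanishes_left :: "ereal \<Rightarrow> ereal \<Rightarrow> (real \<Rightarrow> real) \<Rightarrow> bool" where
  "vanishes_left a b W \<longleftrightarrow> (\<forall>e>0. \<exists>c\<in>einterval a b. \<forall>x. a < ereal x \<and> x \<le> c \<longrightarrow> \<bar>W x\<bar> < e)"

lemma einterval_uminus: "x \<in> einterval (-b) (-a) \<longleftrightarrow> -x \<in> einterval a b"
  by (auto simp: einterval_iff ereal_uminus_bounds)

lemma limit_point_wronskian_left:
  assumes ab: "a < b"
    and s1: "is_solution a b (\<lambda>s. q s - r1) u1 w1" and s2: "is_solution a b (\<lambda>s. q s - r2) u2 w2"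
    and s3: "is_solution a b (\<lambda>s. q s - r1) y z"
    and sq: "sqint a b u1" "sqint a b u2" and nsq: "\<And>c. c \<in> einterval a b \<Longrightarrow> \<not> sqint a (ereal c) y"
  shows "vanishes_left a b (\<lambda>x. u1 x * w2 x - w1 x * u2 x)"
proof -
  have "vanishes_right (-b) (-a) (\<lambda>x. u1 (-x) * (- w2 (-x)) - (- w1 (-x)) * u2 (-x))"
  proof (rule limit_point_wronskian_right[where q="\<lambda>s. q (-s)" and y="\<lambda>x. y (-x)"])
    show "\<not> sqint (ereal c) (-a) (\<lambda>x. y (-x))" if "c \<in> einterval (-b) (-a)" for c
      using nsq[of "-c"] that sqint_reflect[of "ereal (-c)" a y] by (simp add: einterval_uminus)
  qed (use ab is_solution_reflect[OF s1] is_solution_reflect[OF s2] is_solution_reflect[OF s3] sq in \<open>simp_all add: sqint_reflect\<close>)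
  then have vr: "\<And>e. e > 0 \<Longrightarrow> \<exists>c\<in>einterval (-b) (-a). \<forall>x. c \<le> x \<and> ereal x < -a \<longrightarrow> \<bar>u1 (-x) * (- w2 (-x)) - (- w1 (-x)) * u2 (-x)\<bar> < e"
    unfolding vanishes_right_def by blast
  show ?thesis unfolding vanishes_left_def
  proof (intro allI impI)
    fix e :: real assume "e > 0"
    from vr[OF this] obtain c where c: "c \<in> einterval (-b) (-a)"
      "\<And>x. c \<le> x \<Longrightarrow> ereal x < -a \<Longrightarrow> \<bar>u1 (-x) * (- w2 (-x)) - (- w1 (-x)) * u2 (-x)\<bar> < e" by blast
    show "\<exists>c\<in>einterval a b. \<forall>x. a < ereal x \<and> x \<le> c \<longrightarrow> \<bar>u1 x * w2 x - w1 x * u2 x\<bar> < e"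
    proof (intro bexI[of _ "-c"] allI impI)
      show "-c \<in> einterval a b" using c(1) by (simp add: einterval_uminus)
      fix x assume x: "a < ereal x \<and> x \<le> - c"
      then have "\<bar>- (u1 x * w2 x) + w1 x * u2 x\<bar> < e" using c(2)[of "-x"] by (simp add: ereal_uminus_bounds)
      then show "\<bar>u1 x * w2 x - w1 x * u2 x\<bar> < e" by (simp add: abs_minus_commute)
    qed
  qed
qed

text \<open>Both boundary vectors (y, y') are orthogonal to (cos \<theta>, sin \<theta>), hence
  linearly dependent; the limit D of the Wronskian is their determinant.\<close>

lemma real_bc_wronskian:
  assumes "real_bc F \<theta> u1 w1" "real_bc F \<theta> u2 w2"
  shows "((\<lambda>x. u1 x * w2 x - w1 x * u2 x) \<longlongrightarrow> 0) F"
proof -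
  obtain y1 y1' where 1: "(u1 \<longlongrightarrow> y1) F" "(w1 \<longlongrightarrow> y1') F" "y1 * cos \<theta> + y1' * sin \<theta> = 0"
    using assms(1) unfolding real_bc_def by blast
  obtain y2 y2' where 2: "(u2 \<longlongrightarrow> y2) F" "(w2 \<longlongrightarrow> y2') F" "y2 * cos \<theta> + y2' * sin \<theta> = 0"
    using assms(2) unfolding real_bc_def by blast
  define D where "D = y1 * y2' - y1' * y2"
  have "D * cos \<theta> = (y1 * cos \<theta> + y1' * sin \<theta>) * y2' - y1' * (y2 * cos \<theta> + y2' * sin \<theta>)"
    by (simp add: D_def algebra_simps)
  then have c: "D * cos \<theta> = 0" using 1 2 by simp
  have "D * sin \<theta> = y1 * (y2 * cos \<theta> + y2' * sin \<theta>) - (y1 * cos \<theta> + y1' * sin \<theta>) * y2"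
    by (simp add: D_def algebra_simps)
  then have s: "D * sin \<theta> = 0" using 1 2 by simp
  have "D = D * ((sin \<theta>)\<^sup>2 + (cos \<theta>)\<^sup>2)" by simp
  also have "\<dots> = (D * sin \<theta>) * sin \<theta> + (D * cos \<theta>) * cos \<theta>"
    by (simp only: power2_eq_square distrib_left mult.assoc)
  also have "\<dots> = 0" by (simp only: c s mult_zero_left add_0_left)
  finally have "D = 0" .
  moreover have "((\<lambda>x. u1 x * w2 x - w1 x * u2 x) \<longlongrightarrow> D) F"
    unfolding D_def by (intro tendsto_intros 1 2)
  ultimately show ?thesis by simp
qed

lemma vanishes_leftI:
  assumes ab: "a < b" and a: "a \<noteq> -\<infinity>" and lim: "(W \<longlongrightarrow> 0) (at_right (real_of_ereal a))"
  shows "vanishes_left a b W"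
proof -
  obtain a0 where a0: "a = ereal a0" using a ab by (cases a) auto
  show ?thesis unfolding vanishes_left_def
  proof (intro allI impI)
    fix e :: real assume "e > 0"
    then have "\<forall>\<^sub>F x in at_right a0. \<bar>W x\<bar> < e" using lim a0 by (simp add: tendsto_iff)
    then obtain k where k: "k > a0" "\<And>x. a0 < x \<Longrightarrow> x < k \<Longrightarrow> \<bar>W x\<bar> < e"
      unfolding eventually_at_right_field by blast
    obtain z where z: "ereal a0 < ereal z" "ereal z < b" using ereal_dense2[of a b] ab a0 by auto
    define c where "c = min z ((a0 + k) / 2)"
    have "ereal c \<le> ereal z" by (simp add: c_def)
    then have "ereal c < b" using z(2) by (rule le_less_trans)
    moreover have c: "a0 < c" "c < k" using z(1) k(1) by (auto simp: c_def min_def)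
    ultimately show "\<exists>c\<in>einterval a b. \<forall>x. a < ereal x \<and> x \<le> c \<longrightarrow> \<bar>W x\<bar> < e"
      using k(2) a0 by (intro bexI[of _ c]) (auto simp: einterval_iff)
  qed
qed

lemma vanishes_rightI:
  assumes ab: "a < b" and b: "b \<noteq> \<infinity>" and lim: "(W \<longlongrightarrow> 0) (at_left (real_of_ereal b))"
  shows "vanishes_right a b W"
proof -
  obtain b0 where b0: "b = ereal b0" using b ab by (cases b) auto
  show ?thesis unfolding vanishes_right_def
  proof (intro allI impI)
    fix e :: real assume "e > 0"
    then have "\<forall>\<^sub>F x in at_left b0. \<bar>W x\<bar> < e" using lim b0 by (simp add: tendsto_iff)
    then obtain k where k: "k < b0" "\<And>x. k < x \<Longrightarrow> x < b0 \<Longrightarrow> \<bar>W x\<bar> < e"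
      unfolding eventually_at_left_field by blast
    obtain z where z: "a < ereal z" "ereal z < ereal b0" using ereal_dense2[of a b] ab b0 by auto
    define c where "c = max z ((b0 + k) / 2)"
    have "ereal z \<le> ereal c" by (simp add: c_def)
    then have "a < ereal c" using z(1) by (rule less_le_trans[rotated])
    moreover have c: "c < b0" "k < c" using z(2) k(1) by (auto simp: c_def max_def)
    ultimately show "\<exists>c\<in>einterval a b. \<forall>x. c \<le> x \<and> ereal x < b \<longrightarrow> \<bar>W x\<bar> < e"
      using k(2) b0 by (intro bexI[of _ c]) (auto simp: einterval_iff)
  qed
qed

lemma not_L2_part:
  assumes sol: "is_solution a b Q (\<lambda>x. Re (u x)) w1" "is_solution a b Q (\<lambda>x. Im (u x)) w2"
    and sub: "a \<le> a'" "b' \<le> b" and nL2: "u \<notin> L2 (einterval a' b')"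
  shows "\<not> (sqint a' b' (\<lambda>x. Re (u x)) \<and> sqint a' b' (\<lambda>x. Im (u x)))"
proof
  assume sq: "sqint a' b' (\<lambda>x. Re (u x)) \<and> sqint a' b' (\<lambda>x. Im (u x))"
  have "einterval a' b' \<subseteq> einterval a b" using sub by (auto simp: einterval_iff)
  then have cont: "continuous_on (einterval a' b') (\<lambda>x. Re (u x))" "continuous_on (einterval a' b') (\<lambda>x. Im (u x))"
    using is_solution_continuous(1)[OF sol(1)] is_solution_continuous(1)[OF sol(2)] continuous_on_subset by blast+
  have "continuous_on (einterval a' b') (\<lambda>x. Complex (Re (u x)) (Im (u x)))"
    using cont by (intro continuous_on_Complex)
  then have "set_borel_measurable lebesgue (einterval a' b') u"
    by (intro set_borel_measurable_lebesgue_continuous) simp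
  moreover have "set_integrable lebesgue (einterval a' b') (\<lambda>x. (Re (u x))\<^sup>2 + (Im (u x))\<^sup>2)"
    using sq by (intro set_integral_add) (simp_all add: set_integrable_iff_sqint cont)
  then have "set_integrable lebesgue (einterval a' b') (\<lambda>x. (cmod (u x))\<^sup>2)"
    by (simp add: cmod_power2)
  ultimately show False using nL2 by (simp add: L2_def)
qed

text \<open>Near a the real or the imaginary part fails to be square integrable, but one and the
  same part must fail for every c. If the real part is square integrable on (a, c1), then the
  imaginary part fails for each c, as restriction to (a, min c1 c) shows.\<close>

lemma limit_point_left_real:
  assumes "limit_point_left a b q"
  obtains y z where "is_solution a b (\<lambda>s. q s - r) y z" "\<And>c. c \<in> einterval a b \<Longrightarrow> \<not> sqint a (ereal c) y"
proof -
  obtain u where u: "u \<in> AC2 a b" "ae_eq_on (einterval a b) (tau q u) (\<lambda>x. complex_of_real r * u x)"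
    "\<And>c. c \<in> einterval a b \<Longrightarrow> u \<notin> L2 (einterval a (ereal c))"
    using assms unfolding limit_point_left_def by blast
  note sol = AC2_is_solution[OF u(1,2)]
  show ?thesis
  proof (cases "\<forall>c\<in>einterval a b. \<not> sqint a (ereal c) (\<lambda>x. Re (u x))")
    case True then show ?thesis using that[OF sol(1)] by blast
  next
    case False
    then obtain c1 where c1: "c1 \<in> einterval a b" "sqint a (ereal c1) (\<lambda>x. Re (u x))" by blast
    have "\<not> sqint a (ereal c) (\<lambda>x. Im (u x))" if c: "c \<in> einterval a b" for c
    proof
      assume sq: "sqint a (ereal c) (\<lambda>x. Im (u x))"
      define m where "m = min c1 c"
      have m: "m \<in> einterval a b" using c1(1) c by (auto simp: m_def min_def)
      then have "\<not> (sqint a (ereal m) (\<lambda>x. Re (u x)) \<and> sqint a (ereal m) (\<lambda>x. Im (u x)))"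
        by (intro not_L2_part[OF sol _ _ u(3)]) (auto simp: einterval_iff intro: less_imp_le)
      moreover have "sqint a (ereal m) (\<lambda>x. Re (u x))" "sqint a (ereal m) (\<lambda>x. Im (u x))"
        using sqint_mono[OF c1(2)] sqint_mono[OF sq] by (auto simp: m_def)
      ultimately show False by blast
    qed
    then show ?thesis using that[OF sol(2)] by blast
  qed
qed

lemma limit_point_right_real:
  assumes "limit_point_right a b q"
  obtains y z where "is_solution a b (\<lambda>s. q s - r) y z" "\<And>c. c \<in> einterval a b \<Longrightarrow> \<not> sqint (ereal c) b y"
proof -
  obtain u where u: "u \<in> AC2 a b" "ae_eq_on (einterval a b) (tau q u) (\<lambda>x. complex_of_real r * u x)"
    "\<And>c. c \<in> einterval a b \<Longrightarrow> u \<notin> L2 (einterval (ereal c) b)"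
    using assms unfolding limit_point_right_def by blast
  note sol = AC2_is_solution[OF u(1,2)]
  show ?thesis
  proof (cases "\<forall>c\<in>einterval a b. \<not> sqint (ereal c) b (\<lambda>x. Re (u x))")
    case True then show ?thesis using that[OF sol(1)] by blast
  next
    case False
    then obtain c1 where c1: "c1 \<in> einterval a b" "sqint (ereal c1) b (\<lambda>x. Re (u x))" by blast
    have "\<not> sqint (ereal c) b (\<lambda>x. Im (u x))" if c: "c \<in> einterval a b" for c
    proof
      assume sq: "sqint (ereal c) b (\<lambda>x. Im (u x))"
      define m where "m = max c1 c"
      have m: "m \<in> einterval a b" using c1(1) c by (auto simp: m_def max_def)
      then have "\<not> (sqint (ereal m) b (\<lambda>x. Re (u x)) \<and> sqint (ereal m) b (\<lambda>x. Im (u x)))"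
        by (intro not_L2_part[OF sol _ _ u(3)]) (auto simp: einterval_iff intro: less_imp_le)
      moreover have "sqint (ereal m) b (\<lambda>x. Re (u x))" "sqint (ereal m) b (\<lambda>x. Im (u x))"
        using sqint_mono[OF c1(2)] sqint_mono[OF sq] by (auto simp: m_def)
      ultimately show False by blast
    qed
    then show ?thesis using that[OF sol(2)] by blast
  qed
qed

text \<open>Distinct r1 and r2 serve the orthogonality of eigenfunctions, equal ones the variation
  of the coupling constant. In the limit point case the solution that is not square integrable is
  taken for the parameter r1.\<close>

theorem wronskian_vanishes_left:
  assumes ab: "a < b" and "regular_left a b q \<or> limit_point_left a b q"
    and s1: "is_solution a b (\<lambda>s. q s - r1) u1 w1" and s2: "is_solution a b (\<lambda>s. q s - r2) u2 w2"
    and sq: "sqint a b u1" "sqint a b u2"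
    and bc: "regular_left a b q \<Longrightarrow> real_bc (at_right (real_of_ereal a)) \<theta> u1 w1"
      "regular_left a b q \<Longrightarrow> real_bc (at_right (real_of_ereal a)) \<theta> u2 w2"
  shows "vanishes_left a b (\<lambda>x. u1 x * w2 x - w1 x * u2 x)"
proof (cases "regular_left a b q")
  case True
  then show ?thesis
    by (intro vanishes_leftI[OF ab] real_bc_wronskian[OF bc]) (auto simp: regular_left_def)
next
  case False
  then obtain y z where "is_solution a b (\<lambda>s. q s - r1) y z" "\<And>c. c \<in> einterval a b \<Longrightarrow> \<not> sqint a (ereal c) y"
    using limit_point_left_real assms(2) by blast
  then show ?thesis using limit_point_wronskian_left[OF ab s1 s2 _ sq] by blast
qed

theorem wronskian_vanishes_right:
  assumes ab: "a < b" and "regular_right a b q \<or> limit_point_right a b q"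
    and s1: "is_solution a b (\<lambda>s. q s - r1) u1 w1" and s2: "is_solution a b (\<lambda>s. q s - r2) u2 w2"
    and sq: "sqint a b u1" "sqint a b u2"
    and bc: "regular_right a b q \<Longrightarrow> real_bc (at_left (real_of_ereal b)) \<theta> u1 w1"
      "regular_right a b q \<Longrightarrow> real_bc (at_left (real_of_ereal b)) \<theta> u2 w2"
  shows "vanishes_right a b (\<lambda>x. u1 x * w2 x - w1 x * u2 x)"
proof (cases "regular_right a b q")
  case True
  then show ?thesis
    by (intro vanishes_rightI[OF ab] real_bc_wronskian[OF bc]) (auto simp: regular_right_def)
next
  case False
  then obtain y z where "is_solution a b (\<lambda>s. q s - r1) y z" "\<And>c. c \<in> einterval a b \<Longrightarrow> \<not> sqint (ereal c) b y"
    using limit_point_right_real assms(2) by blast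
  then show ?thesis using limit_point_wronskian_right[OF ab s1 s2 _ sq] by blast
qed

section \<open>Orthogonal families are countable\<close>

lemma integrable_product_of_squares:
  fixes f g :: "'a \<Rightarrow> real"
  assumes "f \<in> borel_measurable M" "g \<in> borel_measurable M" "integrable M (\<lambda>x. (f x)\<^sup>2)" "integrable M (\<lambda>x. (g x)\<^sup>2)"
  shows "integrable M (\<lambda>x. f x * g x)"
proof (rule Bochner_Integration.integrable_bound)
  show "integrable M (\<lambda>x. (f x)\<^sup>2 + (g x)\<^sup>2)" using assms by simp
  have "\<bar>s * t\<bar> \<le> s\<^sup>2 + t\<^sup>2" for s t :: real
  proof -
    have "0 \<le> (\<bar>s\<bar> - \<bar>t\<bar>)\<^sup>2" "0 \<le> \<bar>s\<bar> * \<bar>t\<bar>"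
      by (simp_all del: zero_le_mult_iff add: mult_nonneg_nonneg)
    then show ?thesis unfolding abs_mult power2_diff power2_abs by linarith
  qed
  then show "AE x in M. norm (f x * g x) \<le> norm ((f x)\<^sup>2 + (g x)\<^sup>2)"
    by (intro always_eventually allI) (simp add: abs_of_nonneg)
qed (use assms in measurable)

text \<open>Induction over F with the residual \<open>h F\<close>: removing one more component
  lowers the squared norm by the square of its coefficient and leaves the coefficients against the
  members not yet removed unchanged.\<close>

lemma bessel_inequality:
  fixes e :: "'i \<Rightarrow> 'a \<Rightarrow> real"
  assumes e: "\<And>i. i \<in> A \<Longrightarrow> e i \<in> borel_measurable M" "\<And>i. i \<in> A \<Longrightarrow> integrable M (\<lambda>x. (e i x)\<^sup>2)"
    "\<And>i. i \<in> A \<Longrightarrow> (LINT x|M. (e i x)\<^sup>2) = 1"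
    and orth: "\<And>i j. i \<in> A \<Longrightarrow> j \<in> A \<Longrightarrow> i \<noteq> j \<Longrightarrow> (LINT x|M. e i x * e j x) = 0"
    and g: "g \<in> borel_measurable M" "integrable M (\<lambda>x. (g x)\<^sup>2)"
    and F: "finite F" "F \<subseteq> A"
  shows "(\<Sum>i\<in>F. (LINT x|M. g x * e i x)\<^sup>2) \<le> (LINT x|M. (g x)\<^sup>2)"
proof -
  define a where "a i = (LINT x|M. g x * e i x)" for i
  define h where "h F x = g x - (\<Sum>i\<in>F. a i * e i x)" for F x
  have "h F \<in> borel_measurable M \<and> integrable M (\<lambda>x. (h F x)\<^sup>2) \<and>
      (LINT x|M. (h F x)\<^sup>2) = (LINT x|M. (g x)\<^sup>2) - (\<Sum>i\<in>F. (a i)\<^sup>2) \<and>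
      (\<forall>j\<in>A - F. (LINT x|M. h F x * e j x) = a j)"
    using F
  proof (induction F rule: finite_induct)
    case empty
    then show ?case using g by (simp add: h_def[abs_def] a_def)
  next
    case (insert k F)
    then have k: "k \<in> A" "k \<notin> F" and IH: "h F \<in> borel_measurable M" "integrable M (\<lambda>x. (h F x)\<^sup>2)"
      "(LINT x|M. (h F x)\<^sup>2) = (LINT x|M. (g x)\<^sup>2) - (\<Sum>i\<in>F. (a i)\<^sup>2)"
      "\<And>j. j \<in> A - F \<Longrightarrow> (LINT x|M. h F x * e j x) = a j"
      by auto
    have h_eq: "h (insert k F) = (\<lambda>x. h F x - a k * e k x)"
      using insert(1,2) by (simp add: h_def fun_eq_iff)
    have meas: "h (insert k F) \<in> borel_measurable M"
      unfolding h_eq using IH(1) e(1)[OF k(1)] by measurable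
    have hk: "integrable M (\<lambda>x. h F x * e k x)"
      by (rule integrable_product_of_squares[OF IH(1) e(1)[OF k(1)] IH(2) e(2)[OF k(1)]])
    have sq_eq: "(\<lambda>x. (h (insert k F) x)\<^sup>2) = (\<lambda>x. (h F x)\<^sup>2 - 2 * a k * (h F x * e k x) + (a k)\<^sup>2 * (e k x)\<^sup>2)"
      by (auto simp: h_eq power2_eq_square algebra_simps)
    have int: "integrable M (\<lambda>x. (h (insert k F) x)\<^sup>2)"
      unfolding sq_eq using IH(2) hk e(2)[OF k(1)] by (intro Bochner_Integration.integrable_add Bochner_Integration.integrable_diff integrable_mult_right) auto
    have "(LINT x|M. (h (insert k F) x)\<^sup>2) = (LINT x|M. (h F x)\<^sup>2) - 2 * a k * a k + (a k)\<^sup>2 * 1"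
      unfolding sq_eq using IH(2) hk e(2,3)[OF k(1)] IH(4)[of k] k by simp
    then have val: "(LINT x|M. (h (insert k F) x)\<^sup>2) = (LINT x|M. (g x)\<^sup>2) - (\<Sum>i\<in>insert k F. (a i)\<^sup>2)"
      using insert(1,2) IH(3) by (simp add: power2_eq_square)
    have "(LINT x|M. h (insert k F) x * e j x) = a j" if j: "j \<in> A - insert k F" for j
    proof -
      have 1: "integrable M (\<lambda>x. h F x * e j x)" "integrable M (\<lambda>x. e k x * e j x)"
        by (intro integrable_product_of_squares IH(1,2) e; use j k in auto)+
      have "(LINT x|M. h (insert k F) x * e j x) = (LINT x|M. h F x * e j x - a k * (e k x * e j x))"
        by (rule Bochner_Integration.integral_cong) (auto simp: h_eq algebra_simps)
      also have "\<dots> = (LINT x|M. h F x * e j x) - a k * (LINT x|M. e k x * e j x)"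
        using 1 by simp
      also have "\<dots> = a j" using IH(4)[of j] orth[of k j] j k by auto
      finally show ?thesis .
    qed
    with meas int val show ?case by blast
  qed
  then have "(LINT x|M. (g x)\<^sup>2) - (\<Sum>i\<in>F. (a i)\<^sup>2) = (LINT x|M. (h F x)\<^sup>2)" by simp
  also have "0 \<le> \<dots>" by (rule integral_nonneg_AE) simp
  finally show ?thesis by (simp add: a_def)
qed

text \<open>For one test function and one n, Bessel's inequality leaves only finitely many indices
  whose coefficient is at least 1/(n+1) in absolute value. The countable set T, which detects every
  member, takes the place of separability of L2.\<close>

lemma orthonormal_family_countable:
  fixes e :: "'i \<Rightarrow> 'a \<Rightarrow> real"
  assumes e: "\<And>i. i \<in> A \<Longrightarrow> e i \<in> borel_measurable M" "\<And>i. i \<in> A \<Longrightarrow> integrable M (\<lambda>x. (e i x)\<^sup>2)"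
    "\<And>i. i \<in> A \<Longrightarrow> (LINT x|M. (e i x)\<^sup>2) = 1"
    and orth: "\<And>i j. i \<in> A \<Longrightarrow> j \<in> A \<Longrightarrow> i \<noteq> j \<Longrightarrow> (LINT x|M. e i x * e j x) = 0"
    and T: "countable T" "\<And>g. g \<in> T \<Longrightarrow> g \<in> borel_measurable M" "\<And>g. g \<in> T \<Longrightarrow> integrable M (\<lambda>x. (g x)\<^sup>2)"
    and test: "\<And>i. i \<in> A \<Longrightarrow> \<exists>g\<in>T. (LINT x|M. g x * e i x) \<noteq> 0"
  shows "countable A"
proof -
  define C where "C g n = {i\<in>A. 1 / real (Suc n) \<le> \<bar>LINT x|M. g x * e i x\<bar>}" for g and n :: nat
  have fin: "finite (C g n)" if g: "g \<in> T" for g n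
  proof (rule ccontr)
    assume inf: "infinite (C g n)"
    obtain N where N: "(LINT x|M. (g x)\<^sup>2) * (real (Suc n))\<^sup>2 < real N" using reals_Archimedean2 by blast
    obtain F where F: "F \<subseteq> C g n" "finite F" "card F = N" using infinite_arbitrarily_large[OF inf] by blast
    have "real N * (1 / real (Suc n))\<^sup>2 = (\<Sum>i\<in>F. (1 / real (Suc n))\<^sup>2)" using F by simp
    also have "\<dots> \<le> (\<Sum>i\<in>F. (LINT x|M. g x * e i x)\<^sup>2)"
    proof (rule sum_mono)
      fix i assume "i \<in> F"
      then have "1 / real (Suc n) \<le> \<bar>LINT x|M. g x * e i x\<bar>" using F(1) by (auto simp: C_def)
      then have "(1 / real (Suc n))\<^sup>2 \<le> \<bar>LINT x|M. g x * e i x\<bar>\<^sup>2" by (intro power_mono) auto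
      then show "(1 / real (Suc n))\<^sup>2 \<le> (LINT x|M. g x * e i x)\<^sup>2" by simp
    qed
    also have "\<dots> \<le> (LINT x|M. (g x)\<^sup>2)"
      using F(1) by (intro bessel_inequality[OF e orth T(2)[OF g] T(3)[OF g] F(2)]) (auto simp: C_def)
    finally show False using N by (simp add: power_divide divide_le_eq)
  qed
  have "A \<subseteq> (\<Union>g\<in>T. \<Union>n. C g n)"
  proof
    fix i assume i: "i \<in> A"
    then obtain g where g: "g \<in> T" "(LINT x|M. g x * e i x) \<noteq> 0" using test by blast
    then obtain n where "1 / real (Suc n) < \<bar>LINT x|M. g x * e i x\<bar>"
      using reals_Archimedean[of "\<bar>LINT x|M. g x * e i x\<bar>"] by (auto simp: divide_inverse)
    then show "i \<in> (\<Union>g\<in>T. \<Union>n. C g n)" using g i by (auto simp: C_def intro: less_imp_le)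
  qed
  moreover have "countable (\<Union>g\<in>T. \<Union>n. C g n)"
    by (intro countable_UN countable_finite[OF fin] T(1)) auto
  ultimately show ?thesis by (rule countable_subset)
qed

lemma AE_lebesgue_Icc_pos:
  fixes \<phi> :: "real \<Rightarrow> real"
  assumes pos: "AE x in lebesgue. x \<in> {s..t} \<longrightarrow> 0 < \<phi> x" and "s < t"
    and int: "set_integrable lebesgue {s..t} \<phi>"
  shows "0 < (LINT x:{s..t}|lebesgue. \<phi> x)"
proof -
  have i: "integrable lebesgue (\<lambda>x. indicator {s..t} x *\<^sub>R \<phi> x)" using int by (simp add: set_integrable_def)
  have nn: "AE x in lebesgue. 0 \<le> indicator {s..t} x *\<^sub>R \<phi> x"
    using pos by (rule eventually_mono) (auto simp: indicator_def)
  have "0 \<le> (LINT x:{s..t}|lebesgue. \<phi> x)"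
    unfolding set_lebesgue_integral_def by (rule Bochner_Integration.integral_nonneg_AE[OF nn])
  moreover have "(LINT x:{s..t}|lebesgue. \<phi> x) \<noteq> 0"
  proof
    assume "(LINT x:{s..t}|lebesgue. \<phi> x) = 0"
    then have "AE x in lebesgue. indicator {s..t} x *\<^sub>R \<phi> x = 0"
      unfolding set_lebesgue_integral_def using integral_nonneg_eq_0_iff_AE[OF i nn] by simp
    with pos have "AE x in lebesgue. x \<notin> {s..t}"
      by eventually_elim (auto simp: indicator_def)
    then have "negligible {s..t}"
      unfolding eventually_ae_filter_negligible by (auto elim!: negligible_subset)
    then show False using \<open>s < t\<close> by (simp add: negligible_interval(1)[of s t, unfolded cbox_interval box_real])
  qed
  ultimately show ?thesis by simp
qed

text \<open>Bessel's inequality is tested against \<open>\<surd>\<rho>\<close> times the indicators of rational intervals: a continuous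
  function that is not identically zero has a nonzero coefficient against one of them.\<close>

lemma orthogonal_family_countable:
  fixes \<psi> :: "'i \<Rightarrow> real \<Rightarrow> real"
  assumes \<rho>: "set_borel_measurable lebesgue (einterval a b) \<rho>" "\<And>x. 0 \<le> \<rho> x"
    "AE x in lebesgue. x \<in> einterval a b \<longrightarrow> 0 < \<rho> x"
    "\<And>c d. a < ereal c \<Longrightarrow> c \<le> d \<Longrightarrow> ereal d < b \<Longrightarrow> set_integrable lebesgue {c..d} \<rho>"
    and \<psi>: "\<And>i. i \<in> A \<Longrightarrow> continuous_on (einterval a b) (\<psi> i)" "\<And>i. i \<in> A \<Longrightarrow> \<exists>x\<in>einterval a b. \<psi> i x \<noteq> 0"
    "\<And>i. i \<in> A \<Longrightarrow> set_integrable lebesgue (einterval a b) (\<lambda>x. \<rho> x * (\<psi> i x)\<^sup>2)"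
    and orth: "\<And>i j. i \<in> A \<Longrightarrow> j \<in> A \<Longrightarrow> i \<noteq> j \<Longrightarrow> (LINT x:einterval a b|lebesgue. \<rho> x * (\<psi> i x * \<psi> j x)) = 0"
  shows "countable A"
proof -
  let ?S = "einterval a b"
  \<comment> \<open>The square root of the weight is absorbed into the functions, which turns
    orthogonality with weight \<rho> on the interval into orthogonality in L2 of the line.\<close>
  define \<sigma> where "\<sigma> x = sqrt (indicator ?S x * \<rho> x)" for x
  have \<sigma>_meas: "\<sigma> \<in> borel_measurable lebesgue"
  proof -
    have "(\<lambda>x. indicator ?S x * \<rho> x) \<in> borel_measurable lebesgue"
      using \<rho>(1) by (simp add: set_borel_measurable_def)
    then show ?thesis unfolding \<sigma>_def by measurable
  qed
  have \<sigma>2: "\<sigma> x * \<sigma> x = indicator ?S x * \<rho> x" for x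
    using \<rho>(2)[of x] by (simp add: \<sigma>_def indicator_def)
  define F where "F i x = \<sigma> x * (indicator ?S x * \<psi> i x)" for i x
  have ind: "(indicator ?S x :: real) * indicator ?S x = indicator ?S x" for x by (auto simp: indicator_def)
  have FF: "F i x * F j x = indicator ?S x * (\<rho> x * (\<psi> i x * \<psi> j x))" for i j x
  proof -
    have "F i x * F j x = (\<sigma> x * \<sigma> x) * (indicator ?S x * indicator ?S x) * (\<psi> i x * \<psi> j x)"
      by (simp add: F_def mult_ac)
    then show ?thesis unfolding \<sigma>2 ind using ind[of x] by (auto simp: indicator_def)
  qed
  have F_meas: "F i \<in> borel_measurable lebesgue" if "i \<in> A" for i
  proof -
    have "(\<lambda>x. indicator ?S x * \<psi> i x) \<in> borel_measurable lebesgue"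
      using set_borel_measurable_lebesgue_continuous[OF \<psi>(1)[OF that]] by (simp add: set_borel_measurable_def)
    then show ?thesis unfolding F_def by (rule borel_measurable_times[OF \<sigma>_meas])
  qed
  have F2: "(F i x)\<^sup>2 = indicator ?S x * (\<rho> x * (\<psi> i x)\<^sup>2)" for i x
    using FF[of i x i] by (simp add: power2_eq_square)
  have F_int: "integrable lebesgue (\<lambda>x. (F i x)\<^sup>2)" if "i \<in> A" for i
    using \<psi>(3)[OF that] by (simp add: F2 set_integrable_def)
  define G where "G c d x = indicator {c..d} x * \<sigma> x" for c d x
  have GF: "G c d x * F i x = indicator {c..d} x * (\<rho> x * \<psi> i x)" if "{c..d} \<subseteq> ?S" for c d x i
  proof -
    have "G c d x * F i x = indicator {c..d} x * (\<sigma> x * \<sigma> x) * (indicator ?S x * \<psi> i x)"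
      by (simp add: G_def F_def mult_ac)
    then show ?thesis unfolding \<sigma>2 using that by (auto simp: indicator_def)
  qed
  define T where "T = (\<lambda>(c, d). G c d) ` {(c, d). c \<in> \<rat> \<and> d \<in> \<rat> \<and> a < ereal c \<and> c < d \<and> ereal d < b}"
  have test: "\<exists>g\<in>T. (LINT x|lebesgue. g x * F i x) \<noteq> 0" if i: "i \<in> A" for i
  proof -
    obtain x0 where x0: "x0 \<in> ?S" "\<psi> i x0 \<noteq> 0" using \<psi>(2)[OF i] by blast
    \<comment> \<open>Multiplication by the sign at x0 makes \<psi> positive on a whole rational
      interval around x0, so its weighted integral over that interval cannot vanish.\<close>
    define s where "s = sgn (\<psi> i x0)"
    have s: "s * \<psi> i x0 > 0" "s \<noteq> 0" using x0(2) by (auto simp: s_def sgn_if)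
    have "isCont (\<lambda>x. s * \<psi> i x) x0"
      using \<psi>(1)[OF i] x0(1) by (auto simp: continuous_on_eq_continuous_at intro!: continuous_intros)
    then have "\<forall>\<^sub>F x in at x0. s * \<psi> i x > 0"
      unfolding isCont_def using s(1) by (rule order_tendstoD(1))
    then have "\<forall>\<^sub>F x in nhds x0. s * \<psi> i x > 0"
      using s(1) by (simp add: eventually_nhds_conv_at)
    moreover have "\<forall>\<^sub>F x in nhds x0. x \<in> ?S" using x0(1) by (simp add: eventually_nhds_in_open)
    ultimately have "\<forall>\<^sub>F x in nhds x0. s * \<psi> i x > 0 \<and> x \<in> ?S" by eventually_elim simp
    then obtain \<delta> where \<delta>: "\<delta> > 0" "\<And>x. dist x x0 < \<delta> \<Longrightarrow> s * \<psi> i x > 0 \<and> x \<in> ?S"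
      unfolding eventually_nhds_metric by blast
    obtain c where c: "c \<in> \<rat>" "x0 - \<delta> < c" "c < x0" using Rats_dense_in_real[of "x0 - \<delta>" x0] \<delta>(1) by auto
    obtain d where d: "d \<in> \<rat>" "x0 < d" "d < x0 + \<delta>" using Rats_dense_in_real[of x0 "x0 + \<delta>"] \<delta>(1) by auto
    have in\<delta>: "s * \<psi> i x > 0 \<and> x \<in> ?S" if "x \<in> {c..d}" for x
      using that c d by (intro \<delta>(2)) (auto simp: dist_real_def)
    have cd: "a < ereal c" "ereal d < b" "c < d" using in\<delta>[of c] in\<delta>[of d] c d by (auto simp: einterval_iff)
    have sub: "{c..d} \<subseteq> ?S" by (rule Icc_subset_einterval[OF cd(1,2)])
    have cont: "continuous_on {c..d} (\<psi> i)" by (rule continuous_on_subset[OF \<psi>(1)[OF i] sub])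
    have \<rho>\<psi>: "(\<lambda>x. \<rho> x * \<psi> i x) absolutely_integrable_on {c..d}"
    proof -
      have "bounded (\<psi> i ` {c..d})" using cont by (intro compact_imp_bounded compact_continuous_image) auto
      moreover have "\<psi> i \<in> borel_measurable (lebesgue_on {c..d})"
        using cont by (intro continuous_imp_measurable_on_sets_lebesgue) auto
      moreover have "\<rho> absolutely_integrable_on {c..d}" using \<rho>(4)[OF cd(1) _ cd(2)] cd(3) by simp
      ultimately show ?thesis
        using absolutely_integrable_bounded_measurable_product_real[of "\<psi> i" "{c..d}" \<rho>] by (simp add: mult.commute)
    qed
    have "0 < (LINT x:{c..d}|lebesgue. s * (\<rho> x * \<psi> i x))"
    proof (rule AE_lebesgue_Icc_pos[OF _ cd(3)])
      show "AE x in lebesgue. x \<in> {c..d} \<longrightarrow> 0 < s * (\<rho> x * \<psi> i x)"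
        using \<rho>(3)
      proof eventually_elim
        case (elim x)
        show ?case
        proof
          assume x: "x \<in> {c..d}"
          then have "0 < \<rho> x * (s * \<psi> i x)" using elim in\<delta>[OF x] mult_pos_pos[of "\<rho> x" "s * \<psi> i x"] by blast
          then show "0 < s * (\<rho> x * \<psi> i x)" by (simp add: mult_ac)
        qed
      qed
      show "set_integrable lebesgue {c..d} (\<lambda>x. s * (\<rho> x * \<psi> i x))"
        using \<rho>\<psi> by (rule set_integrable_mult_right)
    qed
    then have "(LINT x:{c..d}|lebesgue. \<rho> x * \<psi> i x) \<noteq> 0" by (auto simp: set_lebesgue_integral_def mult.left_commute[of _ s])
    then have "(LINT x|lebesgue. G c d x * F i x) \<noteq> 0"
      by (simp add: GF[OF sub] set_lebesgue_integral_def)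
    moreover have "G c d \<in> T" using c d cd by (auto simp: T_def)
    ultimately show ?thesis by blast
  qed
  define n where "n i = sqrt (LINT x|lebesgue. (F i x)\<^sup>2)" for i
  have n_pos: "n i > 0" if i: "i \<in> A" for i
  proof -
    have nn: "0 \<le> (LINT x|lebesgue. (F i x)\<^sup>2)" by simp
    have "(LINT x|lebesgue. (F i x)\<^sup>2) \<noteq> 0"
    proof
      assume "(LINT x|lebesgue. (F i x)\<^sup>2) = 0"
      then have ae: "AE x in lebesgue. (F i x)\<^sup>2 = 0"
        using integral_nonneg_eq_0_iff_AE[OF F_int[OF i]] by simp
      obtain g where g: "(LINT x|lebesgue. g x * F i x) \<noteq> 0" using test[OF i] by blast
      have "(LINT x|lebesgue. g x * F i x) = 0"
        by (rule integral_eq_zero_AE) (use ae in \<open>auto elim: eventually_mono\<close>)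
      with g show False by simp
    qed
    with nn have "0 < (LINT x|lebesgue. (F i x)\<^sup>2)" by linarith
    then show ?thesis by (simp add: n_def)
  qed
  show ?thesis
  proof (rule orthonormal_family_countable[where M=lebesgue and e="\<lambda>i x. F i x / n i" and T=T])
    fix i assume i: "i \<in> A"
    show "(\<lambda>x. F i x / n i) \<in> borel_measurable lebesgue" using F_meas[OF i] by simp
    show "integrable lebesgue (\<lambda>x. (F i x / n i)\<^sup>2)" using F_int[OF i] by (simp add: power_divide)
    show "(LINT x|lebesgue. (F i x / n i)\<^sup>2) = 1"
      using n_pos[OF i] by (simp add: power_divide n_def)
    obtain g where "g \<in> T" "(LINT x|lebesgue. g x * F i x) \<noteq> 0" using test[OF i] by blast
    then show "\<exists>g\<in>T. (LINT x|lebesgue. g x * (F i x / n i)) \<noteq> 0"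
      using n_pos[OF i] by (intro bexI[of _ g]) auto
  next
    fix i j assume "i \<in> A" "j \<in> A" "i \<noteq> j"
    from orth[OF this] have "(LINT x|lebesgue. F i x * F j x) = 0"
      by (simp add: FF set_lebesgue_integral_def)
    then show "(LINT x|lebesgue. F i x / n i * (F j x / n j)) = 0" by simp
  next
    have "countable {(c, d). c \<in> \<rat> \<and> d \<in> \<rat> \<and> a < ereal c \<and> c < d \<and> ereal d < b}"
      by (rule countable_subset[of _ "\<rat> \<times> \<rat>"]) (auto simp: countable_rat)
    then show "countable T" unfolding T_def by (rule countable_image)
  next
    fix g assume "g \<in> T"
    then obtain c d where g: "g = G c d" and cd: "a < ereal c" "c < d" "ereal d < b" by (auto simp: T_def)
    have ind: "indicator {c..d} \<in> borel_measurable (lebesgue :: real measure)"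
      by (rule borel_measurable_indicator) simp
    show "g \<in> borel_measurable lebesgue" unfolding g G_def using \<sigma>_meas ind by (intro borel_measurable_times)
    have "(\<lambda>x. (G c d x)\<^sup>2) = (\<lambda>x. indicator {c..d} x *\<^sub>R \<rho> x)"
    proof
      fix x
      have "(G c d x)\<^sup>2 = indicator {c..d} x * (\<sigma> x * \<sigma> x)" by (auto simp: G_def power2_eq_square indicator_def)
      then show "(G c d x)\<^sup>2 = indicator {c..d} x *\<^sub>R \<rho> x"
        unfolding \<sigma>2 using Icc_subset_einterval[OF cd(1,3)] by (auto simp: indicator_def)
    qed
    then show "integrable lebesgue (\<lambda>x. (g x)\<^sup>2)"
      using \<rho>(4)[OF cd(1) _ cd(3)] cd(2) by (simp add: g set_integrable_def)
  qed
qed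

section \<open>Eigenvalues form a countable set\<close>

lemma real_eigenfunctionD:
  assumes "real_eigenfunction a b \<alpha> \<beta> q r u w"
  shows "is_solution a b (\<lambda>s. q s - r) u w" "\<exists>x\<in>einterval a b. u x \<noteq> 0" "sqint a b u"
    "regular_left a b q \<Longrightarrow> real_bc (at_right (real_of_ereal a)) \<alpha> u w"
    "regular_right a b q \<Longrightarrow> real_bc (at_left (real_of_ereal b)) \<beta> u w"
proof -
  show *: "is_solution a b (\<lambda>s. q s - r) u w" using assms by (simp add: real_eigenfunction_def)
  show "sqint a b u" using assms set_integrable_iff_sqint[OF is_solution_continuous(1)[OF *]] by (simp add: real_eigenfunction_def)
qed (use assms in \<open>auto simp: real_eigenfunction_def\<close>)

lemma wronskian_has_integral:
  assumes "is_solution a b Q1 u1 w1" "is_solution a b Q2 u2 w2" and cd: "a < ereal c" "c \<le> d" "ereal d < b"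
  shows "((\<lambda>s. (Q2 s - Q1 s) * (u1 s * u2 s)) has_integral
    (u1 d * w2 d - w1 d * u2 d) - (u1 c * w2 c - w1 c * u2 c)) {c..d}"
    "(\<lambda>s. (Q2 s - Q1 s) * (u1 s * u2 s)) absolutely_integrable_on {c..d}"
  using wronskian_primitive[OF cd(2) is_solution_primitive[OF assms(1) cd] is_solution_primitive[OF assms(2) cd]] cd(2)
  by (auto simp: primitive_on_def)

text \<open>On an exhausting sequence of compact intervals Lagrange's identity turns r - s times the
  integral of the product of two eigenfunctions into W(U i) - W(L i), and both Wronskians tend to 0.
  The weight in \<open>orthogonal_family_countable\<close> is the constant 1.\<close>

lemma SL_eigenvalues_countable:
  assumes ab: "a < b" and left: "regular_left a b q \<or> limit_point_left a b q"
    and right: "regular_right a b q \<or> limit_point_right a b q"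
  shows "countable (SL_eigenvalues a b \<alpha> \<beta> q)"
proof -
  let ?A = "SL_eigenvalues a b \<alpha> \<beta> q" and ?S = "einterval a b"
  have "\<exists>u w. real_eigenfunction a b \<alpha> \<beta> q r u w" if "r \<in> ?A" for r
    using SL_eigenvalue_imp_real[OF that] by blast
  then obtain u w where ef: "\<And>r. r \<in> ?A \<Longrightarrow> real_eigenfunction a b \<alpha> \<beta> q r (u r) (w r)" by metis
  note D = real_eigenfunctionD[OF ef]
  have cont: "continuous_on ?S (u r)" if "r \<in> ?A" for r using is_solution_continuous(1)[OF D(1)[OF that]] .
  have sqi: "set_integrable lebesgue ?S (\<lambda>x. (u r x)\<^sup>2)" if "r \<in> ?A" for r
    using D(3)[OF that] set_integrable_iff_sqint[OF cont[OF that]] by simp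
  have orth: "(LINT x:?S|lebesgue. 1 * (u r x * u s x)) = 0" if rs: "r \<in> ?A" "s \<in> ?A" "r \<noteq> s" for r s
  proof -
    define W where "W x = u r x * w s x - w r x * u s x" for x
    have vl: "vanishes_left a b W"
      unfolding W_def by (rule wronskian_vanishes_left[OF ab left D(1)[OF rs(1)] D(1)[OF rs(2)] D(3)[OF rs(1)] D(3)[OF rs(2)] D(4)[OF rs(1)] D(4)[OF rs(2)]])
    have vr: "vanishes_right a b W"
      unfolding W_def by (rule wronskian_vanishes_right[OF ab right D(1)[OF rs(1)] D(1)[OF rs(2)] D(3)[OF rs(1)] D(3)[OF rs(2)] D(5)[OF rs(1)] D(5)[OF rs(2)]])
    obtain L U :: "nat \<Rightarrow> real" where UL: "?S = (\<Union>i. {L i .. U i})"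
      "incseq U" "decseq L" "\<And>i. L i < U i" "\<And>i. a < ereal (L i)" "\<And>i. ereal (U i) < b"
      by (rule einterval_Icc_approximation[OF ab]) (rule that; assumption)
    have prod_int: "set_integrable lebesgue ?S (\<lambda>x. u r x * u s x)"
    proof -
      have m: "(\<lambda>x. indicator ?S x * u r x) \<in> borel_measurable lebesgue" "(\<lambda>x. indicator ?S x * u s x) \<in> borel_measurable lebesgue"
        using set_borel_measurable_lebesgue_continuous[OF cont] rs by (auto simp: set_borel_measurable_def)
      have "integrable lebesgue (\<lambda>x. (indicator ?S x * u r x)\<^sup>2)" "integrable lebesgue (\<lambda>x. (indicator ?S x * u s x)\<^sup>2)"
      proof -
        have *: "(indicator ?S x * v x)\<^sup>2 = indicator ?S x *\<^sub>R (v x)\<^sup>2" for v :: "real \<Rightarrow> real" and x by (auto simp: indicator_def)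
        show "integrable lebesgue (\<lambda>x. (indicator ?S x * u r x)\<^sup>2)" "integrable lebesgue (\<lambda>x. (indicator ?S x * u s x)\<^sup>2)"
          using sqi[OF rs(1)] sqi[OF rs(2)] unfolding set_integrable_def * by auto
      qed
      from integrable_product_of_squares[OF m this] show ?thesis
        unfolding set_integrable_def
        by (rule Bochner_Integration.integrable_cong[THEN iffD1, rotated -1]) (auto simp: indicator_def)
    qed
    have inc: "incseq (\<lambda>i. {L i..U i})"
      using UL(2,3) by (auto simp: incseq_def decseq_def intro: order_trans)
    have "(\<lambda>i. LINT x:{L i..U i}|lebesgue. u r x * u s x) \<longlonglongrightarrow> (LINT x:(\<Union>i. {L i..U i})|lebesgue. u r x * u s x)"
      by (rule set_integral_cont_up) (use inc prod_int UL(1) in auto)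
    then have lim: "(\<lambda>i. LINT x:{L i..U i}|lebesgue. u r x * u s x) \<longlonglongrightarrow> (LINT x:?S|lebesgue. u r x * u s x)"
      using UL(1) by simp
    have val: "(r - s) * (LINT x:{L i..U i}|lebesgue. u r x * u s x) = W (U i) - W (L i)" for i
    proof -
      have "((\<lambda>x. (r - s) * (u r x * u s x)) has_integral (W (U i) - W (L i))) {L i..U i}"
        using wronskian_has_integral(1)[OF D(1)[OF rs(1)] D(1)[OF rs(2)] UL(5) _ UL(6), of i] UL(4)[of i] by (simp add: W_def)
      then have "integral {L i..U i} (\<lambda>x. (r - s) * (u r x * u s x)) = W (U i) - W (L i)" by (rule integral_unique)
      moreover have "set_integrable lebesgue {L i..U i} (\<lambda>x. u r x * u s x)"
        by (rule set_integrable_subset[OF prod_int]) (use UL(1) in auto)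
      then have "(LINT x:{L i..U i}|lebesgue. u r x * u s x) = integral {L i..U i} (\<lambda>x. u r x * u s x)"
        by (rule set_lebesgue_integral_eq_integral)
      ultimately show ?thesis by (simp add: Henstock_Kurzweil_Integration.integral_mult_right)
    qed
    have "(\<lambda>i. W (U i) - W (L i)) \<longlonglongrightarrow> 0"
    proof (rule LIMSEQ_I)
      fix e :: real assume "e > 0"
      then have e2: "e/2 > 0" by simp
      obtain c1 where c1: "c1 \<in> ?S" "\<And>x. a < ereal x \<Longrightarrow> x \<le> c1 \<Longrightarrow> \<bar>W x\<bar> < e/2" using vl e2 unfolding vanishes_left_def by blast
      obtain c2 where c2: "c2 \<in> ?S" "\<And>x. c2 \<le> x \<Longrightarrow> ereal x < b \<Longrightarrow> \<bar>W x\<bar> < e/2" using vr e2 unfolding vanishes_right_def by blast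
      have "\<exists>i. c1 \<in> {L i..U i}" "\<exists>i. c2 \<in> {L i..U i}" using c1(1) c2(1) UL(1) by auto
      then obtain i j where ij: "c1 \<in> {L i..U i}" "c2 \<in> {L j..U j}" by blast
      have "norm (W (U n) - W (L n) - 0) < e" if n: "max i j \<le> n" for n
      proof -
        have "L n \<le> L i" "U j \<le> U n" using UL(2,3) n by (auto simp: incseq_def decseq_def)
        then have "L n \<le> c1" "c2 \<le> U n" using ij by auto
        then have "\<bar>W (L n)\<bar> < e/2" "\<bar>W (U n)\<bar> < e/2" using c1(2)[OF UL(5)] c2(2)[OF _ UL(6)] by auto
        then show ?thesis by simp
      qed
      then show "\<exists>n0. \<forall>n\<ge>n0. norm (W (U n) - W (L n) - 0) < e" by blast
    qed
    moreover have "(\<lambda>i. W (U i) - W (L i)) \<longlonglongrightarrow> (r - s) * (LINT x:?S|lebesgue. u r x * u s x)"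
      unfolding val[symmetric] by (intro tendsto_intros lim)
    ultimately have "(r - s) * (LINT x:?S|lebesgue. u r x * u s x) = 0" by (rule LIMSEQ_unique[rotated])
    then show ?thesis using rs(3) by simp
  qed
  show ?thesis
  proof (rule orthogonal_family_countable[where \<rho>="\<lambda>_. 1" and \<psi>=u and a=a and b=b])
    show "set_borel_measurable lebesgue ?S (\<lambda>_. 1 :: real)" by (rule set_borel_measurable_lebesgue_continuous) simp
    show "set_integrable lebesgue {c..d} (\<lambda>_. 1 :: real)" for c d :: real
      by (rule absolutely_integrable_continuous_real) simp
  qed (use cont D(2) sqi orth in auto)
qed

section \<open>Eigenvalues under a change of the coupling constant\<close>

lemma einterval_mono: "a \<le> a' \<Longrightarrow> b' \<le> b \<Longrightarrow> einterval a' b' \<subseteq> einterval a b"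
  by (auto simp: einterval_iff)

lemma is_solution_sub:
  assumes "is_solution a b Q u w" "a \<le> a'" "b' \<le> b"
  shows "is_solution a' b' Q u w"
  using assms unfolding is_solution_def by (meson le_less_trans less_le_trans)

lemma is_solution_cong:
  assumes "is_solution a b Q u w" "\<And>x. x \<in> einterval a b \<Longrightarrow> Q x = Q' x"
  shows "is_solution a b Q' u w"
  unfolding is_solution_def
proof (intro allI impI)
  fix c d assume cd: "a < ereal c \<and> c \<le> d \<and> ereal d < b"
  then have *: "primitive_on c d u w" "primitive_on c d w (\<lambda>s. Q s * u s)"
    using is_solution_primitive[OF assms(1)] by blast+
  have "x \<in> einterval a b" if "x \<in> {c..d}" for x
    using Icc_subset_einterval[of a c d b] cd that by blast
  then have "primitive_on c d w (\<lambda>s. Q' s * u s)"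
    by (intro primitive_on_cong[OF *(2)]) (simp_all add: assms(2))
  with *(1) show "primitive_on c d u w \<and> primitive_on c d w (\<lambda>s. Q' s * u s)" by blast
qed

lemma AC2_sub: "a \<le> a' \<Longrightarrow> b' \<le> b \<Longrightarrow> AC2 a b \<subseteq> AC2 a' b'"
proof
  fix u assume ab: "a \<le> a'" "b' \<le> b" and u: "u \<in> AC2 a b"
  have "locally_AC a' b' v" if "locally_AC a b v" for v
    using that ab unfolding locally_AC_def by (meson le_less_trans less_le_trans)
  then show "u \<in> AC2 a' b'" using u einterval_mono[OF ab] by (auto simp: AC2_def)
qed

lemma ae_eq_on_sub: "ae_eq_on S u w \<Longrightarrow> S' \<subseteq> S \<Longrightarrow> ae_eq_on S' u w"
  unfolding ae_eq_on_def by (auto elim: eventually_mono)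

lemma limit_point_left_sub:
  assumes "limit_point_left a b q" "b' \<le> b"
  shows "limit_point_left a b' q"
  unfolding limit_point_left_def
proof
  fix z
  obtain u where u: "u \<in> AC2 a b" "ae_eq_on (einterval a b) (tau q u) (\<lambda>x. z * u x)"
    "\<forall>c\<in>einterval a b. u \<notin> L2 (einterval a (ereal c))"
    using assms(1) unfolding limit_point_left_def by blast
  have sub: "einterval a b' \<subseteq> einterval a b" using einterval_mono assms(2) by blast
  show "\<exists>u\<in>AC2 a b'. ae_eq_on (einterval a b') (tau q u) (\<lambda>x. z * u x) \<and> (\<forall>c\<in>einterval a b'. u \<notin> L2 (einterval a (ereal c)))"
    using u AC2_sub[OF order.refl assms(2)] ae_eq_on_sub[OF u(2) sub] sub by blast
qed

lemma limit_point_right_sub: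
  assumes "limit_point_right a b q" "a \<le> a'"
  shows "limit_point_right a' b q"
  unfolding limit_point_right_def
proof
  fix z
  obtain u where u: "u \<in> AC2 a b" "ae_eq_on (einterval a b) (tau q u) (\<lambda>x. z * u x)"
    "\<forall>c\<in>einterval a b. u \<notin> L2 (einterval (ereal c) b)"
    using assms(1) unfolding limit_point_right_def by blast
  have sub: "einterval a' b \<subseteq> einterval a b" using einterval_mono assms(2) by blast
  show "\<exists>u\<in>AC2 a' b. ae_eq_on (einterval a' b) (tau q u) (\<lambda>x. z * u x) \<and> (\<forall>c\<in>einterval a' b. u \<notin> L2 (einterval (ereal c) b))"
    using u AC2_sub[OF assms(2) order.refl] ae_eq_on_sub[OF u(2) sub] sub by blast
qed

lemma regular_left_sub:
  assumes reg: "regular_left a b q" and ab: "a < b'" "b' \<le> b"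
  shows "regular_left a b' q"
proof -
  obtain c where c: "c \<in> einterval a b" "set_integrable lebesgue (einterval a (ereal c)) q" "a \<noteq> -\<infinity>"
    using reg unfolding regular_left_def by blast
  obtain z where z: "a < ereal z" "ereal z < b'" using ereal_dense2[OF ab(1)] by blast
  define m where "m = min c z"
  have "ereal m \<le> ereal z" by (simp add: m_def)
  then have "ereal m < b'" using z(2) by (rule le_less_trans)
  then have "m \<in> einterval a b'" using c(1) z(1) by (auto simp: einterval_iff m_def min_def)
  moreover have "set_integrable lebesgue (einterval a (ereal m)) q"
    by (rule set_integrable_subset[OF c(2) _ einterval_mono]) (auto simp: m_def)
  ultimately show ?thesis using c(3) unfolding regular_left_def by blast
qed

lemma regular_right_sub:
  assumes reg: "regular_right a b q" and ab: "a' < b" "a \<le> a'"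
  shows "regular_right a' b q"
proof -
  obtain c where c: "c \<in> einterval a b" "set_integrable lebesgue (einterval (ereal c) b) q" "b \<noteq> \<infinity>"
    using reg unfolding regular_right_def by blast
  obtain z where z: "a' < ereal z" "ereal z < b" using ereal_dense2[OF ab(1)] by blast
  define m where "m = max c z"
  have "ereal z \<le> ereal m" by (simp add: m_def)
  then have "a' < ereal m" using z(1) by (rule less_le_trans[rotated])
  then have "m \<in> einterval a' b" using c(1) z(2) by (auto simp: einterval_iff m_def max_def)
  moreover have "set_integrable lebesgue (einterval (ereal m) b) q"
    by (rule set_integrable_subset[OF c(2) _ einterval_mono]) (auto simp: m_def)
  ultimately show ?thesis using c(3) unfolding regular_right_def by blast
qed

lemma regular_left_widen: "regular_left a b' q \<Longrightarrow> b' \<le> b \<Longrightarrow> regular_left a b q"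
  unfolding regular_left_def using einterval_mono[of a a b' b] by blast

lemma regular_right_widen: "regular_right a' b q \<Longrightarrow> a \<le> a' \<Longrightarrow> regular_right a b q"
  unfolding regular_right_def using einterval_mono[of a a' b b] by blast

lemma regular_left_cong:
  assumes "regular_left a b q" "\<And>x. x \<in> einterval a b \<Longrightarrow> q x = q' x"
  shows "regular_left a b q'"
proof -
  obtain c where c: "c \<in> einterval a b" "set_integrable lebesgue (einterval a (ereal c)) q" "a \<noteq> -\<infinity>"
    using assms(1) unfolding regular_left_def by blast
  have "einterval a (ereal c) \<subseteq> einterval a b" using c(1) by (intro einterval_mono) (auto simp: einterval_iff)
  then have "set_integrable lebesgue (einterval a (ereal c)) q'"
    using c(2) assms(2) by (subst set_integrable_cong[where f'=q, OF refl refl]) auto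
  then show ?thesis using c unfolding regular_left_def by blast
qed

lemma regular_right_cong:
  assumes "regular_right a b q" "\<And>x. x \<in> einterval a b \<Longrightarrow> q x = q' x"
  shows "regular_right a b q'"
proof -
  obtain c where c: "c \<in> einterval a b" "set_integrable lebesgue (einterval (ereal c) b) q" "b \<noteq> \<infinity>"
    using assms(1) unfolding regular_right_def by blast
  have "einterval (ereal c) b \<subseteq> einterval a b" using c(1) by (intro einterval_mono) (auto simp: einterval_iff)
  then have "set_integrable lebesgue (einterval (ereal c) b) q'"
    using c(2) assms(2) by (subst set_integrable_cong[where f'=q, OF refl refl]) auto
  then show ?thesis using c unfolding regular_right_def by blast
qed

lemma locally_L1_Icc:
  assumes "locally_L1 a b q" "a < ereal c" "ereal d < b"
  shows "q absolutely_integrable_on {c..d}"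
proof (cases "c \<le> d")
  case False then show ?thesis by (simp add: set_integrable_def)
qed (use assms in \<open>auto simp: locally_L1_def\<close>)

lemma solution_unique_continuation:
  assumes sol: "is_solution a b (\<lambda>s. q s - r) u w" and q: "locally_L1 a b q"
    and z: "z \<in> einterval a b" "u z = 0" "w z = 0" and x: "x \<in> einterval a b"
  shows "u x = 0"
proof -
  define c d where "c = min z x" and "d = max z x"
  have cds: "a < ereal c" "c \<le> d" "ereal d < b" using z(1) x by (auto simp: c_def d_def einterval_iff min_def max_def)
  interpret ode_interval c d z "\<lambda>s. 1 + \<bar>q s\<bar> + \<bar>r\<bar>"
    by (rule ode_interval_shift[OF locally_L1_Icc[OF q cds(1,3)]]) (auto simp: c_def d_def)
  show ?thesis
    using system_unique[OF _ is_solution_primitive[OF sol cds] z(2,3), of x] by (auto simp: c_def d_def)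
qed

text \<open>If u vanished on (c, d), so would w = u' at the midpoint, and unique continuation would
  make u zero everywhere. In the coupling argument the weight lives on (c, d) only, so
  eigenfunctions must not vanish identically there.\<close>

lemma solution_nonzero_subinterval:
  assumes sol: "is_solution a b (\<lambda>s. q s - r) u w" and q: "locally_L1 a b q"
    and nz: "\<exists>x\<in>einterval a b. u x \<noteq> 0" and cd: "a \<le> ereal c" "c < d" "ereal d \<le> b"
  shows "\<exists>x\<in>{c<..<d}. u x \<noteq> 0"
proof (rule ccontr)
  assume "\<not> ?thesis"
  then have z: "\<And>x. x \<in> {c<..<d} \<Longrightarrow> u x = 0" by blast
  define m where "m = (c + d) / 2"
  have m: "m \<in> {c<..<d}" using cd(2) by (simp add: m_def)
  then have "ereal c < ereal m" "ereal m < ereal d" by auto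
  then have mS: "m \<in> einterval a b" using cd unfolding einterval_iff using le_less_trans less_le_trans by blast
  have "(u has_real_derivative w m) (at m)" by (rule is_solution_has_derivative[OF sol mS])
  moreover have "(u has_real_derivative 0) (at m)"
    by (rule has_field_derivative_transform_within_open[of "\<lambda>_. 0" _ _ "{c<..<d}"]) (use m z in auto)
  ultimately have "w m = 0" by (rule DERIV_unique)
  then have "u x = 0" if "x \<in> einterval a b" for x
    using solution_unique_continuation[OF sol q mS z[OF m] _ that] by blast
  with nz show False by blast
qed

lemma vanishes_left_const: 
  assumes v: "vanishes_left a b W" and const: "\<And>x. a < ereal x \<Longrightarrow> ereal x < b \<Longrightarrow> W x = k"
  shows "k = 0"
proof (rule ccontr)
  assume "k \<noteq> 0"
  then have "\<bar>k\<bar> > 0" by simp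
  then obtain c where c: "c \<in> einterval a b" "\<And>x. a < ereal x \<Longrightarrow> x \<le> c \<Longrightarrow> \<bar>W x\<bar> < \<bar>k\<bar>"
    using v unfolding vanishes_left_def by blast
  from c(2)[of c] c(1) have "\<bar>W c\<bar> < \<bar>k\<bar>" by (auto simp: einterval_iff)
  with c(1) show False using const[of c] by (auto simp: einterval_iff)
qed

lemma vanishes_right_const: 
  assumes v: "vanishes_right a b W" and const: "\<And>x. a < ereal x \<Longrightarrow> ereal x < b \<Longrightarrow> W x = k"
  shows "k = 0"
proof (rule ccontr)
  assume "k \<noteq> 0"
  then have "\<bar>k\<bar> > 0" by simp
  then obtain c where c: "c \<in> einterval a b" "\<And>x. c \<le> x \<Longrightarrow> ereal x < b \<Longrightarrow> \<bar>W x\<bar> < \<bar>k\<bar>"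
    using v unfolding vanishes_right_def by blast
  from c(2)[of c] c(1) have "\<bar>W c\<bar> < \<bar>k\<bar>" by (auto simp: einterval_iff)
  with c(1) show False using const[of c] by (auto simp: einterval_iff)
qed

text \<open>The potentials \<open>Q t\<close> and \<open>Q s\<close> agree on (a, c) and on (d, b),
  so there both eigenfunctions solve one and the same equation. The Wronskian theorems for a single
  potential thus apply on these intervals, whose outer endpoints a and b keep their classification
  when the interval is shortened.\<close>

theorem coupling_countable:
  fixes Q :: "real \<Rightarrow> real \<Rightarrow> real" and f :: "real \<Rightarrow> real"
  assumes ab: "a < b"
    and Q: "\<And>t s x. x \<in> einterval a b \<Longrightarrow> Q t x - Q s x = (t - s) * f x"
    and Q_loc: "\<And>t. locally_L1 a b (Q t)" and f_loc: "locally_L1 a b f"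
    and left: "\<And>t. regular_left a b (Q t) \<or> limit_point_left a b (Q t)"
    and right: "\<And>t. regular_right a b (Q t) \<or> limit_point_right a b (Q t)"
    and cd: "a < ereal c" "c < d" "ereal d < b"
    and f_pos: "AE x in lebesgue. x \<in> {c<..<d} \<longrightarrow> 0 < f x"
    and f_zero: "\<And>x. x \<in> einterval a b \<Longrightarrow> x \<notin> {c<..<d} \<Longrightarrow> f x = 0"
  shows "countable {t. r \<in> SL_eigenvalues a b \<alpha> \<beta> (Q t)}"
proof -
  let ?A = "{t. r \<in> SL_eigenvalues a b \<alpha> \<beta> (Q t)}"
  have "\<exists>u w. real_eigenfunction a b \<alpha> \<beta> (Q t) r u w" if "t \<in> ?A" for t
    using SL_eigenvalue_imp_real[of r a b \<alpha> \<beta> "Q t"] that by blast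
  then obtain u w where ef: "\<And>t. t \<in> ?A \<Longrightarrow> real_eigenfunction a b \<alpha> \<beta> (Q t) r (u t) (w t)" by metis
  note D = real_eigenfunctionD[OF ef]
  have cb: "ereal c < b" "a < ereal d"
    using cd by (auto intro: less_trans[of _ "ereal d"] less_trans[of _ "ereal c"])
  have f_int: "f absolutely_integrable_on {c..d}" by (rule locally_L1_Icc[OF f_loc cd(1,3)])
  have cont: "continuous_on (einterval a b) (u t)" if "t \<in> ?A" for t using is_solution_continuous(1)[OF D(1)[OF that]] .
  have cont_cd: "continuous_on {c..d} (u t)" if "t \<in> ?A" for t
    by (rule continuous_on_einterval_Icc[OF cont[OF that] cd(1,3)])
  have prod_int: "(\<lambda>x. f x * v x) absolutely_integrable_on {c..d}" if v: "continuous_on {c..d} v" for v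
  proof -
    have "bounded (v ` {c..d})" using v by (intro compact_imp_bounded compact_continuous_image) auto
    moreover have "v \<in> borel_measurable (lebesgue_on {c..d})"
      using v by (intro continuous_imp_measurable_on_sets_lebesgue) auto
    ultimately show ?thesis
      using absolutely_integrable_bounded_measurable_product_real[of v "{c..d}" f] f_int by (simp add: mult.commute)
  qed
  have ae_abs: "AE x in lebesgue. x \<in> {c<..<d} \<longrightarrow> \<bar>f x\<bar> = f x"
    using f_pos by eventually_elim auto
  have eq_left: "Q t x = Q s x" if "x \<in> einterval a (ereal c)" for t s x
  proof -
    have "x \<in> einterval a b" using that cb einterval_mono[OF order.refl less_imp_le[OF cb(1)], of a] by blast
    moreover have "x \<notin> {c<..<d}" using that by (auto simp: einterval_iff)
    ultimately show ?thesis using Q[of x t s] f_zero[of x] by simp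
  qed
  have eq_right: "Q t x = Q s x" if "x \<in> einterval (ereal d) b" for t s x
  proof -
    have "x \<in> einterval a b" using that cb einterval_mono[OF less_imp_le[OF cb(2)] order.refl, of b] by blast
    moreover have "x \<notin> {c<..<d}" using that by (auto simp: einterval_iff)
    ultimately show ?thesis using Q[of x t s] f_zero[of x] by simp
  qed
  have orth: "integral {c..d} (\<lambda>x. f x * (u t x * u s x)) = 0" if ts: "t \<in> ?A" "s \<in> ?A" "t \<noteq> s" for t s
  proof -
    define W where "W x = u t x * w s x - w t x * u s x" for x
    note sol = D(1)[OF ts(1)] D(1)[OF ts(2)]
    have hi: "((\<lambda>x. (s - t) * (f x * (u t x * u s x))) has_integral (W y - W x)) {x..y}"
      if xy: "a < ereal x" "x \<le> y" "ereal y < b" for x y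
    proof (rule has_integral_eq[OF _ wronskian_has_integral(1)[OF sol xy, folded W_def]])
      fix z assume "z \<in> {x..y}"
      then have "z \<in> einterval a b" using Icc_subset_einterval[OF xy(1,3)] by blast
      then show "(Q s z - r - (Q t z - r)) * (u t z * u s z) = (s - t) * (f z * (u t z * u s z))"
        using Q[of z s t] by simp
    qed
    have W_left: "W x = W c" if x: "a < ereal x" "x \<le> c" for x
    proof -
      have "((\<lambda>z. 0) has_integral (W c - W x)) {x..c}"
      proof (rule has_integral_eq[OF _ hi[OF x cb(1)]])
        fix z assume z: "z \<in> {x..c}"
        then have "z \<in> einterval a b" using Icc_subset_einterval[OF x(1) cb(1)] by blast
        then show "(s - t) * (f z * (u t z * u s z)) = 0" using f_zero z by simp
      qed
      then show ?thesis by (simp add: has_integral_0_eq)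
    qed
    have W_right: "W y = W d" if y: "d \<le> y" "ereal y < b" for y
    proof -
      have "((\<lambda>z. 0) has_integral (W y - W d)) {d..y}"
      proof (rule has_integral_eq[OF _ hi[OF cb(2) y]])
        fix z assume z: "z \<in> {d..y}"
        then have "z \<in> einterval a b" using Icc_subset_einterval[OF cb(2) y(2)] by blast
        then show "(s - t) * (f z * (u t z * u s z)) = 0" using f_zero z by simp
      qed
      then show ?thesis by (simp add: has_integral_0_eq)
    qed
    have "vanishes_left a (ereal c) W"
      unfolding W_def
    proof (rule wronskian_vanishes_left[where q="Q t" and \<theta>=\<alpha>])
      show "is_solution a (ereal c) (\<lambda>x. Q t x - r) (u t) (w t)"
        by (rule is_solution_sub[OF sol(1)]) (use cb in auto)
      have "is_solution a (ereal c) (\<lambda>x. Q s x - r) (u s) (w s)"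
        by (rule is_solution_sub[OF sol(2)]) (use cb in auto)
      then show "is_solution a (ereal c) (\<lambda>x. Q t x - r) (u s) (w s)"
        by (rule is_solution_cong) (simp add: eq_left[of _ t s])
      show "regular_left a (ereal c) (Q t) \<or> limit_point_left a (ereal c) (Q t)"
        using left[of t] regular_left_sub[OF _ cd(1)] limit_point_left_sub cb by (auto intro: less_imp_le)
      show "sqint a (ereal c) (u t)" "sqint a (ereal c) (u s)"
        using sqint_mono[OF D(3)[OF ts(1)]] sqint_mono[OF D(3)[OF ts(2)]] cb by (auto intro: less_imp_le)
      assume reg: "regular_left a (ereal c) (Q t)"
      show "real_bc (at_right (real_of_ereal a)) \<alpha> (u t) (w t)"
        by (rule D(4)[OF ts(1)], rule regular_left_widen[OF reg]) (use cb in auto)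
      show "real_bc (at_right (real_of_ereal a)) \<alpha> (u s) (w s)"
        by (rule D(4)[OF ts(2)], rule regular_left_widen[OF regular_left_cong[OF reg eq_left]]) (use cb in auto)
    qed (use cd in auto)
    then have Wc: "W c = 0" by (rule vanishes_left_const) (use W_left in auto)
    have "vanishes_right (ereal d) b W"
      unfolding W_def
    proof (rule wronskian_vanishes_right[where q="Q t" and \<theta>=\<beta>])
      show "is_solution (ereal d) b (\<lambda>x. Q t x - r) (u t) (w t)"
        by (rule is_solution_sub[OF sol(1)]) (use cb in auto)
      have "is_solution (ereal d) b (\<lambda>x. Q s x - r) (u s) (w s)"
        by (rule is_solution_sub[OF sol(2)]) (use cb in auto)
      then show "is_solution (ereal d) b (\<lambda>x. Q t x - r) (u s) (w s)"
        by (rule is_solution_cong) (simp add: eq_right[of _ t s])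
      show "regular_right (ereal d) b (Q t) \<or> limit_point_right (ereal d) b (Q t)"
        using right[of t] regular_right_sub[OF _ cd(3)] limit_point_right_sub cb by (auto intro: less_imp_le)
      show "sqint (ereal d) b (u t)" "sqint (ereal d) b (u s)"
        using sqint_mono[OF D(3)[OF ts(1)]] sqint_mono[OF D(3)[OF ts(2)]] cb by (auto intro: less_imp_le)
      assume reg: "regular_right (ereal d) b (Q t)"
      show "real_bc (at_left (real_of_ereal b)) \<beta> (u t) (w t)"
        by (rule D(5)[OF ts(1)], rule regular_right_widen[OF reg]) (use cb in auto)
      show "real_bc (at_left (real_of_ereal b)) \<beta> (u s) (w s)"
        by (rule D(5)[OF ts(2)], rule regular_right_widen[OF regular_right_cong[OF reg eq_right]]) (use cb in auto)
    qed (use cd in auto)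
    then have Wd: "W d = 0" by (rule vanishes_right_const) (use W_right in auto)
    have "integral {c..d} (\<lambda>x. (s - t) * (f x * (u t x * u s x))) = 0"
      using integral_unique[OF hi[OF cd(1) _ cd(3)]] cd(2) Wc Wd by simp
    then show ?thesis using ts(3) by (simp add: Henstock_Kurzweil_Integration.integral_mult_right)
  qed
  have to_open: "set_integrable lebesgue {c<..<d} g" if "g absolutely_integrable_on {c..d}" for g :: "real \<Rightarrow> real"
    by (rule set_integrable_subset[OF that]) auto
  show ?thesis
  \<comment> \<open>The weight has to be nonnegative everywhere, whereas f is known to be positive
    only almost everywhere in (c, d); hence |f|, which gives the same integrals there.\<close>
  proof (rule orthogonal_family_countable[where \<rho>="\<lambda>x. \<bar>f x\<bar>" and \<psi>=u and a="ereal c" and b="ereal d"], unfold einterval_eq)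
    have "set_integrable lebesgue {c<..<d} (\<lambda>x. \<bar>f x\<bar>)"
      by (intro to_open set_integrable_abs f_int)
    then show "set_borel_measurable lebesgue {c<..<d} (\<lambda>x. \<bar>f x\<bar>)"
      unfolding set_borel_measurable_def set_integrable_def by (rule borel_measurable_integrable)
    show "AE x in lebesgue. x \<in> {c<..<d} \<longrightarrow> 0 < \<bar>f x\<bar>" using f_pos by eventually_elim auto
    show "set_integrable lebesgue {s..t} (\<lambda>x. \<bar>f x\<bar>)" if "ereal c < ereal s" "s \<le> t" "ereal t < ereal d" for s t
      by (rule set_integrable_subset[OF set_integrable_abs[OF f_int]]) (use that in auto)
    fix t assume t: "t \<in> ?A"
    show "continuous_on {c<..<d} (u t)" by (rule continuous_on_subset[OF cont_cd[OF t]]) auto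
    show "\<exists>x\<in>{c<..<d}. u t x \<noteq> 0"
      by (rule solution_nonzero_subinterval[OF D(1)[OF t] Q_loc D(2)[OF t]]) (use cd in auto)
    have "(\<lambda>x. f x * (u t x)\<^sup>2) absolutely_integrable_on {c..d}"
      by (intro prod_int continuous_intros cont_cd t)
    from set_integrable_abs[OF to_open[OF this]] show "set_integrable lebesgue {c<..<d} (\<lambda>x. \<bar>f x\<bar> * (u t x)\<^sup>2)"
      by (simp add: abs_mult)
  next
    fix t s assume ts: "t \<in> ?A" "s \<in> ?A" "t \<noteq> s"
    have int: "(\<lambda>x. f x * (u t x * u s x)) absolutely_integrable_on {c..d}"
      by (intro prod_int continuous_intros cont_cd ts)
    have m1: "(\<lambda>x. indicator {c<..<d} x *\<^sub>R (f x * (u t x * u s x))) \<in> borel_measurable lebesgue"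
      using to_open[OF int] unfolding set_integrable_def by (rule borel_measurable_integrable)
    have "(LINT x:{c<..<d}|lebesgue. \<bar>f x\<bar> * (u t x * u s x)) = (LINT x:{c<..<d}|lebesgue. f x * (u t x * u s x))"
    proof -
      have ae: "AE x in lebesgue. indicator {c<..<d} x *\<^sub>R (f x * (u t x * u s x)) = indicator {c<..<d} x *\<^sub>R (\<bar>f x\<bar> * (u t x * u s x))"
        using ae_abs by eventually_elim (auto simp: indicator_def)
      show ?thesis unfolding set_lebesgue_integral_def
        by (rule integral_cong_AE[OF borel_measurable_AE[OF m1 ae] m1]) (use ae in \<open>auto elim: eventually_mono\<close>)
    qed
    also have "\<dots> = integral {c<..<d} (\<lambda>x. f x * (u t x * u s x))"
      by (rule set_lebesgue_integral_eq_integral(2)[OF to_open[OF int]])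
    also have "\<dots> = 0" using orth[OF ts] by (simp add: integral_open_interval_real)
    finally show "(LINT x:{c<..<d}|lebesgue. \<bar>f x\<bar> * (u t x * u s x)) = 0" .
  qed auto
qed

section \<open>Measurability of spectral events\<close>

text \<open>By compactness it suffices to find, for each \<open>n\<close>, a point of a countable dense set satisfying the
  first \<open>n\<close> conditions up to \<open>1/n\<close>; no measurable projection theorem is needed.\<close>

lemma measurable_exists_compact:
  fixes F :: "nat \<Rightarrow> 'w \<Rightarrow> 'z::euclidean_space \<Rightarrow> real"
  assumes K: "compact K"
    and cont: "\<And>m \<omega>. \<omega> \<in> space M \<Longrightarrow> continuous_on K (F m \<omega>)"
    and meas: "\<And>m p. p \<in> K \<Longrightarrow> (\<lambda>\<omega>. F m \<omega> p) \<in> borel_measurable M"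
  shows "{\<omega> \<in> space M. \<exists>p\<in>K. \<forall>m. F m \<omega> p \<le> 0} \<in> sets M"
proof -
  obtain D where D: "countable D" "D \<subseteq> K" "K \<subseteq> closure D" using separable by blast
  have "{\<omega> \<in> space M. \<exists>p\<in>K. \<forall>m. F m \<omega> p \<le> 0} =
      {\<omega> \<in> space M. \<forall>n::nat. \<exists>p\<in>D. \<forall>m\<in>{..n}. F m \<omega> p < 1 / real (Suc n)}" (is "?A = ?B")
  proof (intro equalityI subsetI)
    fix \<omega> assume "\<omega> \<in> ?A"
    then obtain p where \<omega>: "\<omega> \<in> space M" and p: "p \<in> K" "\<And>m. F m \<omega> p \<le> 0" by blast
    have "\<exists>p\<in>D. \<forall>m\<in>{..n}. F m \<omega> p < 1 / real (Suc n)" for n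
    proof -
      have "\<forall>\<^sub>F y in at p within K. F m \<omega> y < 1 / real (Suc n)" for m
      proof -
        have "(F m \<omega> \<longlongrightarrow> F m \<omega> p) (at p within K)" using cont[OF \<omega>] p(1) by (simp add: continuous_on_def)
        then show ?thesis by (rule order_tendstoD(2)) (use p(2)[of m] in \<open>simp add: le_less_trans\<close>)
      qed
      then have "\<forall>\<^sub>F y in at p within K. \<forall>m\<in>{..n}. F m \<omega> y < 1 / real (Suc n)"
        by (intro eventually_ball_finite) auto
      then obtain \<delta> where \<delta>: "\<delta> > 0" "\<And>y. y \<in> K \<Longrightarrow> y \<noteq> p \<Longrightarrow> dist y p < \<delta> \<Longrightarrow> \<forall>m\<in>{..n}. F m \<omega> y < 1 / real (Suc n)"
        unfolding eventually_at by blast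
      obtain y where y: "y \<in> D" "dist y p < \<delta>" using D(3) p(1) \<delta>(1) closure_approachable by blast
      have "\<forall>m\<in>{..n}. F m \<omega> y < 1 / real (Suc n)"
      proof (cases "y = p")
        case True then show ?thesis by (auto intro!: le_less_trans[OF p(2)])
      next
        case False then show ?thesis using \<delta>(2)[of y] y D(2) by auto
      qed
      with y(1) show ?thesis by blast
    qed
    with \<omega> show "\<omega> \<in> ?B" by blast
  next
    fix \<omega> assume "\<omega> \<in> ?B"
    then have \<omega>: "\<omega> \<in> space M" and "\<forall>n::nat. \<exists>p\<in>D. \<forall>m\<in>{..n}. F m \<omega> p < 1 / real (Suc n)" by auto
    then obtain P where P: "\<And>n. P n \<in> D" "\<And>n m. m \<le> n \<Longrightarrow> F m \<omega> (P n) < 1 / real (Suc n)"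
      by (metis atMost_iff)
    have PK: "P n \<in> K" for n using P(1) D(2) by blast
    obtain p \<sigma> where p: "p \<in> K" "strict_mono \<sigma>" "(P \<circ> \<sigma>) \<longlonglongrightarrow> p"
      using K[unfolded compact_def, rule_format, of P] PK by blast
    have "F m \<omega> p \<le> 0" for m
    proof (rule LIMSEQ_le)
      show "(\<lambda>j. F m \<omega> ((P \<circ> \<sigma>) j)) \<longlonglongrightarrow> F m \<omega> p"
        using cont[OF \<omega>, of m] p(1,3) PK unfolding continuous_on_sequentially by (auto simp: o_def)
      have "(\<lambda>n. 1 / real (Suc n)) \<longlonglongrightarrow> 0" by (rule lim_1_over_n[THEN LIMSEQ_Suc])
      from LIMSEQ_subseq_LIMSEQ[OF this p(2)] show "(\<lambda>j. 1 / real (Suc (\<sigma> j))) \<longlonglongrightarrow> 0"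
        by (simp only: o_def)
      show "\<exists>N. \<forall>j\<ge>N. F m \<omega> ((P \<circ> \<sigma>) j) \<le> 1 / real (Suc (\<sigma> j))"
      proof (intro exI[of _ m] allI impI)
        fix j assume "m \<le> j"
        then have "m \<le> \<sigma> j" using seq_suble[OF p(2), of j] by simp
        from less_imp_le[OF P(2)[OF this]] show "F m \<omega> ((P \<circ> \<sigma>) j) \<le> 1 / real (Suc (\<sigma> j))" by simp
      qed
    qed
    with \<omega> p(1) show "\<omega> \<in> ?A" by blast
  qed
  also have "\<dots> \<in> sets M"
  proof (rule sets.sets_Collect_countable_All)
    fix n :: nat
    have "{\<omega> \<in> space M. \<forall>m\<in>{..n}. F m \<omega> p < 1 / real (Suc n)} \<in> sets M" if "p \<in> D" for p
      using meas[of p] that D(2)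
      by (intro sets.sets_Collect_finite_All borel_measurable_less) auto
    then have "(\<Union>p\<in>D. {\<omega> \<in> space M. \<forall>m\<in>{..n}. F m \<omega> p < 1 / real (Suc n)}) \<in> sets M"
      by (intro sets.countable_UN'[OF D(1)]) auto
    moreover have "(\<Union>p\<in>D. {\<omega> \<in> space M. \<forall>m\<in>{..n}. F m \<omega> p < 1 / real (Suc n)}) =
        {\<omega> \<in> space M. \<exists>p\<in>D. \<forall>m\<in>{..n}. F m \<omega> p < 1 / real (Suc n)}" by auto
    ultimately show "{\<omega> \<in> space M. \<exists>p\<in>D. \<forall>m\<in>{..n}. F m \<omega> p < 1 / real (Suc n)} \<in> sets M" by simp
  qed
  finally show ?thesis .
qed

text \<open>Near a regular endpoint \<open>cut a b q\<close> is integrable across the endpoint, so that the solutions with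
  this potential can be evaluated there.\<close>

definition cut :: "ereal \<Rightarrow> ereal \<Rightarrow> (real \<Rightarrow> real) \<Rightarrow> real \<Rightarrow> real" where
  "cut a b q s = indicator (einterval a b) s * q s"

lemma cut_eq: "s \<in> einterval a b \<Longrightarrow> cut a b q s = q s"
  by (simp add: cut_def)

context
  fixes a b :: ereal and q :: "real \<Rightarrow> real" and x0 :: real
  assumes q: "locally_L1 a b q" and x0: "x0 \<in> einterval a b"
begin

lemma ax0: "a < ereal x0" "ereal x0 < b" "a < b"
  using x0 by (auto simp: einterval_iff)

lemma cut_integrable:
  assumes "a < ereal c" "ereal d < b"
  shows "cut a b q absolutely_integrable_on {c..d}"
proof (rule absolutely_integrable_spike[OF locally_L1_Icc[OF q assms] negligible_empty])
  fix x assume "x \<in> {c..d} - {}"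
  then have "x \<in> einterval a b" using Icc_subset_einterval[OF assms] by blast
  then show "cut a b q x = q x" by (rule cut_eq)
qed

lemma sl_is_solution: "is_solution a b (\<lambda>s. q s - fst z) (sl_u (cut a b q) x0 z) (sl_w (cut a b q) x0 z)"
proof -
  have "is_solution a b (\<lambda>s. cut a b q s - fst z) (sl_u (cut a b q) x0 z) (sl_w (cut a b q) x0 z)"
    unfolding is_solution_def
  proof (intro allI impI)
    fix c d assume cd: "a < ereal c \<and> c \<le> d \<and> ereal d < b"
    have "a < ereal (min c x0)" "ereal (max d x0) < b" using cd ax0 by (auto simp: min_def max_def)
    then have "cut a b q absolutely_integrable_on {min c x0..max d x0}" by (rule cut_integrable)
    then show "primitive_on c d (sl_u (cut a b q) x0 z) (sl_w (cut a b q) x0 z) \<and>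
        primitive_on c d (sl_w (cut a b q) x0 z) (\<lambda>s. (cut a b q s - fst z) * sl_u (cut a b q) x0 z s)"
      using sl_system[where q="cut a b q" and c="min c x0" and d="max d x0" and z=z]
        by (auto intro: primitive_on_subinterval[where c="min c x0" and d="max d x0"])
  qed
  then show ?thesis by (rule is_solution_cong) (simp add: cut_eq)
qed

lemma sl_base: "sl_u (cut a b q) x0 z x0 = fst (snd z)" "sl_w (cut a b q) x0 z x0 = snd (snd z)"
  by (rule sl_initial[OF cut_integrable[OF ax0(1,2)]])+

text \<open>The existentially quantified c may be replaced by the fixed x0, because q is integrable
  over the compact interval between them. Regularity becomes the integrability of q over a fixed
  set, which is a measurable condition on the potential.\<close>

lemma regular_left_iff: "regular_left a b q \<longleftrightarrow> a \<noteq> -\<infinity> \<and> set_integrable lebesgue (einterval a (ereal x0)) q"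
proof
  assume "regular_left a b q"
  then obtain c where c: "c \<in> einterval a b" "set_integrable lebesgue (einterval a (ereal c)) q" "a \<noteq> -\<infinity>"
    unfolding regular_left_def by blast
  have cb: "a < ereal c" "ereal c < b" using c(1) by (auto simp: einterval_iff)
  have "set_integrable lebesgue (einterval a (ereal c) \<union> {c..x0}) q"
    by (intro set_integrable_Un c locally_L1_Icc[OF q] cb ax0) auto
  then have "set_integrable lebesgue (einterval a (ereal x0)) q"
    by (rule set_integrable_subset) (auto simp: einterval_iff)
  with c(3) show "a \<noteq> -\<infinity> \<and> set_integrable lebesgue (einterval a (ereal x0)) q" by blast
qed (use x0 in \<open>auto simp: regular_left_def\<close>)

lemma regular_right_iff: "regular_right a b q \<longleftrightarrow> b \<noteq> \<infinity> \<and> set_integrable lebesgue (einterval (ereal x0) b) q"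
proof
  assume "regular_right a b q"
  then obtain c where c: "c \<in> einterval a b" "set_integrable lebesgue (einterval (ereal c) b) q" "b \<noteq> \<infinity>"
    unfolding regular_right_def by blast
  have cb: "a < ereal c" "ereal c < b" using c(1) by (auto simp: einterval_iff)
  have "set_integrable lebesgue (einterval (ereal c) b \<union> {x0..c}) q"
    by (intro set_integrable_Un c locally_L1_Icc[OF q] cb ax0) auto
  then have "set_integrable lebesgue (einterval (ereal x0) b) q"
    by (rule set_integrable_subset) (auto simp: einterval_iff)
  with c(3) show "b \<noteq> \<infinity> \<and> set_integrable lebesgue (einterval (ereal x0) b) q" by blast
qed (use x0 in \<open>auto simp: regular_right_def\<close>)

lemma cut_integrable_left:
  assumes "regular_left a b q"
  shows "a = ereal (real_of_ereal a)" "real_of_ereal a < x0"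
    "cut a b q absolutely_integrable_on {real_of_ereal a..x0}"
proof -
  show a: "a = ereal (real_of_ereal a)" using assms ax0(1) by (cases a) (auto simp: regular_left_def)
  then have "ereal (real_of_ereal a) < ereal x0" using ax0(1) by simp
  then show "real_of_ereal a < x0" by simp
  have "q absolutely_integrable_on {real_of_ereal a<..<x0}"
    using assms a by (metis regular_left_iff einterval_eq_Icc)
  then have "cut a b q absolutely_integrable_on {real_of_ereal a<..<x0}"
  proof (rule absolutely_integrable_spike[OF _ negligible_empty])
    fix x assume "x \<in> {real_of_ereal a<..<x0} - {}"
    then have "ereal (real_of_ereal a) < ereal x" "ereal x < ereal x0" by auto
    then show "cut a b q x = q x" using a less_trans[OF _ ax0(2)] by (intro cut_eq) (auto simp: einterval_iff)
  qed
  then have "cut a b q absolutely_integrable_on ({real_of_ereal a<..<x0} \<union> {real_of_ereal a, x0})"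
    by (intro absolutely_integrable_Un) (auto intro!: absolutely_integrable_negligible)
  then show "cut a b q absolutely_integrable_on {real_of_ereal a..x0}"
    by (rule set_integrable_subset) auto
qed

lemma cut_integrable_right:
  assumes "regular_right a b q"
  shows "b = ereal (real_of_ereal b)" "x0 < real_of_ereal b"
    "cut a b q absolutely_integrable_on {x0..real_of_ereal b}"
proof -
  show b: "b = ereal (real_of_ereal b)" using assms ax0(2) by (cases b) (auto simp: regular_right_def)
  then have "ereal x0 < ereal (real_of_ereal b)" using ax0(2) by simp
  then show "x0 < real_of_ereal b" by simp
  have "q absolutely_integrable_on {x0<..<real_of_ereal b}"
    using assms b by (metis regular_right_iff einterval_eq_Icc)
  then have "cut a b q absolutely_integrable_on {x0<..<real_of_ereal b}"
  proof (rule absolutely_integrable_spike[OF _ negligible_empty])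
    fix x assume "x \<in> {x0<..<real_of_ereal b} - {}"
    then have "ereal x0 < ereal x" "ereal x < ereal (real_of_ereal b)" by auto
    then show "cut a b q x = q x" using b less_trans[OF ax0(1)] by (intro cut_eq) (auto simp: einterval_iff)
  qed
  then have "cut a b q absolutely_integrable_on ({x0<..<real_of_ereal b} \<union> {real_of_ereal b, x0})"
    by (intro absolutely_integrable_Un) (auto intro!: absolutely_integrable_negligible)
  then show "cut a b q absolutely_integrable_on {x0..real_of_ereal b}"
    by (rule set_integrable_subset) auto
qed

text \<open>The cut potential is integrable up to the endpoint, so the solution and its derivative
  are continuous there and the limits in the boundary condition are values. These values depend
  continuously on the parameter z.\<close>

lemma sl_real_bc_left:
  assumes "regular_left a b q"
  shows "real_bc (at_right (real_of_ereal a)) \<alpha> (sl_u (cut a b q) x0 z) (sl_w (cut a b q) x0 z) \<longleftrightarrow>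
    sl_u (cut a b q) x0 z (real_of_ereal a) * cos \<alpha> + sl_w (cut a b q) x0 z (real_of_ereal a) * sin \<alpha> = 0"
proof -
  let ?a = "real_of_ereal a"
  note ci = cut_integrable_left[OF assms]
  have cont: "continuous_on {?a..x0} (sl_u (cut a b q) x0 z)" "continuous_on {?a..x0} (sl_w (cut a b q) x0 z)"
    using sl_u_continuous_on[OF ci(3)] ci(2) by auto
  have lim: "(f \<longlongrightarrow> f ?a) (at_right ?a)" if "continuous_on {?a..x0} f" for f :: "real \<Rightarrow> real"
    using continuous_on_Icc_at_rightD[OF that ci(2)] .
  show ?thesis unfolding real_bc_def
    using tendsto_unique[OF trivial_limit_at_right_real lim[OF cont(1)]]
      tendsto_unique[OF trivial_limit_at_right_real lim[OF cont(2)]] lim[OF cont(1)] lim[OF cont(2)] by blast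
qed

lemma sl_real_bc_right:
  assumes "regular_right a b q"
  shows "real_bc (at_left (real_of_ereal b)) \<beta> (sl_u (cut a b q) x0 z) (sl_w (cut a b q) x0 z) \<longleftrightarrow>
    sl_u (cut a b q) x0 z (real_of_ereal b) * cos \<beta> + sl_w (cut a b q) x0 z (real_of_ereal b) * sin \<beta> = 0"
proof -
  let ?b = "real_of_ereal b"
  note ci = cut_integrable_right[OF assms]
  have cont: "continuous_on {x0..?b} (sl_u (cut a b q) x0 z)" "continuous_on {x0..?b} (sl_w (cut a b q) x0 z)"
    using sl_u_continuous_on[OF ci(3)] ci(2) by auto
  have lim: "(f \<longlongrightarrow> f ?b) (at_left ?b)" if "continuous_on {x0..?b} f" for f :: "real \<Rightarrow> real"
    using continuous_on_Icc_at_leftD[OF that ci(2)] .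
  show ?thesis unfolding real_bc_def
    using tendsto_unique[OF trivial_limit_at_left_real lim[OF cont(1)]]
      tendsto_unique[OF trivial_limit_at_left_real lim[OF cont(2)]] lim[OF cont(1)] lim[OF cont(2)] by blast
qed

lemma real_bc_scaled:
  assumes "real_bc F \<theta> u w" "\<forall>\<^sub>F x in F. k * u x = u' x" "\<forall>\<^sub>F x in F. k * w x = w' x"
  shows "real_bc F \<theta> u' w'"
proof -
  obtain y y' where y: "(u \<longlongrightarrow> y) F" "(w \<longlongrightarrow> y') F" "y * cos \<theta> + y' * sin \<theta> = 0"
    using assms(1) unfolding real_bc_def by blast
  have "(u' \<longlongrightarrow> k * y) F" "(w' \<longlongrightarrow> k * y') F"
    by (rule Lim_transform_eventually[OF tendsto_mult_left[OF y(1)] assms(2)],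
        rule Lim_transform_eventually[OF tendsto_mult_left[OF y(2)] assms(3)])
  moreover have "k * y * cos \<theta> + k * y' * sin \<theta> = k * (y * cos \<theta> + y' * sin \<theta>)" by (simp add: algebra_simps)
  ultimately show ?thesis unfolding real_bc_def using y(3) by (metis mult_zero_right)
qed

definition sl_admissible :: "real \<Rightarrow> real \<Rightarrow> real \<times> real \<times> real \<Rightarrow> bool" where
  "sl_admissible \<alpha> \<beta> z \<longleftrightarrow> sqint a b (sl_u (cut a b q) x0 z) \<and>
    (regular_left a b q \<longrightarrow> sl_u (cut a b q) x0 z (real_of_ereal a) * cos \<alpha> + sl_w (cut a b q) x0 z (real_of_ereal a) * sin \<alpha> = 0) \<and>
    (regular_right a b q \<longrightarrow> sl_u (cut a b q) x0 z (real_of_ereal b) * cos \<beta> + sl_w (cut a b q) x0 z (real_of_ereal b) * sin \<beta> = 0)"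

text \<open>An eigenfunction can be scaled so that its initial data at x0, which are not both zero,
  lie on the unit circle. The angle then ranges over a compact interval, and the trivial solution is
  excluded automatically.\<close>

theorem SL_eigenvalue_iff_sl:
  "r \<in> SL_eigenvalues a b \<alpha> \<beta> q \<longleftrightarrow> (\<exists>\<theta>\<in>{0..2*pi}. sl_admissible \<alpha> \<beta> (r, cos \<theta>, sin \<theta>))"
proof
  assume "r \<in> SL_eigenvalues a b \<alpha> \<beta> q"
  then obtain u w where ef: "real_eigenfunction a b \<alpha> \<beta> q r u w" by (rule SL_eigenvalue_imp_real)
  note D = real_eigenfunctionD[OF ef]
  define \<rho> where "\<rho> = sqrt ((u x0)\<^sup>2 + (w x0)\<^sup>2)"
  have "u x0 \<noteq> 0 \<or> w x0 \<noteq> 0"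
    using solution_unique_continuation[OF D(1) q x0] D(2) by blast
  then have pos: "(u x0)\<^sup>2 + (w x0)\<^sup>2 > 0" by (simp add: sum_power2_gt_zero_iff)
  then have \<rho>: "\<rho> > 0" by (simp add: \<rho>_def)
  have "(u x0 / \<rho>)\<^sup>2 + (w x0 / \<rho>)\<^sup>2 = ((u x0)\<^sup>2 + (w x0)\<^sup>2) / \<rho>\<^sup>2"
    by (simp add: power_divide add_divide_distrib)
  also have "\<rho>\<^sup>2 = (u x0)\<^sup>2 + (w x0)\<^sup>2"
    unfolding \<rho>_def using pos by (intro real_sqrt_pow2) simp
  also have "((u x0)\<^sup>2 + (w x0)\<^sup>2) / ((u x0)\<^sup>2 + (w x0)\<^sup>2) = 1"
    by (rule divide_self) (use pos in linarith)
  finally obtain \<theta> where \<theta>: "0 \<le> \<theta>" "\<theta> < 2 * pi" "u x0 / \<rho> = cos \<theta>" "w x0 / \<rho> = sin \<theta>"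
    by (rule sincos_total_2pi)
  let ?z = "(r, cos \<theta>, sin \<theta>)"
  let ?u = "sl_u (cut a b q) x0 ?z" and ?w = "sl_w (cut a b q) x0 ?z"
  have eq: "(1/\<rho>) * u x = ?u x \<and> (1/\<rho>) * w x = ?w x" if x: "x \<in> einterval a b" for x
  proof -
    define c d where "c = min x0 x" and "d = max x0 x"
    have cds: "a < ereal c" "c \<le> d" "ereal d < b" using ax0 x by (auto simp: c_def d_def einterval_iff min_def max_def)
    have s1: "is_solution a b (\<lambda>s. q s - r) ?u ?w" using sl_is_solution[of ?z] by simp
    have p1: "primitive_on c d (\<lambda>x. (1/\<rho>) * u x - ?u x) (\<lambda>x. (1/\<rho>) * w x - ?w x)"
      by (intro primitive_on_diff primitive_on_cmult is_solution_primitive(1)[OF D(1) cds] is_solution_primitive(1)[OF s1 cds])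
    have "primitive_on c d (\<lambda>x. (1/\<rho>) * w x - ?w x) (\<lambda>x. (1/\<rho>) * ((q x - r) * u x) - (q x - r) * ?u x)"
      by (intro primitive_on_diff primitive_on_cmult is_solution_primitive(2)[OF D(1) cds] is_solution_primitive(2)[OF s1 cds])
    then have p2: "primitive_on c d (\<lambda>x. (1/\<rho>) * w x - ?w x) (\<lambda>x. (q x - r) * ((1/\<rho>) * u x - ?u x))"
      by (rule primitive_on_cong) (simp_all add: algebra_simps diff_divide_distrib)
    have init: "(1/\<rho>) * u x0 - ?u x0 = 0" "(1/\<rho>) * w x0 - ?w x0 = 0" using \<theta> by (simp_all add: sl_base)
    interpret ode_interval c d x0 "\<lambda>s. 1 + \<bar>q s\<bar> + \<bar>r\<bar>"
      by (rule ode_interval_shift[OF locally_L1_Icc[OF q cds(1,3)]]) (auto simp: c_def d_def)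
    show ?thesis using system_unique[OF _ p1 p2 init, of x] by (auto simp: c_def d_def)
  qed
  have "sl_admissible \<alpha> \<beta> ?z"
    unfolding sl_admissible_def
  proof (intro conjI impI)
    obtain B where B: "\<And>c d. a < ereal c \<Longrightarrow> c \<le> d \<Longrightarrow> ereal d < b \<Longrightarrow> integral {c..d} (\<lambda>x. (u x)\<^sup>2) \<le> B"
      using D(3) unfolding sqint_def by blast
    show "sqint a b ?u" unfolding sqint_def
    proof (intro exI allI impI)
      fix c d assume cd: "a < ereal c \<and> c \<le> d \<and> ereal d < b"
      have "integral {c..d} (\<lambda>x. (?u x)\<^sup>2) = integral {c..d} (\<lambda>x. (1/\<rho>)\<^sup>2 * (u x)\<^sup>2)"
      proof (rule Henstock_Kurzweil_Integration.integral_cong)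
        fix x assume "x \<in> {c..d}"
        then have "x \<in> einterval a b" using Icc_subset_einterval[of a c d b] cd by blast
        then show "(?u x)\<^sup>2 = (1/\<rho>)\<^sup>2 * (u x)\<^sup>2" using eq by (metis power_mult_distrib)
      qed
      also have "\<dots> = (1/\<rho>)\<^sup>2 * integral {c..d} (\<lambda>x. (u x)\<^sup>2)" by (rule Henstock_Kurzweil_Integration.integral_mult_right)
      also have "\<dots> \<le> (1/\<rho>)\<^sup>2 * B" using B cd by (intro mult_left_mono) auto
      finally show "integral {c..d} (\<lambda>x. (?u x)\<^sup>2) \<le> (1/\<rho>)\<^sup>2 * B" .
    qed
  next
    assume reg: "regular_left a b q"
    have "\<forall>\<^sub>F x in at_right (real_of_ereal a). x \<in> einterval a b"
      using cut_integrable_left(1,2)[OF reg] ax0(2) unfolding eventually_at_right_field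
      by (intro exI[of _ x0]) (auto simp: einterval_iff intro: less_trans[of _ "ereal x0"], metis less_ereal.simps(1))
    then have "real_bc (at_right (real_of_ereal a)) \<alpha> ?u ?w"
      by (intro real_bc_scaled[OF D(4)[OF reg], of "1/\<rho>"]) (auto elim!: eventually_mono dest: eq)
    then show "?u (real_of_ereal a) * cos \<alpha> + ?w (real_of_ereal a) * sin \<alpha> = 0" using sl_real_bc_left[OF reg] by blast
  next
    assume reg: "regular_right a b q"
    have "\<forall>\<^sub>F x in at_left (real_of_ereal b). x \<in> einterval a b"
      using cut_integrable_right(1,2)[OF reg] ax0(1) unfolding eventually_at_left_field
      by (intro exI[of _ x0]) (auto simp: einterval_iff intro: less_trans[of a "ereal x0"], metis less_ereal.simps(1))
    then have "real_bc (at_left (real_of_ereal b)) \<beta> ?u ?w"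
      by (intro real_bc_scaled[OF D(5)[OF reg], of "1/\<rho>"]) (auto elim!: eventually_mono dest: eq)
    then show "?u (real_of_ereal b) * cos \<beta> + ?w (real_of_ereal b) * sin \<beta> = 0" using sl_real_bc_right[OF reg] by blast
  qed
  with \<theta> show "\<exists>\<theta>\<in>{0..2*pi}. sl_admissible \<alpha> \<beta> (r, cos \<theta>, sin \<theta>)" by (intro bexI[of _ \<theta>]) auto
next
  assume "\<exists>\<theta>\<in>{0..2*pi}. sl_admissible \<alpha> \<beta> (r, cos \<theta>, sin \<theta>)"
  then obtain \<theta> where adm: "sl_admissible \<alpha> \<beta> (r, cos \<theta>, sin \<theta>)" by blast
  let ?z = "(r, cos \<theta>, sin \<theta>)"
  let ?u = "sl_u (cut a b q) x0 ?z" and ?w = "sl_w (cut a b q) x0 ?z"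
  have sol: "is_solution a b (\<lambda>s. q s - r) ?u ?w" using sl_is_solution[of ?z] by simp
  have nz: "\<exists>x\<in>einterval a b. ?u x \<noteq> 0"
  proof (rule ccontr)
    assume "\<not> ?thesis"
    then have 0: "\<And>x. x \<in> einterval a b \<Longrightarrow> ?u x = 0" by blast
    have "(?u has_real_derivative ?w x0) (at x0)" by (rule is_solution_has_derivative[OF sol x0])
    moreover have "(?u has_real_derivative 0) (at x0)"
      by (rule has_field_derivative_transform_within_open[of "\<lambda>_. 0" _ _ "einterval a b"]) (use x0 0 in auto)
    ultimately have "?w x0 = 0" by (rule DERIV_unique)
    then have "sin \<theta> = 0" "cos \<theta> = 0" using 0[OF x0] by (simp_all add: sl_base)
    then show False using sin_cos_squared_add[of \<theta>] by simp
  qed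
  have "real_eigenfunction a b \<alpha> \<beta> q r ?u ?w"
    unfolding real_eigenfunction_def
    using sol nz adm set_integrable_iff_sqint[OF is_solution_continuous(1)[OF sol]] sl_real_bc_left sl_real_bc_right
    by (auto simp: sl_admissible_def)
  then show "r \<in> SL_eigenvalues a b \<alpha> \<beta> q" by (rule real_imp_SL_eigenvalue[OF ax0(3)])
qed

end

text \<open>With x0 fixed, regularity is finiteness of the integral of |q| over a fixed set, and an
  integral of a nonnegative jointly measurable function depends measurably on \<omega>.\<close>

lemma regular_measurable:
  assumes meas: "(\<lambda>(\<omega>, s). cut a b (q \<omega>) s) \<in> borel_measurable (M \<Otimes>\<^sub>M lebesgue)"
    and q: "\<And>\<omega>. \<omega> \<in> space M \<Longrightarrow> locally_L1 a b (q \<omega>)" and x0: "x0 \<in> einterval a b"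
  shows "{\<omega> \<in> space M. regular_left a b (q \<omega>)} \<in> sets M" "{\<omega> \<in> space M. regular_right a b (q \<omega>)} \<in> sets M"
proof -
  have aux: "{\<omega> \<in> space M. set_integrable lebesgue J (q \<omega>)} \<in> sets M" if J: "J \<in> sets lebesgue" "J \<subseteq> einterval a b" for J
  proof -
    have ind: "indicator J \<in> borel_measurable (lebesgue :: real measure)"
      using J(1) by (rule borel_measurable_indicator)
    have m: "(\<lambda>p. indicator J (snd p) * cut a b (q (fst p)) (snd p)) \<in> borel_measurable (M \<Otimes>\<^sub>M lebesgue)"
      using meas by (intro borel_measurable_times measurable_compose[OF measurable_snd ind]) (simp add: case_prod_unfold)
    have eq: "indicator J s *\<^sub>R q \<omega> s = indicator J s * cut a b (q \<omega>) s" for \<omega> s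
      using J(2) by (auto simp: indicator_def cut_def)
    have sec: "(\<lambda>s. indicator J s * cut a b (q \<omega>) s) \<in> borel_measurable lebesgue" if "\<omega> \<in> space M" for \<omega>
      using measurable_compose[OF measurable_Pair1'[OF that, of lebesgue] m] by simp
    have "(\<lambda>\<omega>. \<integral>\<^sup>+ s. ennreal (norm (indicator J s * cut a b (q \<omega>) s)) \<partial>lebesgue) \<in> borel_measurable M"
      using m by (intro sigma_finite_measure.borel_measurable_nn_integral[OF sigma_finite_lebesgue]) (simp add: case_prod_unfold)
    then have "{\<omega> \<in> space M. (\<integral>\<^sup>+ s. ennreal (norm (indicator J s * cut a b (q \<omega>) s)) \<partial>lebesgue) < \<infinity>} \<in> sets M"
      by measurable
    also have "{\<omega> \<in> space M. (\<integral>\<^sup>+ s. ennreal (norm (indicator J s * cut a b (q \<omega>) s)) \<partial>lebesgue) < \<infinity>} =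
        {\<omega> \<in> space M. set_integrable lebesgue J (q \<omega>)}"
      unfolding set_integrable_def eq integrable_iff_bounded using sec by blast
    finally show ?thesis .
  qed
  have sub: "einterval a (ereal x0) \<subseteq> einterval a b" "einterval (ereal x0) b \<subseteq> einterval a b"
    by (rule einterval_mono; use x0 in \<open>auto simp: einterval_iff\<close>)+
  have "{\<omega> \<in> space M. regular_left a b (q \<omega>)} = (if a = -\<infinity> then {} else {\<omega> \<in> space M. set_integrable lebesgue (einterval a (ereal x0)) (q \<omega>)})"
    using regular_left_iff[OF q x0] by auto
  then show "{\<omega> \<in> space M. regular_left a b (q \<omega>)} \<in> sets M" using aux[OF _ sub(1)] by simp
  have "{\<omega> \<in> space M. regular_right a b (q \<omega>)} = (if b = \<infinity> then {} else {\<omega> \<in> space M. set_integrable lebesgue (einterval (ereal x0) b) (q \<omega>)})"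
    using regular_right_iff[OF q x0] by auto
  then show "{\<omega> \<in> space M. regular_right a b (q \<omega>)} \<in> sets M" using aux[OF _ sub(2)] by simp
qed

text \<open>The indices \<open>m = 0, 1\<close> carry the boundary conditions at \<open>a\<close> and \<open>b\<close>; all other \<open>m\<close> bound the
  \<open>L\<^sub>2\<close> norm on \<open>[L m, U m]\<close>.\<close>

definition adm_cond :: "ereal \<Rightarrow> ereal \<Rightarrow> real \<Rightarrow> real \<Rightarrow> real \<Rightarrow> (nat \<Rightarrow> real) \<Rightarrow> (nat \<Rightarrow> real) \<Rightarrow> (real \<Rightarrow> real) \<Rightarrow>
    nat \<Rightarrow> nat \<Rightarrow> real \<times> real \<times> real \<Rightarrow> real" where
  "adm_cond a b \<alpha> \<beta> x0 L U q N m z =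
    (if m = 0 then (if regular_left a b q
        then \<bar>sl_u (cut a b q) x0 z (real_of_ereal a) * cos \<alpha> + sl_w (cut a b q) x0 z (real_of_ereal a) * sin \<alpha>\<bar> else 0)
     else if m = 1 then (if regular_right a b q
        then \<bar>sl_u (cut a b q) x0 z (real_of_ereal b) * cos \<beta> + sl_w (cut a b q) x0 z (real_of_ereal b) * sin \<beta>\<bar> else 0)
     else (LINT x:{L m..U m}|lebesgue. (sl_u (cut a b q) x0 z x)\<^sup>2) - real N)"

text \<open>Every interval [L m, U m] is enlarged to contain x0, where the initial data sit. The
  restriction m \<ge> 2 reflects that \<open>adm_cond\<close> reserves 0 and 1 for the boundary
  conditions.\<close>

lemma einterval_exhaustion:
  assumes x0: "x0 \<in> einterval a b"
  obtains L U :: "nat \<Rightarrow> real" where "\<And>m. a < ereal (L m)" "\<And>m. ereal (U m) < b" "\<And>m. L m \<le> x0" "\<And>m. x0 \<le> U m"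
    "\<And>c d. a < ereal c \<Longrightarrow> ereal d < b \<Longrightarrow> \<exists>m\<ge>2. L m \<le> c \<and> d \<le> U m"
proof -
  have ab: "a < b" using x0 by (auto simp: einterval_iff intro: less_trans)
  obtain l u :: "nat \<Rightarrow> real" where ul: "einterval a b = (\<Union>i. {l i .. u i})"
    "incseq u" "decseq l" "\<And>i. l i < u i" "\<And>i. a < ereal (l i)" "\<And>i. ereal (u i) < b"
    by (rule einterval_Icc_approximation[OF ab]) (rule that; assumption)
  show ?thesis
  proof (rule that[of "\<lambda>m. min (l m) x0" "\<lambda>m. max (u m) x0"])
    fix c d assume cd: "a < ereal c" "ereal d < b"
    have "min c x0 \<in> einterval a b" "max d x0 \<in> einterval a b"
    proof -
      have xx: "a < ereal x0" "ereal x0 < b" using x0 by (auto simp: einterval_iff)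
      have "ereal (min c x0) \<le> ereal x0" "ereal x0 \<le> ereal (max d x0)" by simp_all
      then have "ereal (min c x0) < b" "a < ereal (max d x0)"
        using xx le_less_trans less_le_trans by blast+
      then show "min c x0 \<in> einterval a b" "max d x0 \<in> einterval a b"
        using cd xx by (auto simp: einterval_iff min_def max_def)
    qed
    then have "\<exists>i. min c x0 \<in> {l i..u i}" "\<exists>i. max d x0 \<in> {l i..u i}" using ul(1) by auto
    then obtain i j where ij: "l i \<le> min c x0" "max d x0 \<le> u j" by auto
    define m where "m = max 2 (max i j)"
    have "l m \<le> l i" "u j \<le> u m" using ul(2,3) by (auto simp: incseq_def decseq_def m_def)
    then show "\<exists>m\<ge>2. min (l m) x0 \<le> c \<and> d \<le> max (u m) x0"
      using ij by (intro exI[of _ m]) (auto simp: m_def)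
  qed (use ul(5,6) x0 in \<open>auto simp: einterval_iff min_def max_def\<close>)
qed

lemma adm_cond_measurable:
  assumes meas: "(\<lambda>(\<omega>, s). cut a b (q \<omega>) s) \<in> borel_measurable (M \<Otimes>\<^sub>M lebesgue)"
    and q: "\<And>\<omega>. \<omega> \<in> space M \<Longrightarrow> locally_L1 a b (q \<omega>)" and x0: "x0 \<in> einterval a b"
  shows "(\<lambda>\<omega>. adm_cond a b \<alpha> \<beta> x0 L U (q \<omega>) N m z) \<in> borel_measurable M"
proof -
  note [measurable] = sl_measurable[OF meas]
  note reg = regular_measurable[OF meas q x0]
  consider "m = 0" | "m = 1" | "m \<noteq> 0" "m \<noteq> 1" by blast
  then show ?thesis
  proof cases
    case 1
    show ?thesis unfolding adm_cond_def 1 simp_thms if_True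
      by (rule measurable_If[OF _ _ reg(1)]) measurable
  next
    case 2
    have "(1::nat) = 0 \<longleftrightarrow> False" by simp
    then show ?thesis unfolding adm_cond_def 2 simp_thms if_True if_False
      by (simp only: if_False) (rule measurable_If[OF _ _ reg(2)]; measurable)
  next
    case 3
    then show ?thesis unfolding adm_cond_def by simp
  qed
qed

lemma adm_cond_continuous:
  assumes q: "locally_L1 a b q" and x0: "x0 \<in> einterval a b"
    and LU: "a < ereal (L m)" "ereal (U m) < b" "L m \<le> x0" "x0 \<le> U m"
  shows "continuous_on UNIV (adm_cond a b \<alpha> \<beta> x0 L U q N m)"
proof -
  consider "m = 0" "regular_left a b q" | "m = 1" "regular_right a b q" | "m \<noteq> 0" "m \<noteq> 1"
    | "m = 0" "\<not> regular_left a b q" | "m = 1" "\<not> regular_right a b q" by blast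
  then show ?thesis
  proof cases
    case 1
    note ci = cut_integrable_left[OF q x0 1(2)]
    have "cut a b q absolutely_integrable_on closed_segment x0 (real_of_ereal a)"
      using ci(2,3) by (simp add: closed_segment_eq_real_ivl)
    then show ?thesis using 1 unfolding adm_cond_def
      by (auto intro!: continuous_intros sl_continuous)
  next
    case 2
    note ci = cut_integrable_right[OF q x0 2(2)]
    have "cut a b q absolutely_integrable_on closed_segment x0 (real_of_ereal b)"
      using ci(2,3) by (simp add: closed_segment_eq_real_ivl)
    then show ?thesis using 2 unfolding adm_cond_def
      by (auto intro!: continuous_intros sl_continuous)
  next
    case 3
    have "continuous_on UNIV (\<lambda>z. LINT x:{L m..U m}|lebesgue. (sl_u (cut a b q) x0 z x)\<^sup>2)"
      by (rule sl_square_integral_continuous[OF cut_integrable[OF q x0 LU(1,2)] LU(3,4)])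
    then show ?thesis using 3 unfolding adm_cond_def by (auto intro!: continuous_intros)
  qed (simp_all add: adm_cond_def)
qed

text \<open>The number N enters only as an upper bound for the square integrals, so a valid N may be
  increased. Requiring the conditions for all large N lets one N serve two operators.\<close>

lemma adm_cond_iff:
  assumes q: "locally_L1 a b q" and x0: "x0 \<in> einterval a b"
    and LU: "\<And>m. a < ereal (L m)" "\<And>m. ereal (U m) < b" "\<And>m. L m \<le> x0" "\<And>m. x0 \<le> U m"
    and ex: "\<And>c d. a < ereal c \<Longrightarrow> ereal d < b \<Longrightarrow> \<exists>m\<ge>2. L m \<le> c \<and> d \<le> U m"
  shows "sl_admissible a b q x0 \<alpha> \<beta> z \<longleftrightarrow> (\<exists>N0. \<forall>N\<ge>N0. \<forall>m. adm_cond a b \<alpha> \<beta> x0 L U q N m z \<le> 0)"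
proof -
  let ?u = "sl_u (cut a b q) x0 z"
  have cont: "continuous_on (einterval a b) ?u"
    using is_solution_continuous(1)[OF sl_is_solution[OF q x0]] .
  have LI: "(LINT x:{L m..U m}|lebesgue. (?u x)\<^sup>2) = integral {L m..U m} (\<lambda>x. (?u x)\<^sup>2)" for m
    by (rule set_lebesgue_integral_eq_integral(2)[OF square_integrable_Icc(1)[OF cont LU(1,2)]])
  have sq: "sqint a b ?u \<longleftrightarrow> (\<exists>N0. \<forall>N\<ge>N0. \<forall>m\<ge>2. integral {L m..U m} (\<lambda>x. (?u x)\<^sup>2) \<le> real N)"
  proof
    assume "sqint a b ?u"
    then obtain B where B: "\<And>c d. a < ereal c \<Longrightarrow> c \<le> d \<Longrightarrow> ereal d < b \<Longrightarrow> integral {c..d} (\<lambda>x. (?u x)\<^sup>2) \<le> B"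
      unfolding sqint_def by blast
    obtain N0 where N0: "B \<le> real N0" using real_arch_simple by blast
    have "integral {L m..U m} (\<lambda>x. (?u x)\<^sup>2) \<le> real N" if "N0 \<le> N" for N m
      using B[OF LU(1) order_trans[OF LU(3) LU(4)] LU(2), of m] N0 that by (meson of_nat_le_iff order_trans)
    then show "\<exists>N0. \<forall>N\<ge>N0. \<forall>m\<ge>2. integral {L m..U m} (\<lambda>x. (?u x)\<^sup>2) \<le> real N" by blast
  next
    assume "\<exists>N0. \<forall>N\<ge>N0. \<forall>m\<ge>2. integral {L m..U m} (\<lambda>x. (?u x)\<^sup>2) \<le> real N"
    then obtain N where N: "\<And>m. m \<ge> 2 \<Longrightarrow> integral {L m..U m} (\<lambda>x. (?u x)\<^sup>2) \<le> real N" by blast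
    show "sqint a b ?u" unfolding sqint_def
    proof (intro exI allI impI)
      fix c d assume cd: "a < ereal c \<and> c \<le> d \<and> ereal d < b"
      then obtain m where m: "m \<ge> 2" "L m \<le> c" "d \<le> U m" using ex by blast
      have "integral {c..d} (\<lambda>x. (?u x)\<^sup>2) \<le> integral {L m..U m} (\<lambda>x. (?u x)\<^sup>2)"
        by (rule integral_subset_le) (use m cd square_integrable_Icc(2)[OF cont] LU in auto)
      then show "integral {c..d} (\<lambda>x. (?u x)\<^sup>2) \<le> real N" using N[OF m(1)] by simp
    qed
  qed
  have split: "(\<forall>m. P m) \<longleftrightarrow> P 0 \<and> P 1 \<and> (\<forall>m\<ge>2. P m)" for P :: "nat \<Rightarrow> bool"
  proof
    assume R: "P 0 \<and> P 1 \<and> (\<forall>m\<ge>2. P m)"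
    show "\<forall>m. P m"
    proof
      fix m :: nat
      consider "m = 0" | "m = 1" | "m \<ge> 2" by linarith
      then show "P m" using R by cases auto
    qed
  qed auto
  show ?thesis
    unfolding sl_admissible_def[OF q x0] sq split[of "\<lambda>m. adm_cond a b \<alpha> \<beta> x0 L U q _ m z \<le> 0"]
    by (auto simp: adm_cond_def LI)
qed

text \<open>The two operators share r but have separate angles, so the parameter is (r, \<theta>,
  \<theta>') in the compact set \<open>K N\<close>, and a maximum merges both families of conditions
  into one. N bounds |r| and the square integrals of both solutions at once; a common eigenvalue is
  found for all large N.\<close>

theorem common_eigenvalue_event_measurable:
  fixes q :: "'w \<Rightarrow> real \<Rightarrow> real"
  assumes meas: "(\<lambda>(\<omega>, s). cut a b (q \<omega>) s) \<in> borel_measurable (M \<Otimes>\<^sub>M lebesgue)"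
    "(\<lambda>(\<omega>, s). cut a' b' (q \<omega>) s) \<in> borel_measurable (M \<Otimes>\<^sub>M lebesgue)"
    and q: "\<And>\<omega>. \<omega> \<in> space M \<Longrightarrow> locally_L1 a b (q \<omega>)" "\<And>\<omega>. \<omega> \<in> space M \<Longrightarrow> locally_L1 a' b' (q \<omega>)"
    and x0: "x0 \<in> einterval a b" "x0 \<in> einterval a' b'"
  shows "{\<omega> \<in> space M. SL_eigenvalues a' b' \<alpha>' \<beta>' (q \<omega>) \<inter> SL_eigenvalues a b \<alpha> \<beta> (q \<omega>) \<noteq> {}} \<in> sets M"
proof -
  obtain L U :: "nat \<Rightarrow> real" where LU: "\<And>m. a < ereal (L m)" "\<And>m. ereal (U m) < b" "\<And>m. L m \<le> x0" "\<And>m. x0 \<le> U m"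
    "\<And>c d. a < ereal c \<Longrightarrow> ereal d < b \<Longrightarrow> \<exists>m\<ge>2. L m \<le> c \<and> d \<le> U m"
    using einterval_exhaustion[OF x0(1)] by blast
  obtain L' U' :: "nat \<Rightarrow> real" where LU': "\<And>m. a' < ereal (L' m)" "\<And>m. ereal (U' m) < b'" "\<And>m. L' m \<le> x0" "\<And>m. x0 \<le> U' m"
    "\<And>c d. a' < ereal c \<Longrightarrow> ereal d < b' \<Longrightarrow> \<exists>m\<ge>2. L' m \<le> c \<and> d \<le> U' m"
    using einterval_exhaustion[OF x0(2)] by blast
  define G where "G N m \<omega> p = adm_cond a b \<alpha> \<beta> x0 L U (q \<omega>) N m (fst p, cos (fst (snd p)), sin (fst (snd p)))"
    for N m \<omega> and p :: "real \<times> real \<times> real"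
  define G' where "G' N m \<omega> p = adm_cond a' b' \<alpha>' \<beta>' x0 L' U' (q \<omega>) N m (fst p, cos (snd (snd p)), sin (snd (snd p)))"
    for N m \<omega> and p :: "real \<times> real \<times> real"
  define K where "K N = {- real N..real N} \<times> {0..2*pi} \<times> {0..2*pi}" for N :: nat
  define E where "E N = {\<omega> \<in> space M. \<exists>p\<in>K N. \<forall>m. max (G N m \<omega> p) (G' N m \<omega> p) \<le> 0}" for N
  have "E N \<in> sets M" for N
    unfolding E_def
  proof (rule measurable_exists_compact)
    show "compact (K N)" unfolding K_def by (intro compact_Times compact_Icc)
    fix m :: nat
    show "continuous_on (K N) (\<lambda>p. max (G N m \<omega> p) (G' N m \<omega> p))" if \<omega>: "\<omega> \<in> space M" for \<omega>
      unfolding G_def G'_def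
      by (intro continuous_intros continuous_on_compose2[OF adm_cond_continuous[OF q(1)[OF \<omega>] x0(1) LU(1-4)]]
          continuous_on_compose2[OF adm_cond_continuous[OF q(2)[OF \<omega>] x0(2) LU'(1-4)]]) auto
    show "(\<lambda>\<omega>. max (G N m \<omega> p) (G' N m \<omega> p)) \<in> borel_measurable M" for p
      unfolding G_def G'_def
      by (intro borel_measurable_max adm_cond_measurable[OF meas(1) q(1) x0(1)] adm_cond_measurable[OF meas(2) q(2) x0(2)])
  qed
  moreover have "{\<omega> \<in> space M. SL_eigenvalues a' b' \<alpha>' \<beta>' (q \<omega>) \<inter> SL_eigenvalues a b \<alpha> \<beta> (q \<omega>) \<noteq> {}} = (\<Union>N. \<Inter>N'\<in>{N..}. E N')"
  proof (intro equalityI subsetI)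
    fix \<omega> assume "\<omega> \<in> {\<omega> \<in> space M. SL_eigenvalues a' b' \<alpha>' \<beta>' (q \<omega>) \<inter> SL_eigenvalues a b \<alpha> \<beta> (q \<omega>) \<noteq> {}}"
    then obtain r where \<omega>: "\<omega> \<in> space M" and r: "r \<in> SL_eigenvalues a' b' \<alpha>' \<beta>' (q \<omega>)" "r \<in> SL_eigenvalues a b \<alpha> \<beta> (q \<omega>)" by blast
    obtain \<theta> where \<theta>: "\<theta> \<in> {0..2*pi}" "sl_admissible a b (q \<omega>) x0 \<alpha> \<beta> (r, cos \<theta>, sin \<theta>)"
      using r(2) SL_eigenvalue_iff_sl[OF q(1)[OF \<omega>] x0(1)] by blast
    obtain \<theta>' where \<theta>': "\<theta>' \<in> {0..2*pi}" "sl_admissible a' b' (q \<omega>) x0 \<alpha>' \<beta>' (r, cos \<theta>', sin \<theta>')"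
      using r(1) SL_eigenvalue_iff_sl[OF q(2)[OF \<omega>] x0(2)] by blast
    obtain N1 where N1: "\<And>N m. N1 \<le> N \<Longrightarrow> adm_cond a b \<alpha> \<beta> x0 L U (q \<omega>) N m (r, cos \<theta>, sin \<theta>) \<le> 0"
      using \<theta>(2) adm_cond_iff[OF q(1)[OF \<omega>] x0(1) LU] by blast
    obtain N2 where N2: "\<And>N m. N2 \<le> N \<Longrightarrow> adm_cond a' b' \<alpha>' \<beta>' x0 L' U' (q \<omega>) N m (r, cos \<theta>', sin \<theta>') \<le> 0"
      using \<theta>'(2) adm_cond_iff[OF q(2)[OF \<omega>] x0(2) LU'] by blast
    obtain N3 where N3: "\<bar>r\<bar> \<le> real N3" using real_arch_simple by blast
    have "\<omega> \<in> E N" if N: "max N1 (max N2 N3) \<le> N" for N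
    proof -
      have "\<bar>r\<bar> \<le> real N" using N3 N by (meson max.bounded_iff of_nat_le_iff order_trans)
      then have "(r, \<theta>, \<theta>') \<in> K N" using \<theta>(1) \<theta>'(1) by (auto simp: K_def)
      moreover have "max (G N m \<omega> (r, \<theta>, \<theta>')) (G' N m \<omega> (r, \<theta>, \<theta>')) \<le> 0" for m
        using N1[of N m] N2[of N m] N by (simp add: G_def G'_def)
      ultimately show ?thesis unfolding E_def using \<omega> by blast
    qed
    then show "\<omega> \<in> (\<Union>N. \<Inter>N'\<in>{N..}. E N')" by blast
  next
    fix \<omega> assume "\<omega> \<in> (\<Union>N. \<Inter>N'\<in>{N..}. E N')"
    then obtain N where N: "\<And>N'. N \<le> N' \<Longrightarrow> \<omega> \<in> E N'" by auto
    have \<omega>: "\<omega> \<in> space M" using N[of N] by (simp add: E_def)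
    obtain p where p: "p \<in> K N" "\<And>m. max (G N m \<omega> p) (G' N m \<omega> p) \<le> 0" using N[of N] by (auto simp: E_def)
    obtain r \<theta> \<theta>' where pr: "p = (r, \<theta>, \<theta>')" by (cases p) auto
    have \<theta>: "\<theta> \<in> {0..2*pi}" "\<theta>' \<in> {0..2*pi}" using p(1) by (auto simp: K_def pr)
    have mono: "adm_cond a b \<alpha> \<beta> x0 L U q N' m z \<le> adm_cond a b \<alpha> \<beta> x0 L U q N m z" if "N \<le> N'"
      for a b \<alpha> \<beta> L U q N' m z using that by (simp add: adm_cond_def)
    have "\<forall>N'\<ge>N. \<forall>m. adm_cond a b \<alpha> \<beta> x0 L U (q \<omega>) N' m (r, cos \<theta>, sin \<theta>) \<le> 0"
      using p(2) by (auto simp: G_def pr intro: order_trans[OF mono])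
    then have "sl_admissible a b (q \<omega>) x0 \<alpha> \<beta> (r, cos \<theta>, sin \<theta>)"
      using adm_cond_iff[OF q(1)[OF \<omega>] x0(1) LU] by blast
    then have 1: "r \<in> SL_eigenvalues a b \<alpha> \<beta> (q \<omega>)"
      using SL_eigenvalue_iff_sl[OF q(1)[OF \<omega>] x0(1)] \<theta>(1) by blast
    have "\<forall>N'\<ge>N. \<forall>m. adm_cond a' b' \<alpha>' \<beta>' x0 L' U' (q \<omega>) N' m (r, cos \<theta>', sin \<theta>') \<le> 0"
      using p(2) by (auto simp: G'_def pr intro: order_trans[OF mono])
    then have "sl_admissible a' b' (q \<omega>) x0 \<alpha>' \<beta>' (r, cos \<theta>', sin \<theta>')"
      using adm_cond_iff[OF q(2)[OF \<omega>] x0(2) LU'] by blast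
    then have "r \<in> SL_eigenvalues a' b' \<alpha>' \<beta>' (q \<omega>)"
      using SL_eigenvalue_iff_sl[OF q(2)[OF \<omega>] x0(2)] \<theta>(2) by blast
    with 1 \<omega> show "\<omega> \<in> {\<omega> \<in> space M. SL_eigenvalues a' b' \<alpha>' \<beta>' (q \<omega>) \<inter> SL_eigenvalues a b \<alpha> \<beta> (q \<omega>) \<noteq> {}}" by blast
  qed
  ultimately show ?thesis by (auto intro!: sets.countable_UN sets.countable_INT'')
qed

section \<open>The random potential\<close>

text \<open>The infinite sum is the pointwise limit of its partial sums over \<open>B m\<close>,
  each a finite sum of a coordinate of \<omega> times a function of x. Outside the interval, where
  summability is not assumed, \<open>cut\<close> makes everything 0.\<close>

lemma cut_random_potential_measurable:
  fixes I :: "int set" and p :: "int \<Rightarrow> real measure"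
  assumes p: "\<And>n. n \<in> I \<Longrightarrow> sets (p n) = sets borel"
    and v: "locally_L1 a b v" and f: "\<And>n. n \<in> I \<Longrightarrow> locally_L1 a b (f n)"
    and summable: "\<And>\<omega> x. \<omega> \<in> space (Pi\<^sub>M I p) \<Longrightarrow> x \<in> einterval a b \<Longrightarrow> (\<lambda>n. \<omega> n * f n x) summable_on I"
  shows "(\<lambda>(\<omega>, x). cut a b (random_potential I v f \<omega>) x) \<in> borel_measurable (Pi\<^sub>M I p \<Otimes>\<^sub>M lebesgue)"
proof -
  let ?M = "Pi\<^sub>M I p \<Otimes>\<^sub>M (lebesgue :: real measure)"
  define B where "B m = I \<inter> {-int m..int m}" for m
  have B: "finite (B m)" "B m \<subseteq> I" for m by (auto simp: B_def)
  define S where "S m z = indicator (einterval a b) (snd z) * v (snd z) +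
      (\<Sum>n\<in>B m. fst z n * (indicator (einterval a b) (snd z) * f n (snd z)))" for m and z :: "(int \<Rightarrow> real) \<times> real"
  have S_meas: "S m \<in> borel_measurable ?M" for m
  proof -
    have "(\<lambda>x. indicator (einterval a b) x * v x) \<in> borel_measurable lebesgue"
      using v by (simp add: locally_L1_def set_borel_measurable_def)
    then have 1: "(\<lambda>z. indicator (einterval a b) (snd z) * v (snd z)) \<in> borel_measurable ?M"
      by (rule measurable_compose[OF measurable_snd])
    have 2: "(\<lambda>z. fst z n * (indicator (einterval a b) (snd z) * f n (snd z))) \<in> borel_measurable ?M" if n: "n \<in> I" for n
    proof -
      have "(\<lambda>x. indicator (einterval a b) x * f n x) \<in> borel_measurable lebesgue"
        using f[OF n] by (simp add: locally_L1_def set_borel_measurable_def)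
      then have 3: "(\<lambda>z. indicator (einterval a b) (snd z) * f n (snd z)) \<in> borel_measurable ?M"
        by (rule measurable_compose[OF measurable_snd])
      have "(\<lambda>\<omega>. \<omega> n) \<in> measurable (Pi\<^sub>M I p) (p n)" by (rule measurable_component_singleton[OF n])
      then have "(\<lambda>\<omega>. \<omega> n) \<in> borel_measurable (Pi\<^sub>M I p)" by (simp cong: measurable_cong_sets add: p[OF n])
      then have "(\<lambda>z. fst z n) \<in> borel_measurable ?M" by (rule measurable_compose[OF measurable_fst])
      from borel_measurable_times[OF this 3] show ?thesis .
    qed
    show ?thesis unfolding S_def
      by (rule borel_measurable_add[OF 1 borel_measurable_sum[OF 2]]) (use B(2) in auto)
  qed
  \<comment> \<open>Every finite subset of I is eventually contained in \<open>B m\<close>, so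
    unordered summation implies convergence along this sequence.\<close>
  have filt: "filterlim B (finite_subsets_at_top I) sequentially"
    unfolding filterlim_finite_subsets_at_top
  proof (intro allI impI)
    fix X assume X: "finite X \<and> X \<subseteq> I"
    define k where "k = nat (Max (insert 0 (abs ` X)))"
    have "x \<in> {-int m..int m}" if "x \<in> X" "k \<le> m" for x m
    proof -
      have "\<bar>x\<bar> \<le> Max (insert 0 (abs ` X))" using X that by (intro Max_ge) auto
      then show ?thesis using that(2) by (auto simp: k_def)
    qed
    then have "finite (B m) \<and> X \<subseteq> B m \<and> B m \<subseteq> I" if "k \<le> m" for m
      using X B that unfolding B_def by blast
    then show "\<forall>\<^sub>F m in sequentially. finite (B m) \<and> X \<subseteq> B m \<and> B m \<subseteq> I"
      unfolding eventually_sequentially by blast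
  qed
  have lim: "(\<lambda>m. S m z) \<longlonglongrightarrow> (case z of (\<omega>, x) \<Rightarrow> cut a b (random_potential I v f \<omega>) x)" if zM: "z \<in> space ?M" for z
  proof -
    obtain \<omega> x where z: "z = (\<omega>, x)" "\<omega> \<in> space (Pi\<^sub>M I p)" using zM by (cases z) (auto simp: space_pair_measure)
    show ?thesis
    proof (cases "x \<in> einterval a b")
      case True
      have "((\<lambda>n. \<omega> n * f n x) has_sum (\<Sum>\<^sub>\<infinity>n\<in>I. \<omega> n * f n x)) I"
        by (rule has_sum_infsum[OF summable[OF z(2) True]])
      then have "(\<lambda>m. \<Sum>n\<in>B m. \<omega> n * f n x) \<longlonglongrightarrow> (\<Sum>\<^sub>\<infinity>n\<in>I. \<omega> n * f n x)"
        unfolding has_sum_def by (rule filterlim_compose[OF _ filt])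
      then have "(\<lambda>m. v x + (\<Sum>n\<in>B m. \<omega> n * f n x)) \<longlonglongrightarrow> v x + (\<Sum>\<^sub>\<infinity>n\<in>I. \<omega> n * f n x)"
        by (intro tendsto_intros)
      then show ?thesis using True by (simp add: z(1) S_def cut_def random_potential_def)
    qed (simp add: z(1) S_def cut_def)
  qed
  show ?thesis by (rule borel_measurable_LIMSEQ_real[OF lim S_meas])
qed

lemma random_potential_fun_upd:
  assumes j: "j \<in> I" and x: "(\<lambda>n. (X(j := t)) n * f n x) summable_on I" "(\<lambda>n. (X(j := s)) n * f n x) summable_on I"
  shows "random_potential I v f (X(j := t)) x - random_potential I v f (X(j := s)) x = (t - s) * f j x"
proof -
  have "((\<lambda>n. (X(j := s)) n * f n x) has_sum (\<Sum>\<^sub>\<infinity>n\<in>I. (X(j := s)) n * f n x)) I"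
    by (rule has_sum_infsum[OF x(2)])
  moreover have "((\<lambda>n. if n = j then (t - s) * f j x else 0) has_sum ((t - s) * f j x)) I"
    by (rule has_sum_finite_neutralI[of "{j}"]) (use j in auto)
  ultimately have "((\<lambda>n. (X(j := s)) n * f n x + (if n = j then (t - s) * f j x else 0)) has_sum
      (\<Sum>\<^sub>\<infinity>n\<in>I. (X(j := s)) n * f n x) + (t - s) * f j x) I"
    by (rule has_sum_add)
  moreover have "(\<lambda>n. (X(j := s)) n * f n x + (if n = j then (t - s) * f j x else 0)) = (\<lambda>n. (X(j := t)) n * f n x)"
    by (auto simp: algebra_simps)
  ultimately have "(\<Sum>\<^sub>\<infinity>n\<in>I. (X(j := t)) n * f n x) = (\<Sum>\<^sub>\<infinity>n\<in>I. (X(j := s)) n * f n x) + (t - s) * f j x"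
    by (intro infsumI) simp
  then show ?thesis by (simp add: random_potential_def)
qed

text \<open>Neither the integrated equation nor the regularity of the endpoints looks at q outside
  the interval; passing through real eigenfunctions avoids a comparison of the operator
  domains.\<close>

lemma SL_eigenvalues_cong:
  assumes ab: "a < b" and eq: "\<And>x. x \<in> einterval a b \<Longrightarrow> q x = q' x"
  shows "SL_eigenvalues a b \<alpha> \<beta> q = SL_eigenvalues a b \<alpha> \<beta> q'"
proof -
  have 1: "r \<in> SL_eigenvalues a b \<alpha> \<beta> q'" if r: "r \<in> SL_eigenvalues a b \<alpha> \<beta> q"
    and eq: "\<And>x. x \<in> einterval a b \<Longrightarrow> q x = q' x" for r and q q' :: "real \<Rightarrow> real"
  proof -
    obtain u w where ef: "real_eigenfunction a b \<alpha> \<beta> q r u w" using SL_eigenvalue_imp_real[OF r] by blast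
    have "is_solution a b (\<lambda>s. q' s - r) u w"
      by (rule is_solution_cong[of a b "\<lambda>s. q s - r"]) (use ef eq in \<open>auto simp: real_eigenfunction_def\<close>)
    moreover have "regular_left a b q' \<Longrightarrow> regular_left a b q" "regular_right a b q' \<Longrightarrow> regular_right a b q"
      using regular_left_cong[of a b q' q] regular_right_cong[of a b q' q] eq by auto
    ultimately have "real_eigenfunction a b \<alpha> \<beta> q' r u w"
      using ef by (auto simp: real_eigenfunction_def)
    then show ?thesis by (rule real_imp_SL_eigenvalue[OF ab])
  qed
  show ?thesis using 1[of _ q q'] 1[of _ q' q] eq by fastforce
qed

section \<open>Endpoints of the smaller interval\<close>

lemma locally_L1_sub:
  assumes "locally_L1 a b q" "a \<le> a'" "b' \<le> b"
  shows "locally_L1 a' b' q"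
  unfolding locally_L1_def
proof (intro conjI allI impI)
  have "(\<lambda>x. indicator (einterval a b) x *\<^sub>R q x) \<in> borel_measurable lebesgue"
    using assms(1) by (simp add: locally_L1_def set_borel_measurable_def)
  moreover have "indicator (einterval a' b') \<in> borel_measurable (lebesgue :: real measure)"
    by (rule borel_measurable_indicator) simp
  ultimately have "(\<lambda>x. indicator (einterval a' b') x * (indicator (einterval a b) x *\<^sub>R q x)) \<in> borel_measurable lebesgue"
    by (intro borel_measurable_times)
  moreover have "(\<lambda>x. indicator (einterval a' b') x * (indicator (einterval a b) x *\<^sub>R q x)) = (\<lambda>x. indicator (einterval a' b') x *\<^sub>R q x)"
    by (rule ext) (use einterval_mono[OF assms(2,3)] in \<open>auto simp: indicator_def\<close>)
  ultimately show "set_borel_measurable lebesgue (einterval a' b') q" by (simp add: set_borel_measurable_def)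
  fix c d assume "a' < ereal c \<and> c \<le> d \<and> ereal d < b'"
  then show "set_integrable lebesgue {c..d} q"
    using assms by (intro locally_L1_Icc[OF assms(1)]) (auto intro: le_less_trans less_le_trans)
qed

text \<open>If a < a', then a' is an interior point of (a, b), so q is integrable up to it and a' is
  regular. If a = a', the classification is inherited.\<close>

lemma endpoint_left_sub:
  assumes q: "locally_L1 a b q" and "regular_left a b q \<or> limit_point_left a b q"
    and sub: "a \<le> a'" "a' < b'" "b' \<le> b"
  shows "regular_left a' b' q \<or> limit_point_left a' b' q"
proof (cases "a = a'")
  case True
  then show ?thesis using assms(2) regular_left_sub[OF _ _ sub(3)] limit_point_left_sub[OF _ sub(3)] sub(2) by blast
next
  case False
  then have "a < a'" using sub(1) by simp
  then obtain a0 where a0: "a' = ereal a0" using sub(2) by (cases a') auto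
  obtain c where c: "a' < ereal c" "ereal c < b'" using ereal_dense2[OF sub(2)] by blast
  have "q absolutely_integrable_on {a0..c}"
    by (rule locally_L1_Icc[OF q]) (use \<open>a < a'\<close> a0 c(2) sub(3) in \<open>auto intro: less_le_trans\<close>)
  then have "set_integrable lebesgue (einterval a' (ereal c)) q"
    by (rule set_integrable_subset) (auto simp: a0)
  then show ?thesis using c a0 by (auto simp: regular_left_def einterval_iff)
qed

lemma endpoint_right_sub:
  assumes q: "locally_L1 a b q" and "regular_right a b q \<or> limit_point_right a b q"
    and sub: "a \<le> a'" "a' < b'" "b' \<le> b"
  shows "regular_right a' b' q \<or> limit_point_right a' b' q"
proof (cases "b = b'")
  case True
  then show ?thesis using assms(2) regular_right_sub[OF _ _ sub(1)] limit_point_right_sub[OF _ sub(1)] sub(2) by blast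
next
  case False
  then have "b' < b" using sub(3) by simp
  then obtain b0 where b0: "b' = ereal b0" using sub(2) by (cases b') auto
  obtain c where c: "a' < ereal c" "ereal c < b'" using ereal_dense2[OF sub(2)] by blast
  have "q absolutely_integrable_on {c..b0}"
    by (rule locally_L1_Icc[OF q]) (use \<open>b' < b\<close> b0 c(1) sub(1) in \<open>auto intro: le_less_trans\<close>)
  then have "set_integrable lebesgue (einterval (ereal c) b') q"
    by (rule set_integrable_subset) (auto simp: b0)
  then show ?thesis using c b0 by (auto simp: regular_right_def einterval_iff)
qed

section \<open>Null events of a product measure\<close>

lemma countable_null_set:
  assumes M: "prob_space M" "sets M = sets borel" and atom: "\<And>r::real. measure M {r} = 0" and A: "countable A"
  shows "A \<in> null_sets M"
proof -
  interpret prob_space M by fact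
  have "{r} \<in> null_sets M" for r
    using atom[of r] M(2) by (auto simp: null_sets_def emeasure_eq_measure)
  then have "(\<Union>r\<in>A. {r}) \<in> null_sets M" using A by (intro null_sets_UN') auto
  then show ?thesis by simp
qed

text \<open>The product measure is the image of \<open>p j\<close> times the product over the other
  coordinates under the map that inserts coordinate j. The measure of E is then the integral of the
  measures of its sections, each of which is 0 because the section is countable and
  \<open>p j\<close> has no atoms.\<close>

lemma null_sets_PiM_coordinate:
  fixes p :: "'i \<Rightarrow> real measure"
  assumes p: "\<And>n. n \<in> I \<Longrightarrow> prob_space (p n)" and j: "j \<in> I" "sets (p j) = sets borel" "\<And>r. measure (p j) {r} = 0"
    and E: "E \<in> sets (Pi\<^sub>M I p)"
    and sec: "\<And>X. X \<in> space (Pi\<^sub>M (I - {j}) p) \<Longrightarrow> countable {t. X(j := t) \<in> E}"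
  shows "E \<in> null_sets (Pi\<^sub>M I p)"
proof -
  define J where "J = I - {j}"
  have IJ: "insert j J = I" using j(1) by (auto simp: J_def)
  have pJ: "\<And>n. n \<in> J \<Longrightarrow> prob_space (p n)" using p by (auto simp: J_def)
  interpret pj: prob_space "p j" using p j(1) by blast
  interpret PJ: prob_space "Pi\<^sub>M J p" by (rule prob_space_PiM) (rule pJ)
  interpret PP: pair_sigma_finite "p j" "Pi\<^sub>M J p" ..
  let ?h = "\<lambda>(x, X). X(j := x)"
  have h: "?h \<in> measurable (p j \<Otimes>\<^sub>M Pi\<^sub>M J p) (Pi\<^sub>M I p)"
    unfolding IJ[symmetric] by measurable
  have distr: "distr (p j \<Otimes>\<^sub>M Pi\<^sub>M J p) (Pi\<^sub>M I p) ?h = Pi\<^sub>M I p"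
    using distr_pair_PiM_eq_PiM[of J p j] pJ p[OF j(1)] unfolding IJ by blast
  let ?A = "?h -` E \<inter> space (p j \<Otimes>\<^sub>M Pi\<^sub>M J p)"
  have A: "?A \<in> sets (p j \<Otimes>\<^sub>M Pi\<^sub>M J p)" using h E by (rule measurable_sets)
  have "emeasure (Pi\<^sub>M I p) E = emeasure (p j \<Otimes>\<^sub>M Pi\<^sub>M J p) ?A"
    by (subst distr[symmetric]) (rule emeasure_distr[OF h E])
  also have "\<dots> = (\<integral>\<^sup>+X. emeasure (p j) ((\<lambda>x. (x, X)) -` ?A) \<partial>Pi\<^sub>M J p)"
    by (rule PP.emeasure_pair_measure_alt2[OF A])
  also have "\<dots> = (\<integral>\<^sup>+X. 0 \<partial>Pi\<^sub>M J p)"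
  proof (rule nn_integral_cong)
    fix X assume X: "X \<in> space (Pi\<^sub>M J p)"
    have "(\<lambda>x. (x, X)) -` ?A \<subseteq> {t. X(j := t) \<in> E}" by auto
    then have "countable ((\<lambda>x. (x, X)) -` ?A)"
      by (rule countable_subset) (use sec[of X] X in \<open>simp add: J_def\<close>)
    then show "emeasure (p j) ((\<lambda>x. (x, X)) -` ?A) = 0"
      using countable_null_set[OF p[OF j(1)] j(2,3)] by blast
  qed
  finally show ?thesis using E by (simp add: null_sets_def)
qed

theorem mainTheorem3:
  fixes a b a' b' :: ereal
    and n1 n2 :: "int extended"
    and I :: "int set"
    and p :: "int \<Rightarrow> real measure"
    and v :: "real \<Rightarrow> real"
    and f :: "int \<Rightarrow> real \<Rightarrow> real"
    and q :: "(int \<Rightarrow> real) \<Rightarrow> real \<Rightarrow> real"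
    and \<alpha> \<beta> \<alpha>' \<beta>' :: real
    and idx :: "nat \<Rightarrow> int"
    and c d :: "nat \<Rightarrow> real"
  assumes "a < b"
    and "n1 < n2"
    and I_eq: "I = index_set n1 n2"
    and "\<And>n. n \<in> I \<Longrightarrow> prob_space (p n)"
    and "\<And>n. n \<in> I \<Longrightarrow> sets (p n) = sets borel"
    and "locally_L1 a b v"
    and "\<And>n. n \<in> I \<Longrightarrow> locally_L1 a b (f n)"
    and q_eq: "q = random_potential I v f"
    and "\<And>\<omega> x. \<omega> \<in> space (Pi\<^sub>M I p) \<Longrightarrow> x \<in> einterval a b \<Longrightarrow> (\<lambda>n. \<omega> n * f n x) summable_on I"
    and "\<And>\<omega>. \<omega> \<in> space (Pi\<^sub>M I p) \<Longrightarrow> locally_L1 a b (q \<omega>)"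
    and "\<And>\<omega>. \<omega> \<in> space (Pi\<^sub>M I p) \<Longrightarrow> regular_left a b (q \<omega>) \<or> limit_point_left a b (q \<omega>)"
    and "\<And>\<omega>. \<omega> \<in> space (Pi\<^sub>M I p) \<Longrightarrow> regular_right a b (q \<omega>) \<or> limit_point_right a b (q \<omega>)"
    and "\<And>\<omega>. \<omega> \<in> space (Pi\<^sub>M I p) \<Longrightarrow> SL_selfadjoint a b \<alpha> \<beta> (q \<omega>)"
    and "inj idx"
    and "\<And>i. idx i \<in> I"
    and "\<And>i. a < ereal (c i) \<and> c i < d i \<and> ereal (d i) < b"
    and "disjoint_family (\<lambda>i. {c i<..<d i})"
    and "\<And>i. AE x in lebesgue. x \<in> {c i<..<d i} \<longrightarrow> f (idx i) x > 0"
    and "\<And>i x. x \<in> einterval a b \<Longrightarrow> x \<notin> {c i<..<d i} \<Longrightarrow> f (idx i) x = 0"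
    and "\<And>i r. measure (p (idx i)) {r} = 0"
    and "a \<le> a'" and "a' < b'" and "b' \<le> b"
    and "\<exists>i. {c i<..<d i} \<inter> einterval a' b' = {}"
  shows "{\<omega> \<in> space (Pi\<^sub>M I p).
            SL_eigenvalues a' b' \<alpha>' \<beta>' (q \<omega>) \<inter> SL_eigenvalues a b \<alpha> \<beta> (q \<omega>) \<noteq> {}}
         \<in> null_sets (Pi\<^sub>M I p)"
proof -
  let ?M = "Pi\<^sub>M I p"
  let ?E = "{\<omega> \<in> space ?M. SL_eigenvalues a' b' \<alpha>' \<beta>' (q \<omega>) \<inter> SL_eigenvalues a b \<alpha> \<beta> (q \<omega>) \<noteq> {}}"
  note prob = assms(4) and sets_p = assms(5) and v_loc = assms(6) and f_loc = assms(7) and summable = assms(9)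
    and q_loc = assms(10) and left = assms(11) and right = assms(12) and idx = assms(15) and cd = assms(16)
    and f_pos = assms(18) and f_zero = assms(19) and atomless = assms(20) and sub = assms(21,22,23)
  have sub_S: "einterval a' b' \<subseteq> einterval a b" by (rule einterval_mono[OF sub(1,3)])
  \<comment> \<open>A point of the smaller interval serves as common base point for the initial data
    of both operators.\<close>
  obtain x0 where x0': "x0 \<in> einterval a' b'" using einterval_nonempty[OF sub(2)] by blast
  then have x0: "x0 \<in> einterval a b" using sub_S by blast
  obtain i where i: "{c i<..<d i} \<inter> einterval a' b' = {}" using assms(24) by blast
  define j where "j = idx i"
  have j: "j \<in> I" using idx by (simp add: j_def)
  have meas: "(\<lambda>(\<omega>, x). cut a b (q \<omega>) x) \<in> borel_measurable (?M \<Otimes>\<^sub>M lebesgue)"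
    unfolding q_eq by (rule cut_random_potential_measurable[OF sets_p v_loc f_loc summable])
  have meas': "(\<lambda>(\<omega>, x). cut a' b' (q \<omega>) x) \<in> borel_measurable (?M \<Otimes>\<^sub>M lebesgue)"
    unfolding q_eq
  proof (rule cut_random_potential_measurable[OF sets_p])
    show "locally_L1 a' b' v" by (rule locally_L1_sub[OF v_loc sub(1,3)])
    show "locally_L1 a' b' (f n)" if "n \<in> I" for n by (rule locally_L1_sub[OF f_loc[OF that] sub(1,3)])
  qed (use summable sub_S in auto)
  have E: "?E \<in> sets ?M"
    by (rule common_eigenvalue_event_measurable[OF meas meas' q_loc locally_L1_sub[OF q_loc sub(1,3)] x0 x0'])
  show ?thesis
  proof (rule null_sets_PiM_coordinate[OF prob j _ _ E])
    show "sets (p j) = sets borel" using sets_p j by blast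
    show "measure (p j) {r} = 0" for r using atomless by (simp add: j_def)
    fix X assume X: "X \<in> space (Pi\<^sub>M (I - {j}) p)"
    define Q where "Q t = q (X(j := t))" for t
    \<comment> \<open>The hypotheses on the potential hold for every sample, hence along the whole
      line in direction j: t may be any real, since \<open>p j\<close> has the space of the Borel
      measure.\<close>
    have \<omega>: "X(j := t) \<in> space ?M" for t
      using X j sets_eq_imp_space_eq[OF sets_p[OF j]]
      by (auto simp: space_PiM PiE_def extensional_def Pi_def)
    have Q_diff: "Q t x - Q s x = (t - s) * f j x" if "x \<in> einterval a b" for t s x
      unfolding Q_def q_eq by (rule random_potential_fun_upd[OF j]) (rule summable[OF \<omega> that])+
    have const: "SL_eigenvalues a' b' \<alpha>' \<beta>' (Q t) = SL_eigenvalues a' b' \<alpha>' \<beta>' (Q 0)" for t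
    proof (rule SL_eigenvalues_cong[OF sub(2)])
      fix x assume x: "x \<in> einterval a' b'"
      then have "x \<in> einterval a b" "x \<notin> {c i<..<d i}" using i sub_S by blast+
      then have "f j x = 0" unfolding j_def by (rule f_zero)
      then show "Q t x = Q 0 x" using Q_diff[of x t 0] x sub_S by auto
    qed
    have "countable (SL_eigenvalues a' b' \<alpha>' \<beta>' (Q 0))"
      by (rule SL_eigenvalues_countable[OF sub(2) endpoint_left_sub[OF _ _ sub] endpoint_right_sub[OF _ _ sub]])
        (use q_loc[OF \<omega>] left[OF \<omega>] right[OF \<omega>] in \<open>simp_all add: Q_def\<close>)
    moreover have "countable {t. r \<in> SL_eigenvalues a b \<alpha> \<beta> (Q t)}" for r
    proof (rule coupling_countable[OF \<open>a < b\<close> Q_diff, where c="c i" and d="d i"])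
      show "locally_L1 a b (Q t)" "regular_left a b (Q t) \<or> limit_point_left a b (Q t)"
        "regular_right a b (Q t) \<or> limit_point_right a b (Q t)" for t
        using q_loc[OF \<omega>] left[OF \<omega>] right[OF \<omega>] by (simp_all add: Q_def)
      show "locally_L1 a b (f j)" by (rule f_loc[OF j])
      show "AE x in lebesgue. x \<in> {c i<..<d i} \<longrightarrow> 0 < f j x" using f_pos by (simp add: j_def)
      show "f j x = 0" if "x \<in> einterval a b" "x \<notin> {c i<..<d i}" for x
        using f_zero[OF that] by (simp add: j_def)
    qed (use cd[of i] in auto)
    ultimately have "countable (\<Union>r\<in>SL_eigenvalues a' b' \<alpha>' \<beta>' (Q 0). {t. r \<in> SL_eigenvalues a b \<alpha> \<beta> (Q t)})"
      by (rule countable_UN)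
    moreover have "{t. X(j := t) \<in> ?E} \<subseteq> (\<Union>r\<in>SL_eigenvalues a' b' \<alpha>' \<beta>' (Q 0). {t. r \<in> SL_eigenvalues a b \<alpha> \<beta> (Q t)})"
      using const by (auto simp flip: Q_def)
    ultimately show "countable {t. X(j := t) \<in> ?E}" by (rule countable_subset[rotated])
  qed
qed

end
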